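(* Let $0\le r\le n-1$, let $f_{r+1},\dots,f_n\in R[x_1,\dots,x_n]$, put $A=R[x_1,\dots,x_n]/(f_{r+1},\dots,f_n)$ and $\overline{A}=A\otimes_R k$, and let $\mathrm{Jac}_f$ be the $(n-r)\times n$ Jacobian matrix of $f=(f_{r+1},\dots,f_n)$. Assume that the determinants of the $(n-r)\times(n-r)$ minors of the reduction of $\mathrm{Jac}_f$ modulo $\pi$ generate the unit ideal of $\overline{A}$. Fix an $n\times(n-r)$ matrix $P$ and $(n-r)\times(n-r)$ matrices $\Delta^{r+1},\dots,\Delta^n$, all with entries in $R[x_1,\dots,x_n]$, such that $$\mathrm{Jac}_f\cdot P\equiv \mathrm{Id}_{n-r}+\sum_{j=r+1}^n f_j\,\Delta^j \pmod{\pi}.$$ Let $\mathbf{S}=(S_{r+1},\dots,S_n)$ be a column vector of variables and let $$G(\mathbf{S})=f^{\sigma}\bigl(\psi(\mathbf{x})+\psi(P)\mathbf{S}\bigr)-f^{p'}-\sum_{j=r+1}^n f_j^{p'}\,\psi(\Delta^j)\,\mathbf{S}.$$ Then there exists a unique lift of the $p'$-power map on $\overline{A}$ to a $\sigma$-semi-linear endomorphism $\phi$ of $R\langle\mathbf{x}\rangle/(f_{r+1},\dots,f_n)$ of the form $$\phi(\mathbf{x})=\psi(\mathbf{x})+\psi(P)\,\mathbf{s}$$ with $\mathbf{s}$ in $(\pi R\langle\mathbf{x}\rangle)^{n-r}$ satisfying $G(\mathbf{s})=0$.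
   Context: $K$ is a finite Galois extension of $\mathbb{Q}_p$ with ramification index $e$, valuation ring $R$, uniformizer $\pi$ and finite residue field $k=R/\pi R$. $\sigma$ is an automorphism of $K$ whose induced map on $k$ is $x\mapsto x^{p'}$, where $p'$ is a positive power of $p$. $\mathbf{x}=(x_1,\dots,x_n)$ (as a column vector where appropriate). $R\langle\mathbf{x}\rangle$ is the ring of formal power series in $x_1,\dots,x_n$ with coefficients in $R$ tending to $0$. $\psi$ is the $\sigma$-linear endomorphism of $R\langle\mathbf{x}\rangle$ that sends each $x_i$ to $x_i^{p'}$, so $\psi(g)(\mathbf{x})=g^\sigma(x_1^{p'},\dots,x_n^{p'})$, where the superscript $\sigma$ means applying $\sigma$ to the coefficients; $\psi$ is applied to matrices and vectors entrywise. $f^\sigma$ is the column vector $(f_{r+1}^\sigma,\dots,f_n^\sigma)$ and $f^{p'}$ the column vector $(f_{r+1}^{p'},\dots,f_n^{p'})$. $G(\mathbf S)$ is thus a column vector of length $n-r$ with entries in $R\langle\mathbf{x}\rangle[\mathbf S]$. That $\phi$ has the stated form means that it is induced by the $\sigma$-semi-linear map $g(\mathbf{x})\mapsto g^\sigma(\psi(\mathbf{x})+\psi(P)\mathbf{s})$. *)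

theory Defs
  imports
    "HOL-Analysis.Abstract_Metric_Spaces"
    "HOL-Algebra.QuotRing"
    "HOL-Algebra.Embedded_Algebras"
    "Jordan_Normal_Form.Determinant"
    "Jordan_Normal_Form.DL_Submatrix"
    "Jordan_Normal_Form.VS_Connect"
begin

unbundle no vec_syntax

section \<open>Finite Galois extensions of the field of p-adic numbers\<close>

definition padic_abs :: "nat \<Rightarrow> rat \<Rightarrow> real" where
  "padic_abs p x = (if x = 0 then 0 else
     real p powi (int (multiplicity (int p) (snd (quotient_of x)))
                  - int (multiplicity (int p) (fst (quotient_of x)))))"

text \<open>
  A subset \<open>S\<close> of a type of class \<open>comm_ring_1\<close>, seen as a ring with the operations of the type.
\<close>

abbreviation ring_on :: "'a::comm_ring_1 set \<Rightarrow> 'a ring" where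
  "ring_on S \<equiv> class_ring\<lparr>carrier := S\<rparr>"

definition valuation_ring :: "('k::field \<Rightarrow> real) \<Rightarrow> 'k set" where
  "valuation_ring v = {a. v a \<le> 1}"

text \<open>
  The field \<open>K\<close> is the type \<open>'k\<close> with the absolute value \<open>v\<close> that extends the p-adic one.
  Its subfield \<open>Qp\<close> is the field of p-adic numbers, i.e. the completion of the rational numbers
  at \<open>p\<close>: complete, containing the rationals densely, and with the p-adic absolute value on
  them. The extension is Galois in the sense that \<open>Qp\<close> is the fixed field of its
  automorphism group.
\<close>

locale padic_galois_extension =
  fixes p :: nat and Qp :: "'k::field_char_0 set" and v :: "'k \<Rightarrow> real"
    and \<pi> :: 'k and e :: nat
  assumes prime: "prime p"
    and abs_nonneg: "v a \<ge> 0"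
    and abs_eq_0: "v a = 0 \<longleftrightarrow> a = 0"
    and abs_mult: "v (a * b) = v a * v b"
    and abs_add: "v (a + b) \<le> max (v a) (v b)"
    and abs_of_rat: "v (of_rat x) = padic_abs p x"
    and Qp_subfield: "subfield Qp (class_ring :: 'k ring)"
    and Qp_dense: "a \<in> Qp \<Longrightarrow> \<epsilon> > 0 \<Longrightarrow> \<exists>x::rat. v (a - of_rat x) < \<epsilon>"
    and Qp_complete: "Metric_space.mcomplete Qp (\<lambda>a b. v (a - b))"
    and finite_extension:
      "ring.finite_dimension (class_ring :: 'k ring) Qp UNIV"
    and galois:
      "{a. \<forall>\<tau>\<in>ring_iso class_ring (class_ring :: 'k ring).
            (\<forall>c\<in>Qp. \<tau> c = c) \<longrightarrow> \<tau> a = a} = Qp"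
    and uniformizer: "PIdl\<^bsub>ring_on (valuation_ring v)\<^esub> \<pi> = {a. v a < 1}"
    and ramification_index: "v (of_nat p) = v \<pi> ^ e"

definition residue_field :: "('k::field \<Rightarrow> real) \<Rightarrow> 'k \<Rightarrow> 'k set ring" where
  "residue_field v \<pi> =
     ring_on (valuation_ring v) Quot (PIdl\<^bsub>ring_on (valuation_ring v)\<^esub> \<pi>)"

definition automorphism_inducing_power ::
    "('k::field \<Rightarrow> real) \<Rightarrow> 'k \<Rightarrow> nat \<Rightarrow> ('k \<Rightarrow> 'k) \<Rightarrow> bool" where
  "automorphism_inducing_power v \<pi> p' \<sigma> \<longleftrightarrow>
     \<sigma> \<in> ring_iso class_ring class_ring \<and>
     (let R = ring_on (valuation_ring v); I = PIdl\<^bsub>R\<^esub> \<pi> in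
      \<forall>a\<in>valuation_ring v. \<sigma> a \<in> valuation_ring v \<and>
        I +>\<^bsub>R\<^esub> \<sigma> a = (I +>\<^bsub>R\<^esub> a) [^]\<^bsub>residue_field v \<pi>\<^esub> p')"


section \<open>Multivariate formal power series\<close>

text \<open>
  The multiset \<open>{#i\<^sub>1, \<dots>, i\<^sub>d#}\<close> stands for the monomial in which the variable of index \<open>i\<close> has
  the multiplicity of \<open>i\<close> as its exponent.
\<close>

typedef (overloaded) 'a mps = "UNIV :: (nat multiset \<Rightarrow> 'a::comm_ring_1) set"
  morphisms mcoeff Abs_mps ..

setup_lifting type_definition_mps

lemma mps_eqI: "(\<And>m. mcoeff f m = mcoeff g m) \<Longrightarrow> f = g"
  by transfer auto

lemma finite_submultisets: "finite {a. a \<subseteq># (m :: 'b multiset)}"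
proof (rule finite_subset)
  show "{a. a \<subseteq># m} \<subseteq> {a. set_mset a \<subseteq> set_mset m \<and> size a \<le> size m}"
    by (auto simp: size_mset_mono dest: mset_subset_eqD)
  have "{a. set_mset a \<subseteq> set_mset m \<and> size a \<le> size m}
      \<subseteq> mset ` {xs. set xs \<subseteq> set_mset m \<and> length xs \<le> size m}"
  proof
    fix a assume "a \<in> {a. set_mset a \<subseteq> set_mset m \<and> size a \<le> size m}"
    moreover obtain xs where "a = mset xs" by (metis ex_mset)
    ultimately show "a \<in> mset ` {xs. set xs \<subseteq> set_mset m \<and> length xs \<le> size m}" by auto
  qed
  thus "finite {a. set_mset a \<subseteq> set_mset m \<and> size a \<le> size m}"
    by (rule finite_subset) (intro finite_imageI finite_lists_length_le finite_set_mset)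
qed

instantiation mps :: (comm_ring_1) comm_ring_1
begin

lift_definition zero_mps :: "'a mps" is "\<lambda>_. 0" .
lift_definition one_mps :: "'a mps" is "\<lambda>m. if m = {#} then 1 else 0" .
lift_definition plus_mps :: "'a mps \<Rightarrow> 'a mps \<Rightarrow> 'a mps" is "\<lambda>f g m. f m + g m" .
lift_definition minus_mps :: "'a mps \<Rightarrow> 'a mps \<Rightarrow> 'a mps" is "\<lambda>f g m. f m - g m" .
lift_definition uminus_mps :: "'a mps \<Rightarrow> 'a mps" is "\<lambda>f m. - f m" .
lift_definition times_mps :: "'a mps \<Rightarrow> 'a mps \<Rightarrow> 'a mps" is
  "\<lambda>f g m. \<Sum>a | a \<subseteq># m. f a * g (m - a)" .

instance
proof
  fix f g h :: "'a mps"
  show "f * g * h = f * (g * h)"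
  proof (transfer, rule ext)
    fix f g h :: "nat multiset \<Rightarrow> 'a" and m :: "nat multiset"
    have "(\<Sum>a | a \<subseteq># m. (\<Sum>b | b \<subseteq># a. f b * g (a - b)) * h (m - a))
        = (\<Sum>(a, b)\<in>(SIGMA a:{a. a \<subseteq># m}. {b. b \<subseteq># a}). f b * g (a - b) * h (m - a))"
      by (simp add: sum_distrib_right sum.Sigma finite_submultisets)
    also have "\<dots> = (\<Sum>(b, c)\<in>(SIGMA b:{b. b \<subseteq># m}. {c. c \<subseteq># m - b}).
        f b * (g c * h (m - b - c)))"
    proof (rule sum.reindex_bij_witness[of _ "\<lambda>(b, c). (b + c, b)" "\<lambda>(a, b). (b, a - b)"],
        goal_cases)
      case (2 ab)
      thus ?case
        by (auto intro: subset_mset.order_trans simp: subset_eq_diff_conv)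
    next
      case (4 bc)
      thus ?case
        by (auto simp: subset_mset.le_diff_conv2 add.commute)
    qed (auto simp: mult.assoc)
    also have "\<dots> = (\<Sum>b | b \<subseteq># m. f b * (\<Sum>c | c \<subseteq># m - b. g c * h (m - b - c)))"
      by (simp add: sum_distrib_left sum.Sigma finite_submultisets)
    finally show "(\<Sum>a | a \<subseteq># m. (\<Sum>b | b \<subseteq># a. f b * g (a - b)) * h (m - a)) = \<dots>" .
  qed
  show "f * g = g * f"
  proof (transfer, rule ext)
    fix f g :: "nat multiset \<Rightarrow> 'a" and m :: "nat multiset"
    have double_diff: "m - (m - a) = a" if "a \<subseteq># m" for a
    proof -
      have "(m - a) + a - (m - a) = a" by (rule add_diff_cancel_left')
      thus ?thesis by (simp add: subset_mset.diff_add[OF that])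
    qed
    show "(\<Sum>a | a \<subseteq># m. f a * g (m - a)) = (\<Sum>a | a \<subseteq># m. g a * f (m - a))"
      by (rule sum.reindex_bij_witness[of _ "\<lambda>a. m - a" "\<lambda>a. m - a"])
         (simp_all add: double_diff mult.commute)
  qed
  show "1 * f = f"
  proof (transfer, rule ext)
    fix f :: "nat multiset \<Rightarrow> 'a" and m :: "nat multiset"
    have "(\<Sum>a | a \<subseteq># m. (if a = {#} then 1 else 0) * f (m - a))
        = (\<Sum>a\<in>{{#}}. (if a = {#} then 1 else 0) * f (m - a))"
      by (rule sum.mono_neutral_right) (auto simp: finite_submultisets)
    thus "(\<Sum>a | a \<subseteq># m. (if a = {#} then 1 else 0) * f (m - a)) = f m"
      by simp
  qed
  show "(f + g) * h = f * h + g * h"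
    by transfer (simp add: distrib_right sum.distrib)
  show "(0 :: 'a mps) \<noteq> 1"
    by transfer (auto dest: fun_cong[of _ _ "{#}"])
qed (transfer; force simp: add.assoc add.commute)+

end

lift_definition mconst :: "'a::comm_ring_1 \<Rightarrow> 'a mps" is
  "\<lambda>c m. if m = {#} then c else 0" .

lift_definition mvar :: "nat \<Rightarrow> 'a::comm_ring_1 mps" is
  "\<lambda>i m. if m = {#i#} then 1 else 0" .

lift_definition mderiv :: "nat \<Rightarrow> 'a::comm_ring_1 mps \<Rightarrow> 'a mps" is
  "\<lambda>i f m. of_nat (count m i + 1) * f (add_mset i m)" .

text \<open>
  \<open>mpoly_eval h y f\<close> is the value at \<open>y\<close> of the polynomial (i.e. finitely supported power
  series) \<open>f\<close> after \<open>h\<close> has been applied to its coefficients.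
\<close>

definition mpoly_eval ::
    "('a::comm_ring_1 \<Rightarrow> 'b::comm_ring_1) \<Rightarrow> (nat \<Rightarrow> 'b) \<Rightarrow> 'a mps \<Rightarrow> 'b" where
  "mpoly_eval h y f = (\<Sum>m | mcoeff f m \<noteq> 0. h (mcoeff f m) * (\<Prod>i\<in>#m. y i))"


section \<open>Restricted power series and polynomials over the valuation ring\<close>

text \<open>
  Variables and equations are numbered from 0: index \<open>i < n\<close> stands for \<open>x\<^sub>i\<^sub>+\<^sub>1\<close>, and index
  \<open>j < n - r\<close> for \<open>f\<^sub>r\<^sub>+\<^sub>1\<^sub>+\<^sub>j\<close>.
\<close>

definition tate :: "nat \<Rightarrow> ('k::field \<Rightarrow> real) \<Rightarrow> 'k mps set" where
  "tate n v = {g. (\<forall>m. mcoeff g m \<in> valuation_ring v) \<and>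
                  (\<forall>m. mcoeff g m \<noteq> 0 \<longrightarrow> set_mset m \<subseteq> {..<n}) \<and>
                  (\<forall>\<epsilon>>0. finite {m. v (mcoeff g m) \<ge> \<epsilon>})}"

definition polys :: "nat \<Rightarrow> ('k::field \<Rightarrow> real) \<Rightarrow> 'k mps set" where
  "polys n v = {g \<in> tate n v. finite {m. mcoeff g m \<noteq> 0}}"

definition pi_multiples :: "'k::field \<Rightarrow> 'k mps set \<Rightarrow> 'k mps set" where
  "pi_multiples \<pi> S = (\<lambda>g. mconst \<pi> * g) ` S"

text \<open>
  \<open>g\<^sup>\<sigma>(y)\<close> for a restricted power series \<open>g\<close> and \<open>y\<close> in \<open>R\<langle>x\<rangle>\<^sup>n\<close>: the sum of its terms
  in the Gauss norm, i.e. uniformly in the coefficients.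
\<close>

definition tate_subst ::
    "nat \<Rightarrow> ('k::field \<Rightarrow> real) \<Rightarrow> ('k \<Rightarrow> 'k) \<Rightarrow> (nat \<Rightarrow> 'k mps) \<Rightarrow> 'k mps \<Rightarrow> 'k mps" where
  "tate_subst n v \<sigma> y g = (THE h. h \<in> tate n v \<and>
     (\<forall>\<epsilon>>0. \<exists>M. finite M \<and> (\<forall>M'. finite M' \<and> M \<subseteq> M' \<longrightarrow>
        (\<forall>l. v (mcoeff (h - (\<Sum>m\<in>M'. mconst (\<sigma> (mcoeff g m)) * (\<Prod>i\<in>#m. y i))) l) < \<epsilon>))))"

definition psi :: "nat \<Rightarrow> ('k::field \<Rightarrow> real) \<Rightarrow> ('k \<Rightarrow> 'k) \<Rightarrow> nat \<Rightarrow> 'k mps \<Rightarrow> 'k mps" where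
  "psi n v \<sigma> p' = tate_subst n v \<sigma> (\<lambda>i. mvar i ^ p')"

abbreviation var_vec :: "nat \<Rightarrow> 'a::comm_ring_1 mps vec" where
  "var_vec n \<equiv> vec n mvar"


section \<open>The algebras and their reductions\<close>

definition poly_ideal ::
    "nat \<Rightarrow> ('k::field \<Rightarrow> real) \<Rightarrow> 'k mps vec \<Rightarrow> 'k mps set" where
  "poly_ideal n v f = Idl\<^bsub>ring_on (polys n v)\<^esub> (set\<^sub>v f)"

definition tate_ideal ::
    "nat \<Rightarrow> ('k::field \<Rightarrow> real) \<Rightarrow> 'k mps vec \<Rightarrow> 'k mps set" where
  "tate_ideal n v f = Idl\<^bsub>ring_on (tate n v)\<^esub> (set\<^sub>v f)"

definition poly_quot ::
    "nat \<Rightarrow> ('k::field \<Rightarrow> real) \<Rightarrow> 'k mps vec \<Rightarrow> 'k mps set ring" where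
  "poly_quot n v f = ring_on (polys n v) Quot poly_ideal n v f"

definition tate_quot ::
    "nat \<Rightarrow> ('k::field \<Rightarrow> real) \<Rightarrow> 'k mps vec \<Rightarrow> 'k mps set ring" where
  "tate_quot n v f = ring_on (tate n v) Quot tate_ideal n v f"

definition poly_class ::
    "nat \<Rightarrow> ('k::field \<Rightarrow> real) \<Rightarrow> 'k mps vec \<Rightarrow> 'k mps \<Rightarrow> 'k mps set" where
  "poly_class n v f g = poly_ideal n v f +>\<^bsub>ring_on (polys n v)\<^esub> g"

definition tate_class ::
    "nat \<Rightarrow> ('k::field \<Rightarrow> real) \<Rightarrow> 'k mps vec \<Rightarrow> 'k mps \<Rightarrow> 'k mps set" where
  "tate_class n v f g = tate_ideal n v f +>\<^bsub>ring_on (tate n v)\<^esub> g"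

text \<open>
  With \<open>A = R[x]/(f)\<close>, the base change of \<open>A\<close> to the residue field \<open>R/\<pi>R\<close> is \<open>A/\<pi>A\<close>;
  \<open>special_class\<close> is the reduction map from \<open>R[x]\<close> to it.
\<close>

definition special_ideal ::
    "nat \<Rightarrow> ('k::field \<Rightarrow> real) \<Rightarrow> 'k \<Rightarrow> 'k mps vec \<Rightarrow> 'k mps set set" where
  "special_ideal n v \<pi> f = PIdl\<^bsub>poly_quot n v f\<^esub> (poly_class n v f (mconst \<pi>))"

definition special_fibre ::
    "nat \<Rightarrow> ('k::field \<Rightarrow> real) \<Rightarrow> 'k \<Rightarrow> 'k mps vec \<Rightarrow> 'k mps set set ring" where
  "special_fibre n v \<pi> f = poly_quot n v f Quot special_ideal n v \<pi> f"

definition special_class ::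
    "nat \<Rightarrow> ('k::field \<Rightarrow> real) \<Rightarrow> 'k \<Rightarrow> 'k mps vec \<Rightarrow> 'k mps \<Rightarrow> 'k mps set set" where
  "special_class n v \<pi> f h =
     special_ideal n v \<pi> f +>\<^bsub>poly_quot n v f\<^esub> poly_class n v f h"

text \<open>
  Every restricted power series is congruent to a polynomial modulo \<open>\<pi>\<close>, and the reduction of
  its class in \<open>R\<langle>x\<rangle>/(f)\<close> is the reduction of that polynomial.
\<close>

definition tate_reduction ::
    "nat \<Rightarrow> ('k::field \<Rightarrow> real) \<Rightarrow> 'k \<Rightarrow> 'k mps vec \<Rightarrow> 'k mps set \<Rightarrow> 'k mps set set" where
  "tate_reduction n v \<pi> f b = the_elem
     {special_class n v \<pi> f h | g h.
        g \<in> b \<and> h \<in> polys n v \<and> g - h \<in> pi_multiples \<pi> (tate n v)}"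

definition lifts_power_map ::
    "nat \<Rightarrow> ('k::field \<Rightarrow> real) \<Rightarrow> 'k \<Rightarrow> nat \<Rightarrow> 'k mps vec \<Rightarrow> ('k mps set \<Rightarrow> 'k mps set) \<Rightarrow> bool"
  where
  "lifts_power_map n v \<pi> p' f \<phi> \<longleftrightarrow>
     (\<forall>b\<in>carrier (tate_quot n v f).
        tate_reduction n v \<pi> f (\<phi> b)
          = tate_reduction n v \<pi> f b [^]\<^bsub>special_fibre n v \<pi> f\<^esub> p')"

text \<open>
  Extensionality makes \<open>\<phi>\<close> determined by its values on the carrier.
\<close>

definition semilinear_endo ::
    "nat \<Rightarrow> ('k::field \<Rightarrow> real) \<Rightarrow> ('k \<Rightarrow> 'k) \<Rightarrow> 'k mps vec \<Rightarrow> ('k mps set \<Rightarrow> 'k mps set) \<Rightarrow> bool"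
  where
  "semilinear_endo n v \<sigma> f \<phi> \<longleftrightarrow>
     \<phi> \<in> extensional (carrier (tate_quot n v f)) \<and>
     \<phi> \<in> Ring.ring_hom (tate_quot n v f) (tate_quot n v f) \<and>
     (\<forall>a\<in>valuation_ring v. \<forall>b\<in>carrier (tate_quot n v f).
        \<phi> (tate_class n v f (mconst a) \<otimes>\<^bsub>tate_quot n v f\<^esub> b)
          = tate_class n v f (mconst (\<sigma> a)) \<otimes>\<^bsub>tate_quot n v f\<^esub> \<phi> b)"


section \<open>The Jacobian matrix and the equation for the lift\<close>

definition jacobian :: "nat \<Rightarrow> 'a::comm_ring_1 mps vec \<Rightarrow> 'a mps mat" where
  "jacobian n f = mat (dim_vec f) n (\<lambda>(j, i). mderiv i (f $ j))"

definition maximal_minors :: "'a::comm_ring_1 mat \<Rightarrow> 'a set" where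
  "maximal_minors M = {det (submatrix M {..<dim_row M} I) | I.
     I \<subseteq> {..<dim_col M} \<and> card I = dim_row M}"

definition psi_shift ::
    "nat \<Rightarrow> ('k::field \<Rightarrow> real) \<Rightarrow> ('k \<Rightarrow> 'k) \<Rightarrow> nat \<Rightarrow> 'k mps mat \<Rightarrow> 'k mps vec \<Rightarrow> 'k mps vec"
  where
  "psi_shift n v \<sigma> p' P s =
     map_vec (psi n v \<sigma> p') (var_vec n) + map_mat (psi n v \<sigma> p') P *\<^sub>v s"

text \<open>
  The entries of \<open>G\<close> are polynomials in the variables \<open>S\<close> over \<open>R\<langle>x\<rangle>\<close>: the outer series
  variables are the \<open>S\<close>, the inner ones the \<open>x\<close>.
\<close>

definition lift_equation ::
    "nat \<Rightarrow> ('k::field \<Rightarrow> real) \<Rightarrow> ('k \<Rightarrow> 'k) \<Rightarrow> nat \<Rightarrow> 'k mps vec \<Rightarrow> 'k mps mat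
      \<Rightarrow> (nat \<Rightarrow> 'k mps mat) \<Rightarrow> 'k mps mps vec" where
  "lift_equation n v \<sigma> p' f P \<Delta> =
     (let d = dim_vec f;
          \<psi> = psi n v \<sigma> p';
          S = var_vec d;
          Y = map_vec mconst (map_vec \<psi> (var_vec n)) + map_mat mconst (map_mat \<psi> P) *\<^sub>v S
      in map_vec (mpoly_eval (\<lambda>a. mconst (mconst (\<sigma> a))) (\<lambda>i. Y $ i)) f
         - map_vec (\<lambda>g. mconst (g ^ p')) f
         - vec d (\<lambda>a. \<Sum>j<d. mconst ((f $ j) ^ p') *
                            (map_mat mconst (map_mat \<psi> (\<Delta> j)) *\<^sub>v S) $ a))"

definition lift_equation_at ::
    "'a::comm_ring_1 mps vec \<Rightarrow> 'a vec \<Rightarrow> 'a vec" where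
  "lift_equation_at G s = map_vec (mpoly_eval id (\<lambda>j. s $ j)) G"

end

theory Submission
  imports Defs
begin

text \<open>
  Since \<open>\<psi>\<close> lifts the \<open>p'\<close>-power map, the congruence satisfied by \<open>Jac\<^sub>f P\<close> says that \<open>G(0)\<close>
  vanishes modulo \<open>\<pi>\<close> and that the derivative of \<open>G\<close> at any point of \<open>(\<pi>R\<langle>x\<rangle>)\<^sup>n\<^sup>-\<^sup>r\<close> is the identity
  modulo \<open>\<pi>\<close>. Hence \<open>s \<mapsto> s - G(s)\<close> is a \<open>\<pi>\<close>-adic contraction there, and \<open>G\<close> has exactly one
  root \<open>s\<close>, because \<open>R\<langle>x\<rangle>\<close> is \<open>\<pi>\<close>-adically complete. For this \<open>s\<close> the substitution
  \<open>x \<mapsto> \<psi>(x) + \<psi>(P)s\<close> sends \<open>f\<close> to \<open>f\<^bsup>p'\<^esup> + \<Sum>\<^sub>j f\<^sub>j\<^bsup>p'\<^esup> \<psi>(\<Delta>\<^sup>j) s\<close>, so it preserves the ideal \<open>(f)\<close>,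
  and it is congruent to the \<open>p'\<close>-power map modulo \<open>\<pi>\<close>.
\<close>

section \<open>Multivariate power series and polynomial evaluation\<close>

text \<open>Completeness is given for \<open>Qp\<close> only, while the fixed point needs limits in
  K; it is carried along a chain of \<open>Qp\<close>-subspaces from 0 up to K. Sizes are measured
  by a filtration \<open>fil k\<close> of all power series, kept apart from membership in R<x>, so
  that congruences can be computed without tracking convergence. Substitution into a restricted
  series is a described limit; its laws are transferred from polynomials by approximation. Both
  congruences rest on one fact: modulo \<pi>, f^\<sigma>(x^p') and f^p' are the same sum of p'-th
  powers of the terms of f. This settles G(0) and explains the correction term of G. Applying \<psi>
  to the congruence for Jac P leaves the summands \<psi>(f_j) \<psi>(\<Delta>^j) beside the
  identity. Replacing \<psi>(f_j) by f_j^p' changes them only by multiples of \<pi>, and f_j^p'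
  visibly lies in the ideal (f). So one and the same correction normalises the derivative to the
  identity and keeps the image of f inside (f) at a root.\<close>

lemma mcoeff_zero [simp]: "mcoeff 0 m = 0" by transfer simp
lemma mcoeff_one: "mcoeff 1 m = (if m = {#} then 1 else 0)" by transfer simp
lemma mcoeff_add [simp]: "mcoeff (f + g) m = mcoeff f m + mcoeff g m" by transfer simp
lemma mcoeff_diff [simp]: "mcoeff (f - g) m = mcoeff f m - mcoeff g m" by transfer simp
lemma mcoeff_uminus [simp]: "mcoeff (- f) m = - mcoeff f m" by transfer simp
lemma mcoeff_mult: "mcoeff (f * g) m = (\<Sum>a | a \<subseteq># m. mcoeff f a * mcoeff g (m - a))"
  by transfer simp
lemma mcoeff_const: "mcoeff (mconst c) m = (if m = {#} then c else 0)" by transfer simp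
lemma mcoeff_var: "mcoeff (mvar i) m = (if m = {#i#} then 1 else 0)" by transfer simp
lemma mcoeff_deriv: "mcoeff (mderiv i f) m = of_nat (count m i + 1) * mcoeff f (add_mset i m)"
  by transfer simp
lemma mcoeff_sum: "mcoeff (sum F A) m = (\<Sum>x\<in>A. mcoeff (F x) m)"
  by (induction A rule: infinite_finite_induct) auto

lemma mcoeff_const_mult [simp]: "mcoeff (mconst c * g) m = c * mcoeff g m"
proof -
  have "mcoeff (mconst c * g) m = (\<Sum>a | a \<subseteq># m. if a = {#} then c * mcoeff g m else 0)"
    unfolding mcoeff_mult by (intro sum.cong) (auto simp: mcoeff_const)
  thus ?thesis by (simp add: finite_submultisets)
qed

text \<open>The single term c x^m. Products of such terms are explicit, so identities for finitely
  supported series can be checked on terms instead of on convolution sums.\<close>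

lift_definition mmonom :: "nat multiset \<Rightarrow> 'a::comm_ring_1 \<Rightarrow> 'a mps" is
  "\<lambda>m c l. if l = m then c else 0" .

lemma mcoeff_monom: "mcoeff (mmonom m c) l = (if l = m then c else 0)" by transfer simp

lemma mmonom_mult: "mmonom a c * mmonom b d = mmonom (a + b) (c * d)"
proof (rule mps_eqI)
  fix m
  have "mcoeff (mmonom a c * mmonom b d) m
      = (\<Sum>x | x \<subseteq># m. if x = a then (if m = a + b then c * d else 0) else 0)"
    unfolding mcoeff_mult by (intro sum.cong) (auto simp: mcoeff_monom)
  also have "\<dots> = mcoeff (mmonom (a + b) (c * d)) m"
    by (auto simp: finite_submultisets mcoeff_monom)
  finally show "mcoeff (mmonom a c * mmonom b d) m = mcoeff (mmonom (a + b) (c * d)) m" .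
qed

lemma mconst_conv_monom: "mconst c = mmonom {#} c"
  by (rule mps_eqI) (simp add: mcoeff_const mcoeff_monom)
lemma mvar_conv_monom: "mvar i = mmonom {#i#} 1"
  by (rule mps_eqI) (simp add: mcoeff_var mcoeff_monom)

lemma comm_ring_hom_mconst: "comm_ring_hom (mconst :: 'a::comm_ring_1 \<Rightarrow> 'a mps)"
proof
  fix x y :: 'a
  show "mconst (x * y) = mconst x * mconst y" by (rule mps_eqI) (simp add: mcoeff_const)
qed (rule mps_eqI; simp add: mcoeff_const mcoeff_one)+

interpretation mconst: comm_ring_hom "mconst :: 'a::comm_ring_1 \<Rightarrow> 'a mps"
  by (rule comm_ring_hom_mconst)

lemma prod_mset_mvar: "(\<Prod>i\<in>#m. mvar i) = mmonom m 1"
  by (induction m) (auto simp: mvar_conv_monom mmonom_mult mconst_conv_monom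
      simp flip: mconst.hom_one)

text \<open>\<open>mpoly_eval\<close> sums over the support, and a sum over an infinite set is 0, so
  its laws are stated under this predicate. In contrast to \<open>polys\<close> it puts no condition
  on the coefficients and therefore also applies to \<open>'k mps mps\<close>, where the lift
  equation lives.\<close>

definition finsupp :: "'a::comm_ring_1 mps \<Rightarrow> bool" where
  "finsupp f \<longleftrightarrow> finite {m. mcoeff f m \<noteq> 0}"

lemma finsupp_zero [simp]: "finsupp 0" by (simp add: finsupp_def)
lemma finsupp_monom [simp]: "finsupp (mmonom m c)"
  unfolding finsupp_def by (rule finite_subset[of _ "{m}"]) (auto simp: mcoeff_monom)
lemma finsupp_const [simp]: "finsupp (mconst c)" by (simp add: mconst_conv_monom)
lemma finsupp_var [simp]: "finsupp (mvar c)" by (simp add: mvar_conv_monom)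
lemma finsupp_one [simp]: "finsupp 1" by (simp flip: mconst.hom_one)
lemma finsupp_add [simp]: "finsupp f \<Longrightarrow> finsupp g \<Longrightarrow> finsupp (f + g)"
  unfolding finsupp_def
  by (rule finite_subset[of _ "{m. mcoeff f m \<noteq> 0} \<union> {m. mcoeff g m \<noteq> 0}"]) auto
lemma finsupp_uminus [simp]: "finsupp f \<Longrightarrow> finsupp (- f)"
  unfolding finsupp_def by simp
lemma finsupp_diff [simp]: "finsupp f \<Longrightarrow> finsupp g \<Longrightarrow> finsupp (f - g)"
  using finsupp_add[of f "- g"] by simp
lemma finsupp_sum: "(\<And>x. x \<in> A \<Longrightarrow> finsupp (F x)) \<Longrightarrow> finsupp (sum F A)"
  by (induction A rule: infinite_finite_induct) auto

lemma sum_monomials: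
  assumes "finite M" "{m. mcoeff f m \<noteq> 0} \<subseteq> M"
  shows "(\<Sum>m\<in>M. mmonom m (mcoeff f m)) = f"
proof (rule mps_eqI)
  fix l
  have "mcoeff (\<Sum>m\<in>M. mmonom m (mcoeff f m)) l = (\<Sum>m\<in>M. if m = l then mcoeff f l else 0)"
    unfolding mcoeff_sum by (intro sum.cong) (auto simp: mcoeff_monom)
  thus "mcoeff (\<Sum>m\<in>M. mmonom m (mcoeff f m)) l = mcoeff f l"
    using assms by auto
qed

lemma finsupp_mult [simp]: assumes "finsupp f" "finsupp g" shows "finsupp (f * g)"
proof -
  let ?A = "{m. mcoeff f m \<noteq> 0}" and ?B = "{m. mcoeff g m \<noteq> 0}"
  have "f * g = (\<Sum>a\<in>?A. mmonom a (mcoeff f a)) * (\<Sum>b\<in>?B. mmonom b (mcoeff g b))"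
    using assms by (simp add: sum_monomials finsupp_def)
  thus ?thesis
    by (simp add: sum_product finsupp_sum mmonom_mult)
qed

lemma finsupp_power [simp]: "finsupp f \<Longrightarrow> finsupp (f ^ k)"
  by (induction k) auto
lemma finsupp_prod_mset: "(\<And>i. i \<in># m \<Longrightarrow> finsupp (y i)) \<Longrightarrow> finsupp (\<Prod>i\<in>#m. y i)"
  by (induction m) auto

lemma finsupp_deriv [simp]: assumes "finsupp f" shows "finsupp (mderiv i f)"
proof -
  have "{m. mcoeff (mderiv i f) m \<noteq> 0} \<subseteq> (\<lambda>m. m - {#i#}) ` {m. mcoeff f m \<noteq> 0}"
  proof
    fix m assume "m \<in> {m. mcoeff (mderiv i f) m \<noteq> 0}"
    hence "add_mset i m \<in> {m. mcoeff f m \<noteq> 0}" "m = add_mset i m - {#i#}"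
      by (auto simp: mcoeff_deriv)
    thus "m \<in> (\<lambda>m. m - {#i#}) ` {m. mcoeff f m \<noteq> 0}" by blast
  qed
  thus ?thesis using assms finite_subset unfolding finsupp_def by blast
qed

section \<open>Evaluation of polynomials along a homomorphism of the coefficients\<close>

context comm_ring_hom begin

text \<open>Coefficients 0 are mapped to 0, so the index set may grow; this lets series with
  different supports be summed over a common set.\<close>

lemma mpoly_eval_superset:
  assumes "finite M" "{m. mcoeff f m \<noteq> 0} \<subseteq> M"
  shows "mpoly_eval hom y f = (\<Sum>m\<in>M. hom (mcoeff f m) * (\<Prod>i\<in>#m. y i))"
  unfolding mpoly_eval_def by (rule sum.mono_neutral_left) (use assms in auto)

lemma mpoly_eval_monom: "mpoly_eval hom y (mmonom m c) = hom c * (\<Prod>i\<in>#m. y i)"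
  by (subst mpoly_eval_superset[of "{m}"]) (auto simp: mcoeff_monom)

lemma mpoly_eval_zero: "mpoly_eval hom y 0 = 0" by (simp add: mpoly_eval_def)

lemma mpoly_eval_const: "mpoly_eval hom y (mconst c) = hom c"
  by (simp add: mconst_conv_monom mpoly_eval_monom)

lemma mpoly_eval_var: "mpoly_eval hom y (mvar i) = y i"
  by (simp add: mvar_conv_monom mpoly_eval_monom)

lemma mpoly_eval_add:
  assumes "finsupp f" "finsupp g"
  shows "mpoly_eval hom y (f + g) = mpoly_eval hom y f + mpoly_eval hom y g"
proof -
  let ?M = "{m. mcoeff f m \<noteq> 0} \<union> {m. mcoeff g m \<noteq> 0}"
  have fin: "finite ?M" using assms by (simp add: finsupp_def)
  show ?thesis
    by (subst (1 2 3) mpoly_eval_superset[of ?M])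
       (auto simp: fin[simplified] hom_add distrib_right sum.distrib)
qed

lemma mpoly_eval_uminus: "mpoly_eval hom y (- f) = - mpoly_eval hom y f"
  by (simp add: mpoly_eval_def sum_negf hom_uminus)

lemma mpoly_eval_diff:
  "finsupp f \<Longrightarrow> finsupp g \<Longrightarrow> mpoly_eval hom y (f - g) = mpoly_eval hom y f - mpoly_eval hom y g"
  using mpoly_eval_add[of f "- g" y] by (simp add: mpoly_eval_uminus)

lemma mpoly_eval_sum:
  "(\<And>x. x \<in> A \<Longrightarrow> finsupp (F x)) \<Longrightarrow> mpoly_eval hom y (sum F A) = (\<Sum>x\<in>A. mpoly_eval hom y (F x))"
  by (induction A rule: infinite_finite_induct)
     (auto simp: mpoly_eval_zero mpoly_eval_add finsupp_sum)

lemma mpoly_eval_mult: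
  assumes "finsupp f" "finsupp g"
  shows "mpoly_eval hom y (f * g) = mpoly_eval hom y f * mpoly_eval hom y g"
proof -
  let ?A = "{m. mcoeff f m \<noteq> 0}" and ?B = "{m. mcoeff g m \<noteq> 0}"
  have "f * g = (\<Sum>a\<in>?A. mmonom a (mcoeff f a)) * (\<Sum>b\<in>?B. mmonom b (mcoeff g b))"
    using assms by (simp add: sum_monomials finsupp_def)
  also have "\<dots> = (\<Sum>a\<in>?A. \<Sum>b\<in>?B. mmonom (a + b) (mcoeff f a * mcoeff g b))"
    by (simp add: sum_product mmonom_mult)
  also have "mpoly_eval hom y \<dots> = (\<Sum>a\<in>?A. \<Sum>b\<in>?B.
      (hom (mcoeff f a) * (\<Prod>i\<in>#a. y i)) * (hom (mcoeff g b) * (\<Prod>i\<in>#b. y i)))"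
    by (simp add: mpoly_eval_sum finsupp_sum mpoly_eval_monom hom_mult mult_ac)
  also have "\<dots> = mpoly_eval hom y f * mpoly_eval hom y g"
    by (simp add: sum_product mpoly_eval_def)
  finally show ?thesis .
qed

lemma mpoly_eval_prod_mset:
  "(\<And>i. i \<in># m \<Longrightarrow> finsupp (z i)) \<Longrightarrow>
    mpoly_eval hom y (\<Prod>i\<in>#m. z i) = (\<Prod>i\<in>#m. mpoly_eval hom y (z i))"
  by (induction m) (auto simp: mpoly_eval_mult finsupp_prod_mset mpoly_eval_const[of y 1, simplified])

end

text \<open>Points are often entries of vectors, whose value beyond the length is unspecified; only
  the indices that really occur may be compared.\<close>

lemma mpoly_eval_cong:
  assumes "\<And>m i. mcoeff f m \<noteq> 0 \<Longrightarrow> i \<in># m \<Longrightarrow> y i = z i"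
  shows "mpoly_eval h y f = mpoly_eval h z f"
  unfolding mpoly_eval_def
  by (intro sum.cong arg_cong2[of _ _ _ _ "(*)"] arg_cong[of _ _ prod_mset] image_mset_cong)
     (use assms in auto)

section \<open>Subrings of a commutative ring\<close>

text \<open>A common interface for the valuation ring, the integral power series, R<x> and R[x]:
  closure in the ambient type turns \<open>ring_on S\<close> into a ring of HOL-Algebra, where
  ideals and quotients are available.\<close>

locale subring_on =
  fixes S :: "'a::comm_ring_1 set"
  assumes one_mem: "1 \<in> S"
    and diff_mem: "a \<in> S \<Longrightarrow> b \<in> S \<Longrightarrow> a - b \<in> S"
    and mult_mem: "a \<in> S \<Longrightarrow> b \<in> S \<Longrightarrow> a * b \<in> S"
begin

lemma zero_mem: "0 \<in> S" using diff_mem[OF one_mem one_mem] by simp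
lemma uminus_mem: "a \<in> S \<Longrightarrow> - a \<in> S" using diff_mem[OF zero_mem, of a] by simp
lemma add_mem: "a \<in> S \<Longrightarrow> b \<in> S \<Longrightarrow> a + b \<in> S"
  using diff_mem[of a "- b"] uminus_mem[of b] by simp
lemma power_mem: "a \<in> S \<Longrightarrow> a ^ k \<in> S"
  by (induction k) (auto intro: one_mem mult_mem)
lemma sum_mem: "(\<And>x. x \<in> A \<Longrightarrow> F x \<in> S) \<Longrightarrow> sum F A \<in> S"
  by (induction A rule: infinite_finite_induct) (auto intro: zero_mem add_mem)
lemma prod_mset_mem: "(\<And>i. i \<in># m \<Longrightarrow> y i \<in> S) \<Longrightarrow> (\<Prod>i\<in>#m. y i) \<in> S"
  by (induction m) (auto intro: one_mem mult_mem)

lemma cring_ring_on: "cring (ring_on S)"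
proof (rule cringI)
  show "abelian_group (ring_on S)"
  proof (rule abelian_groupI)
    fix x assume "x \<in> carrier (ring_on S)"
    thus "\<exists>y\<in>carrier (ring_on S). y \<oplus>\<^bsub>ring_on S\<^esub> x = \<zero>\<^bsub>ring_on S\<^esub>"
      by (auto intro!: bexI[of _ "- x"] uminus_mem)
  qed (auto intro: zero_mem add_mem)
  show "Group.comm_monoid (ring_on S)"
    by (rule comm_monoidI) (auto intro: one_mem mult_mem)
qed (auto simp: distrib_right)

sublocale on: cring "ring_on S" by (rule cring_ring_on)

lemma a_inv_ring_on: "x \<in> S \<Longrightarrow> \<ominus>\<^bsub>ring_on S\<^esub> x = - x"
  by (rule sym, rule on.sum_zero_eq_neg) (auto intro: uminus_mem)

lemma a_minus_ring_on: "x \<in> S \<Longrightarrow> y \<in> S \<Longrightarrow> x \<ominus>\<^bsub>ring_on S\<^esub> y = x - y"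
  by (simp add: a_minus_def a_inv_ring_on[simplified])

lemma nat_pow_ring_on: "x [^]\<^bsub>ring_on S\<^esub> (k::nat) = x ^ k"
  by (induction k) (auto simp: mult.commute)

lemma ideal_ring_onI:
  assumes "I \<subseteq> S" "0 \<in> I" "\<And>a b. a \<in> I \<Longrightarrow> b \<in> I \<Longrightarrow> a + b \<in> I"
    "\<And>a x. a \<in> I \<Longrightarrow> x \<in> S \<Longrightarrow> x * a \<in> I"
  shows "ideal I (ring_on S)"
proof (rule idealI)
  show "Ring.ring (ring_on S)" by (rule on.ring_axioms)
  show "subgroup I (add_monoid (ring_on S))"
  proof (rule group.subgroupI)
    show "group (add_monoid (ring_on S))" by (rule on.add.is_group)
    fix a assume a: "a \<in> I"
    have "- a = (- 1) * a" by simp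
    also have "\<dots> \<in> I" by (intro assms a uminus_mem one_mem)
    finally show "inv\<^bsub>add_monoid (ring_on S)\<^esub> a \<in> I"
      using a_inv_ring_on[of a] a assms(1) by (auto simp: a_inv_def)
  qed (use assms in auto)
qed (use assms in \<open>auto simp: mult.commute\<close>)

lemma ideal_memD:
  assumes "ideal I (ring_on S)"
  shows "I \<subseteq> S" "0 \<in> I" "a \<in> I \<Longrightarrow> b \<in> I \<Longrightarrow> a + b \<in> I" "a \<in> I \<Longrightarrow> b \<in> I \<Longrightarrow> a - b \<in> I"
    "a \<in> I \<Longrightarrow> x \<in> S \<Longrightarrow> x * a \<in> I"
proof -
  interpret I: ideal I "ring_on S" by (rule assms)
  show IS: "I \<subseteq> S" using I.a_subset by simp
  show "0 \<in> I" using I.zero_closed by simp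
  show add: "a \<in> I \<Longrightarrow> b \<in> I \<Longrightarrow> a + b \<in> I" for a b using I.a_closed[of a b] by simp
  show mult: "a \<in> I \<Longrightarrow> x \<in> S \<Longrightarrow> x * a \<in> I" for a x using I.I_l_closed[of a x] by simp
  assume "a \<in> I" "b \<in> I"
  thus "a - b \<in> I"
    using add[of a "(- 1) * b"] mult[of b "- 1"] uminus_mem[OF one_mem] by simp
qed

lemma rcos_ring_on: "I +>\<^bsub>ring_on S\<^esub> a = (\<lambda>i. i + a) ` I"
  by (auto simp: a_r_coset_def r_coset_def)

lemma rcos_eq_iff:
  assumes "ideal I (ring_on S)" "a \<in> S" "b \<in> S"
  shows "I +>\<^bsub>ring_on S\<^esub> a = I +>\<^bsub>ring_on S\<^esub> b \<longleftrightarrow> a - b \<in> I"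
  using on.quotient_eq_iff_same_a_r_cos[OF assms(1), of a b] assms(2,3)
  by (simp add: a_minus_ring_on[simplified])

lemma carrier_Quot_ring_on:
  "carrier (ring_on S Quot I) = (\<lambda>a. I +>\<^bsub>ring_on S\<^esub> a) ` S"
  by (auto simp: FactRing_def A_RCOSETS_def')

lemma rcos_hom:
  assumes "ideal I (ring_on S)"
  shows "(+>\<^bsub>ring_on S\<^esub>) I \<in> Ring.ring_hom (ring_on S) (ring_on S Quot I)"
  by (rule ideal.rcos_ring_hom[OF assms])

lemma genideal_ring_on_minimal:
  assumes "ideal I (ring_on S)" "T \<subseteq> I"
  shows "Idl\<^bsub>ring_on S\<^esub> T \<subseteq> I"
  using on.genideal_minimal[OF assms] .

lemma PIdl_ring_on: "PIdl\<^bsub>ring_on S\<^esub> a = {x * a | x. x \<in> S}"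
  by (simp add: cgenideal_def)

end

lemma ring_hom_nat_pow:
  assumes "h \<in> Ring.ring_hom A B" "Ring.ring A" "Ring.ring B" "x \<in> carrier A"
  shows "h (x [^]\<^bsub>A\<^esub> (k::nat)) = h x [^]\<^bsub>B\<^esub> k"
proof -
  interpret A: Ring.ring A by fact
  interpret B: Ring.ring B by fact
  show ?thesis
    by (induction k) (use assms in \<open>auto simp: ring_hom_one ring_hom_mult\<close>)
qed

section \<open>Completeness of finite extensions\<close>

context padic_galois_extension begin

section \<open>Ultrametric inequalities and the uniformizer\<close>

lemma v_zero [simp]: "v 0 = 0" using abs_eq_0 by simp

lemma v_one [simp]: "v 1 = 1"
proof -
  have "v 1 * v 1 = v 1 * 1" using abs_mult[of 1 1] by simp
  thus ?thesis using abs_eq_0[of 1] by simp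
qed

lemma v_uminus [simp]: "v (- a) = v a"
proof -
  have "v (- 1) * v (- 1) = 1" using abs_mult[of "- 1" "- 1"] by simp
  hence "v (- 1) = 1" using abs_nonneg[of "- 1"] square_eq_1_iff[of "v (- 1)"] by auto
  thus ?thesis using abs_mult[of "- 1" a] by simp
qed

lemma v_diff: "v (a - b) \<le> max (v a) (v b)"
  using abs_add[of a "- b"] by simp

lemma v_minus_commute: "v (a - b) = v (b - a)"
  using v_uminus[of "a - b"] by simp

lemma v_power: "v (a ^ k) = v a ^ k"
  by (induction k) (auto simp: abs_mult)

lemma v_add_le: "v a \<le> x \<Longrightarrow> v b \<le> x \<Longrightarrow> v (a + b) \<le> x"
  using abs_add[of a b] by linarith

lemma v_diff_le: "v a \<le> x \<Longrightarrow> v b \<le> x \<Longrightarrow> v (a - b) \<le> x"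
  using v_diff[of a b] by linarith

lemma v_diff_less: "v a < x \<Longrightarrow> v b < x \<Longrightarrow> v (a - b) < x"
  using v_diff[of a b] by linarith

lemma v_sum_le: "0 \<le> x \<Longrightarrow> (\<And>i. i \<in> A \<Longrightarrow> v (F i) \<le> x) \<Longrightarrow> v (sum F A) \<le> x"
  by (induction A rule: infinite_finite_induct) (auto intro: v_add_le)

lemma subring_valuation_ring: "subring_on (valuation_ring v)"
proof
  fix a b assume "a \<in> valuation_ring v" "b \<in> valuation_ring v"
  thus "a - b \<in> valuation_ring v" "a * b \<in> valuation_ring v"
    by (auto simp: valuation_ring_def abs_mult abs_nonneg mult_le_one intro: v_diff_le)
qed (auto simp: valuation_ring_def)

sublocale R: subring_on "valuation_ring v" by (rule subring_valuation_ring)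

text \<open>The normalisation of the absolute value makes p a nonzero element of the maximal ideal.
  This later shows that \<pi> is nonzero and that multiples of p vanish modulo \<pi>.\<close>

lemma v_p: "v (of_nat p) = 1 / p"
proof -
  have "v (of_nat p) = padic_abs p (of_nat p)" using abs_of_rat[of "of_nat p"] by simp
  also have "\<dots> = real p powi (- 1)"
  proof -
    have "multiplicity (int p) (int p) = 1"
      using prime prime_gt_1_nat[of p] by (intro multiplicity_self) auto
    thus ?thesis using prime prime_gt_0_nat[of p] by (simp add: padic_abs_def)
  qed
  finally show ?thesis by (simp add: power_int_minus field_simps)
qed

lemma maximal_ideal_eq: "{a. v a < 1} = {x * \<pi> | x. v x \<le> 1}"
  using uniformizer R.PIdl_ring_on[of \<pi>] by (simp only: valuation_ring_def mem_Collect_eq)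

lemma v_pi_less_1: "v \<pi> < 1"
proof -
  have "1 * \<pi> \<in> {x * \<pi> | x. v x \<le> 1}" by fastforce
  hence "1 * \<pi> \<in> {a. v a < 1}" by (simp only: maximal_ideal_eq)
  thus ?thesis by simp
qed

lemma v_p_less_1: "v (of_nat p) < 1"
  using prime prime_gt_1_nat[of p] by (simp add: v_p)

text \<open>Discreteness of the valuation: an element of the maximal ideal is an integral multiple
  of \<pi>, so no value lies strictly between \<open>v \<pi>\<close> and 1.\<close>

lemma v_le_pi: "v a < 1 \<Longrightarrow> v a \<le> v \<pi>"
proof -
  assume "v a < 1"
  then obtain x where "a = x * \<pi>" "v x \<le> 1" using maximal_ideal_eq by blast
  thus ?thesis using mult_right_mono[of "v x" 1 "v \<pi>"] by (simp add: abs_mult abs_nonneg)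
qed

text \<open>The maximal ideal contains p, which is not 0, so its generator is not 0 either.\<close>

lemma v_pi_pos: "v \<pi> > 0"
proof -
  have "0 < v (of_nat p)" using prime prime_gt_1_nat[of p] by (simp add: v_p)
  thus ?thesis using v_le_pi[OF v_p_less_1] by linarith
qed

lemma pi_nonzero: "\<pi> \<noteq> 0" using v_pi_pos by auto

lemma v_pi_power_le_1: "v \<pi> ^ k \<le> 1"
  using v_pi_pos v_pi_less_1 by (simp add: power_le_one)

lemma v_pi_power_mono: "j \<le> k \<Longrightarrow> v \<pi> ^ k \<le> v \<pi> ^ j"
  using v_pi_pos v_pi_less_1 by (simp add: power_decreasing)

lemma v_pi_power_less: "\<epsilon> > 0 \<Longrightarrow> \<exists>k. v \<pi> ^ k < \<epsilon>"
  using real_arch_pow_inv[OF _ v_pi_less_1] by blast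

section \<open>Cauchy sequences and complete subsets of K\<close>

definition vcauchy :: "(nat \<Rightarrow> 'k) \<Rightarrow> bool" where
  "vcauchy X \<longleftrightarrow> (\<forall>\<epsilon>>0. \<exists>N. \<forall>m\<ge>N. \<forall>n\<ge>N. v (X m - X n) < \<epsilon>)"

definition vconv :: "(nat \<Rightarrow> 'k) \<Rightarrow> 'k \<Rightarrow> bool" where
  "vconv X L \<longleftrightarrow> (\<forall>\<epsilon>>0. \<exists>N. \<forall>n\<ge>N. v (X n - L) < \<epsilon>)"

text \<open>Convergence is not tied to a carrier here, so a sequence in \<open>E\<close> can be
  shown to converge to a point whose membership in \<open>E\<close> is the question.\<close>

definition vcomplete :: "'k set \<Rightarrow> bool" where
  "vcomplete E \<longleftrightarrow> (\<forall>X. range X \<subseteq> E \<longrightarrow> vcauchy X \<longrightarrow> (\<exists>L\<in>E. vconv X L))"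

lemma vcauchy_diff: assumes "vcauchy X" "vcauchy Y" shows "vcauchy (\<lambda>n. X n - Y n)"
  unfolding vcauchy_def
proof (intro allI impI)
  fix \<epsilon> :: real assume "\<epsilon> > 0"
  then obtain M N where MN: "\<And>m n. m \<ge> M \<Longrightarrow> n \<ge> M \<Longrightarrow> v (X m - X n) < \<epsilon>"
      "\<And>m n. m \<ge> N \<Longrightarrow> n \<ge> N \<Longrightarrow> v (Y m - Y n) < \<epsilon>"
    using assms unfolding vcauchy_def by meson
  have "v (X m - Y m - (X n - Y n)) < \<epsilon>" if "m \<ge> max M N" "n \<ge> max M N" for m n
  proof -
    have "v ((X m - X n) - (Y m - Y n)) < \<epsilon>"
      using that by (intro v_diff_less MN) auto
    thus ?thesis by (simp add: algebra_simps)
  qed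
  thus "\<exists>N. \<forall>m\<ge>N. \<forall>n\<ge>N. v (X m - Y m - (X n - Y n)) < \<epsilon>" by blast
qed

lemma vcauchy_mult_right: assumes "vcauchy X" shows "vcauchy (\<lambda>n. X n * a)"
proof (cases "a = 0")
  case False
  hence a: "v a > 0" using abs_nonneg[of a] abs_eq_0[of a] by simp
  show ?thesis unfolding vcauchy_def
  proof (intro allI impI)
    fix \<epsilon> :: real assume "\<epsilon> > 0"
    hence "\<epsilon> / v a > 0" using a by simp
    then obtain N where "\<And>m n. m \<ge> N \<Longrightarrow> n \<ge> N \<Longrightarrow> v (X m - X n) < \<epsilon> / v a"
      using assms unfolding vcauchy_def by meson
    moreover have "v (X m * a - X n * a) = v (X m - X n) * v a" for m n
      by (simp flip: abs_mult left_diff_distrib)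
    ultimately show "\<exists>N. \<forall>m\<ge>N. \<forall>n\<ge>N. v (X m * a - X n * a) < \<epsilon>"
      using a by (auto simp: pos_less_divide_eq)
  qed
qed (simp add: vcauchy_def)

lemma vconv_add: assumes "vconv X L" "vconv Y M" shows "vconv (\<lambda>n. X n + Y n) (L + M)"
  unfolding vconv_def
proof (intro allI impI)
  fix \<epsilon> :: real assume "\<epsilon> > 0"
  then obtain N1 N2 where N: "\<And>n. n \<ge> N1 \<Longrightarrow> v (X n - L) < \<epsilon>"
      "\<And>n. n \<ge> N2 \<Longrightarrow> v (Y n - M) < \<epsilon>"
    using assms unfolding vconv_def by meson
  have "v (X n + Y n - (L + M)) < \<epsilon>" if "n \<ge> max N1 N2" for n
    using abs_add[of "X n - L" "Y n - M"] N(1)[of n] N(2)[of n] that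
    by (simp add: algebra_simps)
  thus "\<exists>N. \<forall>n\<ge>N. v (X n + Y n - (L + M)) < \<epsilon>" by blast
qed

lemma vconv_mult_right: assumes "vconv X L" shows "vconv (\<lambda>n. X n * a) (L * a)"
proof (cases "a = 0")
  case False
  hence a: "v a > 0" using abs_nonneg[of a] abs_eq_0[of a] by simp
  show ?thesis unfolding vconv_def
  proof (intro allI impI)
    fix \<epsilon> :: real assume "\<epsilon> > 0"
    hence "\<epsilon> / v a > 0" using a by simp
    then obtain N where "\<And>n. n \<ge> N \<Longrightarrow> v (X n - L) < \<epsilon> / v a"
      using assms unfolding vconv_def by meson
    moreover have "v (X n * a - L * a) = v (X n - L) * v a" for n
      by (simp flip: abs_mult left_diff_distrib)
    ultimately show "\<exists>N. \<forall>n\<ge>N. v (X n * a - L * a) < \<epsilon>"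
      using a by (auto simp: pos_less_divide_eq)
  qed
qed (simp add: vconv_def)

lemma vconv_unique: assumes "vconv X L" "vconv X M" shows "L = M"
proof (rule ccontr)
  assume "L \<noteq> M"
  hence pos: "v (L - M) > 0" using abs_nonneg[of "L - M"] abs_eq_0[of "L - M"] by simp
  then obtain N1 N2 where N: "\<And>n. n \<ge> N1 \<Longrightarrow> v (X n - L) < v (L - M)"
      "\<And>n. n \<ge> N2 \<Longrightarrow> v (X n - M) < v (L - M)"
    using assms unfolding vconv_def by meson
  have "v ((X (max N1 N2) - M) - (X (max N1 N2) - L)) < v (L - M)"
    by (intro v_diff_less N) auto
  thus False by simp
qed

lemma vconv_imp_vcauchy: assumes "vconv X L" shows "vcauchy X"
  unfolding vcauchy_def
proof (intro allI impI)
  fix \<epsilon> :: real assume "\<epsilon> > 0"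
  then obtain N where N: "\<And>n. n \<ge> N \<Longrightarrow> v (X n - L) < \<epsilon>"
    using assms unfolding vconv_def by meson
  have "v (X m - X n) < \<epsilon>" if "m \<ge> N" "n \<ge> N" for m n
    using v_diff_less[OF N N, of m n] that by simp
  thus "\<exists>N. \<forall>m\<ge>N. \<forall>n\<ge>N. v (X m - X n) < \<epsilon>" by blast
qed

lemma ring_class_ring: "Ring.ring (class_ring :: 'k ring)"
  by (rule class_ring.ring_axioms)

lemma Qp_closed:
  "0 \<in> Qp" "a \<in> Qp \<Longrightarrow> b \<in> Qp \<Longrightarrow> a + b \<in> Qp" "a \<in> Qp \<Longrightarrow> b \<in> Qp \<Longrightarrow> a * b \<in> Qp"
  "a \<in> Qp \<Longrightarrow> - a \<in> Qp" "a \<in> Qp \<Longrightarrow> a \<noteq> 0 \<Longrightarrow> inverse a \<in> Qp"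
proof -
  note S = subringE[OF subfieldE(1)[OF Qp_subfield]]
  show "0 \<in> Qp" "a \<in> Qp \<Longrightarrow> b \<in> Qp \<Longrightarrow> a + b \<in> Qp" "a \<in> Qp \<Longrightarrow> b \<in> Qp \<Longrightarrow> a * b \<in> Qp"
    using S(2) S(6)[of a b] S(7)[of a b] by auto
  show "- a \<in> Qp" if "a \<in> Qp" using S(5)[OF that] by (simp add: class_ring_simps)
  assume a: "a \<in> Qp" "a \<noteq> 0"
  have 1: "1 \<in> Qp" using S(3) by simp
  show "inverse a \<in> Qp"
    using ring.subfield_m_inv_simprule[OF ring_class_ring Qp_subfield, of a "inverse a"] a 1
    by (simp add: class_ring_simps)
qed

lemma vcomplete_Qp: "vcomplete Qp"
  unfolding vcomplete_def
proof (intro allI impI)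
  interpret M: Metric_space Qp "\<lambda>a b. v (a - b)"
  proof
    fix x y z
    show "v (x - z) \<le> v (x - y) + v (y - z)"
      using abs_add[of "x - y" "y - z"] abs_nonneg[of "x - y"] abs_nonneg[of "y - z"] by simp
  qed (auto simp: abs_nonneg v_minus_commute abs_eq_0)
  fix X assume X: "range X \<subseteq> Qp" "vcauchy X"
  hence "M.MCauchy X" unfolding M.MCauchy_def vcauchy_def by meson
  then obtain L where "limitin M.mtopology X L sequentially"
    using Qp_complete unfolding M.mcomplete_def by blast
  thus "\<exists>L\<in>Qp. vconv X L"
    unfolding M.limit_metric_sequentially vconv_def by blast
qed

text \<open>
  As \<open>E\<close> is closed, \<open>b\<close> has a positive distance \<open>\<delta>\<close> from \<open>E\<close>, so \<open>v k * \<delta> \<le> v (k * b + w)\<close>: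
  the coefficients of \<open>b\<close> in a Cauchy sequence form a Cauchy sequence.
\<close>

lemma vcomplete_line_extension:
  assumes E: "vcomplete E" "0 \<in> E" "\<And>a b. a \<in> E \<Longrightarrow> b \<in> E \<Longrightarrow> a + b \<in> E"
      "\<And>k a. k \<in> Qp \<Longrightarrow> a \<in> E \<Longrightarrow> k * a \<in> E"
    and b: "b \<notin> E"
  shows "vcomplete {k * b + w | k w. k \<in> Qp \<and> w \<in> E}"
  unfolding vcomplete_def
proof (intro allI impI)
  have "\<exists>\<delta>>0. \<forall>w\<in>E. v (b - w) \<ge> \<delta>"
  proof (rule ccontr)
    \<comment> \<open>Otherwise points of \<open>E\<close> converge to \<open>b\<close>; by
      completeness they also have a limit in \<open>E\<close>, and uniqueness of limits puts
      \<open>b\<close> into \<open>E\<close>.\<close>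
    assume contr: "\<not> ?thesis"
    have "\<forall>i::nat. \<exists>w\<in>E. v (b - w) < 1 / Suc i"
    proof
      fix i :: nat
      have "0 < 1 / real (Suc i)" by simp
      thus "\<exists>w\<in>E. v (b - w) < 1 / Suc i" using contr by (metis linorder_not_le)
    qed
    then obtain W where W: "\<And>i. W i \<in> E" "\<And>i::nat. v (b - W i) < 1 / Suc i" by metis
    have "vconv W b" unfolding vconv_def
    proof (intro allI impI)
      fix \<epsilon> :: real assume "\<epsilon> > 0"
      then obtain N where N: "1 / Suc N < \<epsilon>" using nat_approx_posE by blast
      have "v (W n - b) < \<epsilon>" if "n \<ge> N" for n
      proof -
        have "v (W n - b) < 1 / Suc n" using W(2)[of n] by (simp only: v_minus_commute)
        also have "1 / real (Suc n) \<le> 1 / Suc N" using that by (simp add: field_simps)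
        finally show ?thesis using N by linarith
      qed
      thus "\<exists>N. \<forall>n\<ge>N. v (W n - b) < \<epsilon>" by blast
    qed
    moreover obtain L where "L \<in> E" "vconv W L"
      using E(1) vconv_imp_vcauchy[OF \<open>vconv W b\<close>] W(1) unfolding vcomplete_def by blast
    ultimately show False using vconv_unique b by metis
  qed
  then obtain \<delta> where \<delta>: "\<delta> > 0" "\<And>w. w \<in> E \<Longrightarrow> v (b - w) \<ge> \<delta>" by blast
  have bound: "v k * \<delta> \<le> v (k * b + w)" if "k \<in> Qp" "w \<in> E" for k w
  proof (cases "k = 0")
    case False
    \<comment> \<open>For nonzero k, the element k b + w is k times the difference between b and the
      point -w/k of \<open>E\<close>.\<close>
    have "(- inverse k) * w \<in> E" using that False by (intro E Qp_closed)
    hence "\<delta> \<le> v (b - (- inverse k) * w)" by (rule \<delta>(2))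
    hence "v k * \<delta> \<le> v k * v (b - (- inverse k) * w)" by (simp add: abs_nonneg mult_left_mono)
    also have "\<dots> = v (k * (b - (- inverse k) * w))" by (rule abs_mult[symmetric])
    also have "k * (b - (- inverse k) * w) = k * b + w" using False by (simp add: distrib_left)
    finally show ?thesis .
  qed (simp add: abs_nonneg)
  fix X assume X: "range X \<subseteq> {k * b + w | k w. k \<in> Qp \<and> w \<in> E}" "vcauchy X"
  have "\<forall>n. \<exists>k w. X n = k * b + w \<and> k \<in> Qp \<and> w \<in> E" using X(1) by blast
  then obtain k w where kw: "\<And>n. X n = k n * b + w n" "\<And>n. k n \<in> Qp" "\<And>n. w n \<in> E" by metis
  have "vcauchy k" unfolding vcauchy_def
  proof (intro allI impI)
    fix \<epsilon> :: real assume "\<epsilon> > 0"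
    hence "\<epsilon> * \<delta> > 0" using \<delta>(1) by simp
    then obtain N where N: "\<And>m n. m \<ge> N \<Longrightarrow> n \<ge> N \<Longrightarrow> v (X m - X n) < \<epsilon> * \<delta>"
      using X(2) unfolding vcauchy_def by meson
    have "v (k m - k n) < \<epsilon>" if "m \<ge> N" "n \<ge> N" for m n
    proof -
      have "w m + (- 1) * w n \<in> E"
        using Qp_closed(4)[of 1] subringE(3)[OF subfieldE(1)[OF Qp_subfield]]
        by (intro E(3,4) kw) auto
      moreover have "k m + - k n \<in> Qp" by (intro Qp_closed kw)
      ultimately have "v (k m - k n) * \<delta> \<le> v ((k m - k n) * b + (w m - w n))"
        using bound by force
      also have "\<dots> = v (X m - X n)" by (simp add: kw(1) algebra_simps)
      also have "\<dots> < \<epsilon> * \<delta>" by (rule N[OF that])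
      finally show ?thesis using \<delta>(1) by simp
    qed
    thus "\<exists>N. \<forall>m\<ge>N. \<forall>n\<ge>N. v (k m - k n) < \<epsilon>" by blast
  qed
  then obtain K where K: "K \<in> Qp" "vconv k K"
    using vcomplete_Qp kw(2) unfolding vcomplete_def by blast
  have "w = (\<lambda>n. X n - k n * b)" by (simp add: kw(1))
  hence "vcauchy w" using vcauchy_diff[OF X(2) vcauchy_mult_right[OF \<open>vcauchy k\<close>, of b]] by simp
  then obtain W where W: "W \<in> E" "vconv w W"
    using E(1) kw(3) unfolding vcomplete_def by blast
  have "vconv X (K * b + W)"
    using vconv_add[OF vconv_mult_right[OF K(2), of b] W(2)] by (simp add: kw(1)[abs_def])
  thus "\<exists>L\<in>{k * b + w | k w. k \<in> Qp \<and> w \<in> E}. vconv X L" using K W by blast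
qed

text \<open>Induction on the dimension, adjoining one line at a time. The closure properties are
  carried along because the next line extension asks for them; the field is a variable with an
  equation so that the induction rule applies.\<close>

lemma vcomplete_dimension:
  assumes "ring.dimension (class_ring :: 'k ring) N K E" "K = Qp"
  shows "vcomplete E \<and> (0::'k) \<in> E \<and> (\<forall>a\<in>E. \<forall>b\<in>E. a + b \<in> E) \<and> (\<forall>k\<in>Qp. \<forall>a\<in>E. k * a \<in> E)"
  using assms
proof (induction N K E rule: ring.dimension.induct[OF ring_class_ring, consumes 1, case_names zero_dim Suc_dim])
  case zero_dim
  have "vconv X 0" if "range X \<subseteq> {0}" for X
  proof -
    have "X n = 0" for n using that by blast
    thus ?thesis by (simp add: vconv_def)
  qed
  thus ?case by (auto simp: vcomplete_def)
next
  case (Suc_dim b E N K)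
  have eq: "ring.line_extension class_ring K b E = {k * b + w | k w. k \<in> Qp \<and> w \<in> E}"
  proof (rule Set.set_eqI)
    fix x
    show "x \<in> ring.line_extension class_ring K b E \<longleftrightarrow> x \<in> {k * b + w | k w. k \<in> Qp \<and> w \<in> E}"
      unfolding ring.line_extension_mem_iff[OF ring_class_ring] using Suc_dim.prems by auto
  qed
  show ?case unfolding eq
  proof (intro conjI ballI)
    show "vcomplete {k * b + w | k w. k \<in> Qp \<and> w \<in> E}"
      using Suc_dim by (intro vcomplete_line_extension) auto
    show "0 \<in> {k * b + w | k w. k \<in> Qp \<and> w \<in> E}"
      using Suc_dim Qp_closed(1) by (force intro: exI[of _ 0])
  next
    fix x y assume "x \<in> {k * b + w | k w. k \<in> Qp \<and> w \<in> E}" "y \<in> {k * b + w | k w. k \<in> Qp \<and> w \<in> E}"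
    then obtain k w k' w' where "x = k * b + w" "y = k' * b + w'" "k \<in> Qp" "k' \<in> Qp" "w \<in> E" "w' \<in> E"
      by blast
    moreover from this have "x + y = (k + k') * b + (w + w')" by (simp add: algebra_simps)
    ultimately show "x + y \<in> {k * b + w | k w. k \<in> Qp \<and> w \<in> E}"
      using Suc_dim Qp_closed(2) by blast
  next
    fix c x assume "c \<in> Qp" "x \<in> {k * b + w | k w. k \<in> Qp \<and> w \<in> E}"
    then obtain k w where "x = k * b + w" "k \<in> Qp" "w \<in> E" by blast
    moreover from this have "c * x = (c * k) * b + c * w" by (simp add: algebra_simps)
    ultimately show "c * x \<in> {k * b + w | k w. k \<in> Qp \<and> w \<in> E}"
      using Suc_dim Qp_closed(3) \<open>c \<in> Qp\<close> by blast
  qed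
qed

text \<open>By the ultrametric inequality every later term stays within \<open>v \<pi> ^ k\<close>
  of \<open>X k\<close>. So the sequence is Cauchy, and the limit inherits the same bound without
  loss.\<close>

lemma limit_exists:
  assumes X: "\<And>k. v (X (Suc k) - X k) \<le> v \<pi> ^ k"
  shows "\<exists>L. \<forall>k. v (L - X k) \<le> v \<pi> ^ k"
proof -
  have step: "v (X (k + j) - X k) \<le> v \<pi> ^ k" for k j
  proof (induction j)
    case (Suc j)
    have "v ((X (Suc (k + j)) - X (k + j)) + (X (k + j) - X k)) \<le> v \<pi> ^ k"
      using X[of "k + j"] v_pi_power_mono[of k "k + j"] by (intro v_add_le Suc.IH) linarith
    thus ?case by simp
  qed (use v_pi_pos in simp)
  have "vcauchy X" unfolding vcauchy_def
  proof (intro allI impI)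
    fix \<epsilon> :: real assume "\<epsilon> > 0"
    then obtain k where k: "v \<pi> ^ k < \<epsilon>" using v_pi_power_less by blast
    have "v (X m - X n) < \<epsilon>" if "m \<ge> k" "n \<ge> k" for m n
      using v_diff_less[of "X m - X k" \<epsilon> "X n - X k"] step[of k "m - k"] step[of k "n - k"] that k
      by simp
    thus "\<exists>N. \<forall>m\<ge>N. \<forall>n\<ge>N. v (X m - X n) < \<epsilon>" by blast
  qed
  \<comment> \<open>K itself is reached by the induction on dimension, being of finite dimension
    over \<open>Qp\<close>.\<close>
  moreover have "vcomplete UNIV" using vcomplete_dimension finite_extension
    unfolding ring.finite_dimension_def[OF ring_class_ring] by blast
  ultimately obtain L where L: "vconv X L" unfolding vcomplete_def by blast
  have "v (L - X k) \<le> v \<pi> ^ k" for k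
  proof -
    obtain N where N: "\<And>n. n \<ge> N \<Longrightarrow> v (X n - L) < v \<pi> ^ k"
      using L v_pi_pos unfolding vconv_def by (metis zero_less_power)
    \<comment> \<open>The index k + N is late enough for both estimates: the distance to
      \<open>X k\<close> and the distance to the limit.\<close>
    have "v ((X (k + N) - X k) - (X (k + N) - L)) \<le> v \<pi> ^ k"
      using N[of "k + N"] step[of k N]
        v_diff_le[of "X (k + N) - X k" "v \<pi> ^ k" "X (k + N) - L"] by simp
    thus ?thesis by simp
  qed
  thus ?thesis by blast
qed

end

section \<open>The \<open>\<pi>\<close>-adic filtration of the ring of restricted power series\<close>

context padic_galois_extension begin

lemma v_sum_less: "0 < x \<Longrightarrow> (\<And>i. i \<in> A \<Longrightarrow> v (F i) < x) \<Longrightarrow> v (sum F A) < x"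
proof (induction A rule: infinite_finite_induct)
  case (insert a A)
  hence "v (F a) < x" "v (sum F A) < x" by auto
  thus ?case using insert.hyps abs_add[of "F a" "sum F A"] by simp
qed auto

text \<open>A bound on the Gauss norm alone. Variables and decay of coefficients are unrestricted,
  so \<open>fil 0\<close> consists of all series with integral coefficients; intersecting with
  \<open>tate n v\<close> recovers the multiples of \<pi> at level 1.\<close>

definition fil :: "nat \<Rightarrow> 'k mps set" where
  "fil k = {g. \<forall>l. v (mcoeff g l) \<le> v \<pi> ^ k}"

lemma fil_zero [simp]: "0 \<in> fil k" using v_pi_pos by (simp add: fil_def)
lemma fil_add: "f \<in> fil k \<Longrightarrow> g \<in> fil k \<Longrightarrow> f + g \<in> fil k"
  by (simp add: fil_def v_add_le)
lemma fil_diff: "f \<in> fil k \<Longrightarrow> g \<in> fil k \<Longrightarrow> f - g \<in> fil k"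
  by (simp add: fil_def v_diff_le)
lemma fil_uminus: "f \<in> fil k \<Longrightarrow> - f \<in> fil k"
  by (simp add: fil_def)
lemma fil_sum: "(\<And>x. x \<in> A \<Longrightarrow> F x \<in> fil k) \<Longrightarrow> sum F A \<in> fil k"
  by (induction A rule: infinite_finite_induct) (auto intro: fil_add)
lemma fil_trans: "f - g \<in> fil k \<Longrightarrow> g - h \<in> fil k \<Longrightarrow> f - h \<in> fil k"
  using fil_add[of "f - g" k "g - h"] by simp
lemma fil_mono: "f \<in> fil k \<Longrightarrow> j \<le> k \<Longrightarrow> f \<in> fil j"
  using v_pi_power_mono[of j k] by (auto simp: fil_def intro: order_trans)
lemma fil_mult_add: assumes "f \<in> fil j" "g \<in> fil k" shows "f * g \<in> fil (j + k)"
proof -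
  have "v (mcoeff (f * g) m) \<le> v \<pi> ^ (j + k)" for m
    unfolding mcoeff_mult
    using assms v_pi_pos
    by (intro v_sum_le) (auto simp: abs_mult power_add fil_def abs_nonneg intro!: mult_mono)
  thus ?thesis by (simp add: fil_def)
qed
lemma fil_mult: "f \<in> fil 0 \<Longrightarrow> g \<in> fil k \<Longrightarrow> f * g \<in> fil k"
  using fil_mult_add[of f 0 g k] by simp
lemma fil_mult': "f \<in> fil k \<Longrightarrow> g \<in> fil 0 \<Longrightarrow> f * g \<in> fil k"
  using fil_mult_add[of f k g 0] by simp
lemma fil_const: "v a \<le> v \<pi> ^ k \<Longrightarrow> mconst a \<in> fil k"
  using v_pi_pos by (auto simp: fil_def mcoeff_const)
text \<open>The powers of \<open>v \<pi>\<close> tend to 0. Equality of series is proved below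
  through this, one level at a time.\<close>

lemma fil_separated: assumes "\<And>k. g \<in> fil k" shows "g = 0"
proof (rule mps_eqI)
  fix m
  have "v (mcoeff g m) \<le> 0"
  proof (rule ccontr)
    assume "\<not> v (mcoeff g m) \<le> 0"
    then obtain k where "v \<pi> ^ k < v (mcoeff g m)"
      using v_pi_power_less[of "v (mcoeff g m)"] by auto
    thus False using assms[of k] by (auto simp: fil_def not_le[symmetric])
  qed
  thus "mcoeff g m = mcoeff 0 m" using abs_nonneg[of "mcoeff g m"] abs_eq_0[of "mcoeff g m"] by simp
qed
lemma fil_separated_diff: "(\<And>k. f - g \<in> fil k) \<Longrightarrow> f = g"
  using fil_separated[of "f - g"] by simp

section \<open>Integral series, restricted series and polynomials as subrings\<close>

lemma subring_fil: "subring_on (fil 0)"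
  by standard (auto intro: fil_diff fil_mult simp: fil_const simp flip: mconst.hom_one)

sublocale fil: subring_on "fil 0" by (rule subring_fil)

lemma tate_in_fil: "g \<in> tate n v \<Longrightarrow> g \<in> fil 0"
  by (auto simp: tate_def fil_def valuation_ring_def)

lemma tate_vars: "g \<in> tate n v \<Longrightarrow> mcoeff g m \<noteq> 0 \<Longrightarrow> set_mset m \<subseteq> {..<n}"
  by (auto simp: tate_def)

lemma tateI:
  assumes "g \<in> fil 0" "\<And>m. mcoeff g m \<noteq> 0 \<Longrightarrow> set_mset m \<subseteq> {..<n}"
    "\<And>\<epsilon>. \<epsilon> > 0 \<Longrightarrow> finite {m. v (mcoeff g m) \<ge> \<epsilon>}"
  shows "g \<in> tate n v"
  using assms by (auto simp: tate_def fil_def valuation_ring_def)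

lemma subring_tate: "subring_on (tate n v)"
proof
  have "{m. \<epsilon> \<le> v (mcoeff 1 m)} \<subseteq> {{#}}" if "\<epsilon> > 0" for \<epsilon> :: real
    using that by (auto simp: mcoeff_one split: if_splits)
  thus "1 \<in> tate n v"
    by (intro tateI fil.one_mem) (auto simp: mcoeff_one finite_subset split: if_splits)
next
  fix f g assume fg: "f \<in> tate n v" "g \<in> tate n v"
  show "f - g \<in> tate n v"
  proof (rule tateI)
    show "f - g \<in> fil 0" using fg by (intro fil_diff tate_in_fil)
    show "set_mset m \<subseteq> {..<n}" if "mcoeff (f - g) m \<noteq> 0" for m
    proof -
      have "mcoeff f m \<noteq> 0 \<or> mcoeff g m \<noteq> 0" using that by auto
      thus ?thesis using fg tate_vars by blast
    qed
    fix \<epsilon> :: real assume "\<epsilon> > 0"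
    hence "finite ({m. v (mcoeff f m) \<ge> \<epsilon>} \<union> {m. v (mcoeff g m) \<ge> \<epsilon>})"
      using fg by (auto simp: tate_def)
    moreover have "{m. v (mcoeff (f - g) m) \<ge> \<epsilon>} \<subseteq> {m. v (mcoeff f m) \<ge> \<epsilon>} \<union> {m. v (mcoeff g m) \<ge> \<epsilon>}"
    proof
      fix m assume "m \<in> {m. v (mcoeff (f - g) m) \<ge> \<epsilon>}"
      thus "m \<in> {m. v (mcoeff f m) \<ge> \<epsilon>} \<union> {m. v (mcoeff g m) \<ge> \<epsilon>}"
        using v_diff_less[of "mcoeff f m" \<epsilon> "mcoeff g m"] by (auto simp flip: not_less)
    qed
    ultimately show "finite {m. v (mcoeff (f - g) m) \<ge> \<epsilon>}" by (rule rev_finite_subset)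
  qed
  show "f * g \<in> tate n v"
  proof (rule tateI)
    show "f * g \<in> fil 0" using fg by (intro fil.mult_mem tate_in_fil)
    show "set_mset m \<subseteq> {..<n}" if "mcoeff (f * g) m \<noteq> 0" for m
    proof -
      from that[unfolded mcoeff_mult] obtain a
        where "a \<in> {a. a \<subseteq># m}" "mcoeff f a * mcoeff g (m - a) \<noteq> 0"
        by (rule sum.not_neutral_contains_not_neutral)
      hence a: "a \<subseteq># m" "mcoeff f a \<noteq> 0" "mcoeff g (m - a) \<noteq> 0" by auto
      hence "set_mset a \<subseteq> {..<n}" "set_mset (m - a) \<subseteq> {..<n}"
        using tate_vars[OF fg(1)] tate_vars[OF fg(2)] by auto
      moreover have "set_mset m = set_mset a \<union> set_mset (m - a)"
        using a by (simp flip: set_mset_union)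
      ultimately show ?thesis by simp
    qed
    fix \<epsilon> :: real assume \<epsilon>: "\<epsilon> > 0"
    hence "finite ((\<lambda>(a, b). a + b) ` ({m. v (mcoeff f m) \<ge> \<epsilon>} \<times> {m. v (mcoeff g m) \<ge> \<epsilon>}))"
      using fg by (auto simp: tate_def)
    moreover have "{m. v (mcoeff (f * g) m) \<ge> \<epsilon>}
        \<subseteq> (\<lambda>(a, b). a + b) ` ({m. v (mcoeff f m) \<ge> \<epsilon>} \<times> {m. v (mcoeff g m) \<ge> \<epsilon>})"
    proof
      fix m assume "m \<in> {m. v (mcoeff (f * g) m) \<ge> \<epsilon>}"
      \<comment> \<open>A sum of terms smaller than \<epsilon> is smaller than \<epsilon>, so a
        large coefficient of the product has a large term. As both factors of that term have size at
        most 1, each of them is at least \<epsilon>, and m is the sum of two exponents from finite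
        sets.\<close>
      hence "\<not> v (\<Sum>a | a \<subseteq># m. mcoeff f a * mcoeff g (m - a)) < \<epsilon>"
        by (simp add: mcoeff_mult)
      hence "\<exists>a\<in>{a. a \<subseteq># m}. \<not> v (mcoeff f a * mcoeff g (m - a)) < \<epsilon>"
        using v_sum_less[OF \<epsilon>, of "{a. a \<subseteq># m}" "\<lambda>a. mcoeff f a * mcoeff g (m - a)"] by blast
      then obtain a where a: "a \<subseteq># m" "v (mcoeff f a) * v (mcoeff g (m - a)) \<ge> \<epsilon>"
        by (auto simp: abs_mult not_less)
      have "v (mcoeff f a) \<le> 1" "v (mcoeff g (m - a)) \<le> 1"
        using fg by (auto simp: tate_def valuation_ring_def)
      hence "v (mcoeff f a) \<ge> \<epsilon>" "v (mcoeff g (m - a)) \<ge> \<epsilon>"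
        using a(2) abs_nonneg[of "mcoeff f a"] abs_nonneg[of "mcoeff g (m - a)"]
          mult_left_le[of "v (mcoeff g (m - a))" "v (mcoeff f a)"]
          mult_left_le[of "v (mcoeff f a)" "v (mcoeff g (m - a))"]
        by (auto simp: mult.commute)
      moreover have "m = a + (m - a)" using a by simp
      ultimately show "m \<in> (\<lambda>(a, b). a + b) ` ({m. v (mcoeff f m) \<ge> \<epsilon>} \<times> {m. v (mcoeff g m) \<ge> \<epsilon>})"
        by (intro image_eqI[of _ _ "(a, m - a)"]) auto
    qed
    ultimately show "finite {m. v (mcoeff (f * g) m) \<ge> \<epsilon>}" by (rule rev_finite_subset)
  qed
qed

sublocale tate: subring_on "tate n v" for n by (rule subring_tate)

lemma polys_iff: "g \<in> polys n v \<longleftrightarrow> g \<in> tate n v \<and> finsupp g"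
  by (simp add: polys_def finsupp_def)

lemma polys_tate: "g \<in> polys n v \<Longrightarrow> g \<in> tate n v" by (simp add: polys_iff)
lemma polys_finsupp: "g \<in> polys n v \<Longrightarrow> finsupp g" by (simp add: polys_iff)

lemma subring_polys: "subring_on (polys n v)"
  by standard (auto simp: polys_iff intro: tate.one_mem tate.diff_mem tate.mult_mem)

sublocale polys: subring_on "polys n v" for n by (rule subring_polys)

lemma polysI:
  assumes "g \<in> fil 0" "\<And>m. mcoeff g m \<noteq> 0 \<Longrightarrow> set_mset m \<subseteq> {..<n}" "finsupp g"
  shows "g \<in> polys n v"
proof -
  have "{m. v (mcoeff g m) \<ge> \<epsilon>} \<subseteq> {m. mcoeff g m \<noteq> 0}" if "\<epsilon> > 0" for \<epsilon>
    using that by auto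
  thus ?thesis using assms unfolding polys_iff
    by (auto intro!: tateI intro: finite_subset simp: finsupp_def)
qed

lemma monom_polys: "v a \<le> 1 \<Longrightarrow> set_mset m \<subseteq> {..<n} \<Longrightarrow> mmonom m a \<in> polys n v"
  by (rule polysI) (auto simp: mcoeff_monom fil_def split: if_splits)

lemma const_polys: "v a \<le> 1 \<Longrightarrow> mconst a \<in> polys n v"
  by (simp add: mconst_conv_monom monom_polys)

lemma var_polys: "i < n \<Longrightarrow> mvar i \<in> polys n v"
  by (simp add: mvar_conv_monom monom_polys)

text \<open>Truncation: only finitely many coefficients have size at least
  \<open>v \<pi> ^ k\<close>, and exactly these are kept.\<close>

lemma tate_approx: assumes "g \<in> tate n v" shows "\<exists>h\<in>polys n v. g - h \<in> fil k"
proof -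
  let ?M = "{m. v (mcoeff g m) \<ge> v \<pi> ^ k}"
  have fin: "finite ?M" using assms v_pi_pos by (auto simp: tate_def)
  define h where "h = Abs_mps (\<lambda>m. if m \<in> ?M then mcoeff g m else 0)"
  have h: "mcoeff h m = (if m \<in> ?M then mcoeff g m else 0)" for m
    by (simp add: h_def Abs_mps_inverse)
  have "finsupp h" unfolding finsupp_def
    by (rule finite_subset[OF _ fin]) (auto simp: h)
  hence "h \<in> polys n v"
    using assms tate_in_fil[OF assms] v_pi_pos
    by (intro polysI) (auto simp: h fil_def dest: tate_vars split: if_splits)
  moreover have "g - h \<in> fil k" using v_pi_pos by (auto simp: fil_def h)
  ultimately show ?thesis by blast
qed

text \<open>This is the \<pi>-adic completeness of R<x>. Limits are taken coefficient by
  coefficient; since their rate is the same for all coefficients, support and decay pass from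
  \<open>H k\<close> to the limit.\<close>

lemma tate_limit:
  assumes "\<And>k. H k \<in> tate n v" "\<And>k. H (Suc k) - H k \<in> fil k"
  shows "\<exists>h\<in>tate n v. \<forall>k. h - H k \<in> fil k"
proof -
  have "\<exists>L. \<forall>k. v (L - mcoeff (H k) m) \<le> v \<pi> ^ k" for m
    using assms(2) by (intro limit_exists) (simp add: fil_def)
  then obtain L where L: "\<And>m k. v (L m - mcoeff (H k) m) \<le> v \<pi> ^ k" by metis
  define h where "h = Abs_mps L"
  have h: "h - H k \<in> fil k" for k using L by (simp add: fil_def h_def Abs_mps_inverse)
  have "h \<in> tate n v"
  proof (rule tateI)
    show "h \<in> fil 0" using fil_add[OF h[of 0] tate_in_fil[OF assms(1)[of 0]]] by simp
    show "set_mset m \<subseteq> {..<n}" if "mcoeff h m \<noteq> 0" for m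
    proof -
      \<comment> \<open>Once \<open>v \<pi> ^ k\<close> is below the size of this coefficient,
        \<open>H k\<close> cannot have coefficient 0 at m, and its variables are known.\<close>
      have "v (mcoeff h m) > 0" using that abs_nonneg[of "mcoeff h m"] abs_eq_0[of "mcoeff h m"] by simp
      then obtain k where "v \<pi> ^ k < v (mcoeff h m)" using v_pi_power_less by blast
      moreover have "v (mcoeff h m - mcoeff (H k) m) \<le> v \<pi> ^ k" using h[of k] by (simp add: fil_def)
      ultimately have "mcoeff (H k) m \<noteq> 0" by auto
      thus ?thesis using tate_vars[OF assms(1)] by blast
    qed
    fix \<epsilon> :: real assume "\<epsilon> > 0"
    then obtain k where k: "v \<pi> ^ k < \<epsilon>" using v_pi_power_less by blast
    have "{m. v (mcoeff h m) \<ge> \<epsilon>} \<subseteq> {m. v (mcoeff (H k) m) \<ge> \<epsilon>}"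
    proof (clarify, rule ccontr)
      fix m assume m: "v (mcoeff h m) \<ge> \<epsilon>" "\<not> v (mcoeff (H k) m) \<ge> \<epsilon>"
      have "v (mcoeff h m - mcoeff (H k) m) \<le> v \<pi> ^ k" using h[of k] by (simp add: fil_def)
      thus False using abs_add[of "mcoeff h m - mcoeff (H k) m" "mcoeff (H k) m"] m k by simp
    qed
    thus "finite {m. v (mcoeff h m) \<ge> \<epsilon>}"
      using assms(1)[of k] \<open>\<epsilon> > 0\<close> by (auto simp: tate_def intro: finite_subset)
  qed
  thus ?thesis using h by blast
qed

text \<open>The coefficients of the quotient are exposed because the users must still read off its
  support and decay.\<close>

lemma pi_multiple_fil:
  assumes "g \<in> fil 1"
  obtains h where "g = mconst \<pi> * h" "h \<in> fil 0" "\<And>m. mcoeff h m = mcoeff g m / \<pi>"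
proof
  define h where "h = Abs_mps (\<lambda>m. mcoeff g m / \<pi>)"
  show h: "mcoeff h m = mcoeff g m / \<pi>" for m by (simp add: h_def Abs_mps_inverse)
  show "g = mconst \<pi> * h" using pi_nonzero by (intro mps_eqI) (simp add: h)
  have "v (x / \<pi>) \<le> 1" if "v x \<le> v \<pi>" for x
  proof -
    have "v (x / \<pi>) * v \<pi> \<le> 1 * v \<pi>" using that pi_nonzero by (simp flip: abs_mult)
    thus ?thesis using v_pi_pos by simp
  qed
  thus "h \<in> fil 0" using assms by (auto simp: fil_def h)
qed

lemma pi_in_fil: "mconst \<pi> \<in> fil 1" by (rule fil_const) simp

text \<open>Division by \<pi> only rescales coefficients, hence preserves support and decay. Thus
  being a multiple of \<pi> becomes a mere bound on the norm.\<close>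

lemma pi_multiples_tate: "pi_multiples \<pi> (tate n v) = tate n v \<inter> fil 1"
proof (intro equalityI subsetI)
  fix g assume "g \<in> pi_multiples \<pi> (tate n v)"
  then obtain h where "g = mconst \<pi> * h" "h \<in> tate n v" by (auto simp: pi_multiples_def)
  moreover have "mconst \<pi> \<in> tate n v" using v_pi_less_1 by (simp add: const_polys polys_tate)
  ultimately show "g \<in> tate n v \<inter> fil 1"
    using fil_mult'[OF pi_in_fil] tate_in_fil tate.mult_mem by blast
next
  fix g assume g: "g \<in> tate n v \<inter> fil 1"
  then obtain h where h: "g = mconst \<pi> * h" "h \<in> fil 0" "\<And>m. mcoeff h m = mcoeff g m / \<pi>"
    using pi_multiple_fil by blast
  have "h \<in> tate n v"
  proof (rule tateI[OF h(2)])
    show "set_mset m \<subseteq> {..<n}" if "mcoeff h m \<noteq> 0" for m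
      using that g h(3)[of m] tate_vars[of g n m] by auto
    fix \<epsilon> :: real assume "\<epsilon> > 0"
    \<comment> \<open>A coefficient of the quotient has size at least \<epsilon> only if that of g
      has size at least \<open>v \<pi> * \<epsilon>\<close>.\<close>
    hence "finite {m. v (mcoeff g m) \<ge> v \<pi> * \<epsilon>}" using g v_pi_pos by (auto simp: tate_def)
    thus "finite {m. v (mcoeff h m) \<ge> \<epsilon>}"
      by (rule rev_finite_subset) (auto simp: h(1) abs_mult abs_nonneg mult_left_mono)
  qed
  thus "g \<in> pi_multiples \<pi> (tate n v)" using h(1) by (simp add: pi_multiples_def)
qed

lemma pi_multiples_polys: "pi_multiples \<pi> (polys n v) = polys n v \<inter> fil 1"
proof (intro equalityI subsetI)
  fix g assume "g \<in> pi_multiples \<pi> (polys n v)"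
  then obtain h where "g = mconst \<pi> * h" "h \<in> polys n v" by (auto simp: pi_multiples_def)
  moreover have "mconst \<pi> \<in> polys n v" using v_pi_less_1 by (simp add: const_polys)
  ultimately show "g \<in> polys n v \<inter> fil 1"
    using fil_mult'[OF pi_in_fil] tate_in_fil polys_tate polys.mult_mem by blast
next
  fix g assume g: "g \<in> polys n v \<inter> fil 1"
  then obtain h where h: "g = mconst \<pi> * h" "h \<in> fil 0" "\<And>m. mcoeff h m = mcoeff g m / \<pi>"
    using pi_multiple_fil by blast
  have "{m. mcoeff h m \<noteq> 0} \<subseteq> {m. mcoeff g m \<noteq> 0}" by (auto simp: h(3))
  hence "finsupp h" using g finite_subset by (auto simp: polys_iff finsupp_def)
  hence "h \<in> polys n v"
    using g by (intro polysI h(2)) (auto simp: h(3) dest!: polys_tate dest: tate_vars)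
  thus "g \<in> pi_multiples \<pi> (polys n v)" using h(1) by (simp add: pi_multiples_def)
qed

end

section \<open>Substitution and the Frobenius congruence\<close>

context padic_galois_extension begin

section \<open>Congruences modulo powers of \<pi>, and additivity of p-power maps modulo
  \<pi>\<close>

lemma fil_cong_mult:
  assumes "a - a' \<in> fil k" "b - b' \<in> fil k" "a \<in> fil 0" "b' \<in> fil 0"
  shows "a * b - a' * b' \<in> fil k"
proof -
  have "a * b - a' * b' = a * (b - b') + (a - a') * b'" by (simp add: algebra_simps)
  thus ?thesis using assms by (auto intro: fil_add fil_mult fil_mult')
qed

lemma fil_cong_power:
  assumes "a - b \<in> fil k" "a \<in> fil 0" "b \<in> fil 0"
  shows "a ^ j - b ^ j \<in> fil k"
  by (induction j) (use assms in \<open>auto intro: fil_cong_mult fil.power_mem\<close>)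

lemma fil_cong_prod_mset:
  assumes "\<And>i. i \<in># m \<Longrightarrow> y i - z i \<in> fil k" "\<And>i. i \<in># m \<Longrightarrow> y i \<in> fil 0" "\<And>i. i \<in># m \<Longrightarrow> z i \<in> fil 0"
  shows "(\<Prod>i\<in>#m. y i) - (\<Prod>i\<in>#m. z i) \<in> fil k"
  using assms by (induction m) (auto intro!: fil_cong_mult fil.prod_mset_mem)

lemma of_nat_p_fil: "of_nat p * f \<in> fil 1" if "f \<in> fil 0"
proof -
  have "mconst (of_nat p) * f \<in> fil 1"
    using v_le_pi[OF v_p_less_1] by (intro fil_mult'[OF fil_const that]) simp
  thus ?thesis by (simp add: mconst.hom_of_nat)
qed

text \<open>Only the two extreme terms of the binomial expansion survive, since p divides all inner
  binomial coefficients and multiples of p lie in \<open>fil 1\<close>.\<close>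

lemma power_p_add:
  assumes "a \<in> fil 0" "b \<in> fil 0"
  shows "(a + b) ^ p - (a ^ p + b ^ p) \<in> fil 1"
proof -
  have p: "p > 0" using prime prime_gt_0_nat by blast
  have "(a + b) ^ p = (\<Sum>k\<le>p. of_nat (p choose k) * a ^ k * b ^ (p - k))"
    by (rule binomial_ring)
  also have "{..p} = insert 0 (insert p {0<..<p})" using p by auto
  also have "(\<Sum>k\<in>\<dots>. of_nat (p choose k) * a ^ k * b ^ (p - k))
      = b ^ p + (a ^ p + (\<Sum>k\<in>{0<..<p}. of_nat (p choose k) * a ^ k * b ^ (p - k)))"
    using p by simp
  finally have "(a + b) ^ p - (a ^ p + b ^ p)
      = (\<Sum>k\<in>{0<..<p}. of_nat (p choose k) * a ^ k * b ^ (p - k))" by simp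
  also have "\<dots> \<in> fil 1"
  proof (rule fil_sum)
    fix k assume k: "k \<in> {0<..<p}"
    hence "p dvd p choose k" using prime by (intro dvd_choose_prime) auto
    then obtain c where c: "p choose k = p * c" by auto
    have "of_nat c * a ^ k * b ^ (p - k) \<in> fil 0"
    proof -
      have "(of_nat c :: 'k mps) \<in> fil 0"
        by (induction c) (auto intro: fil.add_mem fil.one_mem)
      thus ?thesis using assms by (intro fil.mult_mem fil.power_mem)
    qed
    from of_nat_p_fil[OF this]
    show "of_nat (p choose k) * a ^ k * b ^ (p - k) \<in> fil 1" by (simp add: c mult.assoc)
  qed
  finally show ?thesis .
qed

text \<open>The congruence for p^j may be raised to the p-th power, after which the case of exponent
  p splits the new sum.\<close>

lemma power_p_power_add:
  assumes "a \<in> fil 0" "b \<in> fil 0"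
  shows "(a + b) ^ (p ^ j) - (a ^ (p ^ j) + b ^ (p ^ j)) \<in> fil 1"
proof (induction j)
  case (Suc j)
  let ?q = "p ^ j"
  have "((a + b) ^ ?q) ^ p - (a ^ ?q + b ^ ?q) ^ p \<in> fil 1"
    using assms by (intro fil_cong_power Suc.IH fil.power_mem fil.add_mem)
  moreover have "(a ^ ?q + b ^ ?q) ^ p - ((a ^ ?q) ^ p + (b ^ ?q) ^ p) \<in> fil 1"
    using assms by (intro power_p_add fil.power_mem)
  ultimately have "((a + b) ^ ?q) ^ p - ((a ^ ?q) ^ p + (b ^ ?q) ^ p) \<in> fil 1"
    by (rule fil_trans)
  thus ?case by (simp add: mult.commute flip: power_mult)
qed simp

lemma power_p_power_sum:
  assumes "finite A" "\<And>x. x \<in> A \<Longrightarrow> F x \<in> fil 0"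
  shows "sum F A ^ (p ^ j) - (\<Sum>x\<in>A. F x ^ (p ^ j)) \<in> fil 1"
  using assms
proof (induction A rule: finite_induct)
  case empty
  have "p ^ j > 0" using prime prime_gt_0_nat by simp
  thus ?case by (simp add: zero_power)
next
  case (insert x A)
  have "(F x + sum F A) ^ (p ^ j) - (F x ^ (p ^ j) + sum F A ^ (p ^ j)) \<in> fil 1"
    using insert by (intro power_p_power_add fil.sum_mem) auto
  moreover have "F x ^ (p ^ j) + sum F A ^ (p ^ j) - (F x ^ (p ^ j) + (\<Sum>x\<in>A. F x ^ (p ^ j))) \<in> fil 1"
    using insert by simp
  ultimately show ?case using insert.hyps by (simp add: fil_trans)
qed

end

locale frobenius_lift = padic_galois_extension +
  fixes \<sigma> :: "'a \<Rightarrow> 'a" and p' :: nat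
  assumes sigma: "automorphism_inducing_power v \<pi> p' \<sigma>"
    and p'_power: "\<exists>d>0. p' = p ^ d"
begin

section \<open>The automorphism on coefficients\<close>

lemma comm_ring_hom_sigma: "comm_ring_hom \<sigma>"
proof -
  have "\<sigma> \<in> ring_iso class_ring class_ring"
    using sigma by (simp add: automorphism_inducing_power_def)
  note s = ring_iso_memE[OF this]
  have "\<sigma> 0 + \<sigma> 0 = \<sigma> 0" using s(3)[of 0 0] by simp
  hence "\<sigma> 0 = 0" by simp
  thus ?thesis using s by unfold_locales auto
qed

sublocale \<sigma>: comm_ring_hom \<sigma> by (rule comm_ring_hom_sigma)

lemma p'_pos: "p' > 0" using p'_power prime prime_gt_0_nat by auto

lemma sigma_integral: "v a \<le> 1 \<Longrightarrow> v (\<sigma> a) \<le> 1"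
  using sigma by (simp add: automorphism_inducing_power_def valuation_ring_def Let_def)

text \<open>The equality of cosets in the residue field puts the difference into the maximal ideal;
  discreteness then sharpens "less than 1" to the bound by \<open>v \<pi>\<close>.\<close>

lemma sigma_frobenius: assumes "v a \<le> 1" shows "v (\<sigma> a - a ^ p') \<le> v \<pi>"
proof -
  let ?R = "ring_on (valuation_ring v)"
  let ?I = "PIdl\<^bsub>?R\<^esub> \<pi>"
  have a: "a \<in> valuation_ring v" "\<sigma> a \<in> valuation_ring v" "a ^ p' \<in> valuation_ring v"
    using assms sigma_integral R.power_mem by (auto simp: valuation_ring_def)
  have I: "ideal ?I ?R"
    using v_pi_less_1 by (intro R.on.cgenideal_ideal) (auto simp: valuation_ring_def)
  have "?I +>\<^bsub>?R\<^esub> \<sigma> a = (?I +>\<^bsub>?R\<^esub> a) [^]\<^bsub>?R Quot ?I\<^esub> p'"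
    using sigma a(1) unfolding automorphism_inducing_power_def residue_field_def Let_def by blast
  also have "\<dots> = ?I +>\<^bsub>?R\<^esub> (a [^]\<^bsub>?R\<^esub> p')"
    using a(1) by (intro ring_hom_nat_pow[symmetric, OF R.rcos_hom[OF I]] R.on.ring_axioms
      ideal.quotient_is_ring[OF I]) simp
  also have "a [^]\<^bsub>?R\<^esub> p' = a ^ p'" by (rule R.nat_pow_ring_on)
  finally have "\<sigma> a - a ^ p' \<in> ?I" using R.rcos_eq_iff[OF I a(2,3)] by blast
  hence "v (\<sigma> a - a ^ p') < 1" unfolding uniformizer by simp
  thus ?thesis by (rule v_le_pi)
qed

text \<open>Continuity of \<sigma> is derived from its action on the residue field: \<sigma>(\<pi>)
  is congruent to \<pi>^p' and so stays in the maximal ideal, and a general element is \<pi>^k times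
  an integral one.\<close>

lemma sigma_le: assumes "v a \<le> v \<pi> ^ k" shows "v (\<sigma> a) \<le> v \<pi> ^ k"
proof -
  have "v (\<pi> ^ p') \<le> v \<pi>" using v_pi_power_mono[of 1 p'] p'_pos by (simp add: v_power)
  hence "v ((\<sigma> \<pi> - \<pi> ^ p') + \<pi> ^ p') \<le> v \<pi>"
    using v_pi_less_1 by (intro v_add_le sigma_frobenius) auto
  hence pi: "v (\<sigma> \<pi>) \<le> v \<pi>" by simp
  define b where "b = a / \<pi> ^ k"
  have a: "a = \<pi> ^ k * b" using pi_nonzero by (simp add: b_def)
  hence "v \<pi> ^ k * v b \<le> v \<pi> ^ k * 1" using assms by (simp add: abs_mult v_power)
  hence "v b \<le> 1" using v_pi_pos by simp
  hence "v (\<sigma> \<pi>) ^ k * v (\<sigma> b) \<le> v \<pi> ^ k * 1"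
    using pi by (intro mult_mono power_mono sigma_integral) (auto simp: abs_nonneg)
  thus ?thesis by (simp add: a \<sigma>.hom_mult \<sigma>.hom_power abs_mult v_power)
qed

text \<open>Combining \<sigma> with the embedding of constants turns the substitution g^\<sigma>(y)
  of a polynomial into \<open>mpoly_eval\<close> along a single ring homomorphism.\<close>

definition cst :: "'a \<Rightarrow> 'a mps" where "cst a = mconst (\<sigma> a)"

lemma comm_ring_hom_cst: "comm_ring_hom cst"
  by unfold_locales (auto simp: cst_def \<sigma>.hom_add \<sigma>.hom_mult mconst.hom_add mconst.hom_mult)

sublocale cst: comm_ring_hom cst by (rule comm_ring_hom_cst)

lemma cst_fil: "v a \<le> v \<pi> ^ k \<Longrightarrow> cst a \<in> fil k"
  by (simp add: cst_def fil_const sigma_le)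

lemma cst_polys: "v a \<le> 1 \<Longrightarrow> cst a \<in> polys n v"
  by (simp add: cst_def const_polys sigma_integral)

section \<open>Substitution into restricted power series as a limit\<close>

definition subst_term :: "(nat \<Rightarrow> 'a mps) \<Rightarrow> 'a mps \<Rightarrow> nat multiset \<Rightarrow> 'a mps" where
  "subst_term y g m = cst (mcoeff g m) * (\<Prod>i\<in>#m. y i)"

text \<open>The convergence condition inside \<open>tate_subst\<close>, with the levels of the
  filtration in place of \<epsilon>, so that the congruence calculus applies to it.\<close>

definition has_subst :: "(nat \<Rightarrow> 'a mps) \<Rightarrow> 'a mps \<Rightarrow> 'a mps \<Rightarrow> bool" where
  "has_subst y g h \<longleftrightarrow> (\<forall>k. \<exists>M. finite M \<and> (\<forall>M'. finite M' \<and> M \<subseteq> M' \<longrightarrow> h - sum (subst_term y g) M' \<in> fil k))"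

text \<open>Every positive \<epsilon> exceeds some \<open>v \<pi> ^ k\<close>, and each
  \<open>v \<pi> ^ k\<close> is itself a positive \<epsilon>; this also bridges the strict and the
  weak inequality.\<close>

lemma has_subst_iff:
  "(\<forall>\<epsilon>>0. \<exists>M. finite M \<and> (\<forall>M'. finite M' \<and> M \<subseteq> M' \<longrightarrow>
      (\<forall>l. v (mcoeff (h - (\<Sum>m\<in>M'. mconst (\<sigma> (mcoeff g m)) * (\<Prod>i\<in>#m. y i))) l) < \<epsilon>)))
    \<longleftrightarrow> has_subst y g h" (is "?L \<longleftrightarrow> _")
proof -
  let ?D = "\<lambda>M. h - (\<Sum>m\<in>M. mconst (\<sigma> (mcoeff g m)) * (\<Prod>i\<in>#m. y i))"
  have D: "h - sum (subst_term y g) M = ?D M" for M by (simp add: subst_term_def cst_def)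
  have fil_iff: "d \<in> fil k \<longleftrightarrow> (\<forall>l. v (mcoeff d l) \<le> v \<pi> ^ k)" for d k
    by (simp add: fil_def)
  show ?thesis
  proof
    assume L: ?L
    show "has_subst y g h" unfolding has_subst_def D
    proof
      fix k
      have "v \<pi> ^ k > 0" using v_pi_pos by simp
      from L[rule_format, OF this] obtain M where "finite M"
          "\<forall>M'. finite M' \<and> M \<subseteq> M' \<longrightarrow> (\<forall>l. v (mcoeff (?D M') l) < v \<pi> ^ k)" by auto
      thus "\<exists>M. finite M \<and> (\<forall>M'. finite M' \<and> M \<subseteq> M' \<longrightarrow> ?D M' \<in> fil k)"
        unfolding fil_iff by (meson less_imp_le)
    qed
  next
    assume h: "has_subst y g h"
    show ?L
    proof (intro allI impI)
      fix \<epsilon> :: real assume "\<epsilon> > 0"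
      then obtain k where k: "v \<pi> ^ k < \<epsilon>" using v_pi_power_less by blast
      have "\<exists>M. finite M \<and> (\<forall>M'. finite M' \<and> M \<subseteq> M' \<longrightarrow> ?D M' \<in> fil k)"
        using h unfolding has_subst_def D by (rule spec)
      then obtain M where M: "finite M" "\<forall>M'. finite M' \<and> M \<subseteq> M' \<longrightarrow> ?D M' \<in> fil k"
        by (elim exE conjE) (rule that)
      show "\<exists>M. finite M \<and> (\<forall>M'. finite M' \<and> M \<subseteq> M' \<longrightarrow> (\<forall>l. v (mcoeff (?D M') l) < \<epsilon>))"
      proof (intro exI[of _ M] conjI allI impI)
        fix M' l assume "finite M' \<and> M \<subseteq> M'"
        hence "?D M' \<in> fil k" using M(2) by blast
        hence "v (mcoeff (?D M') l) \<le> v \<pi> ^ k" unfolding fil_iff by blast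
        thus "v (mcoeff (?D M') l) < \<epsilon>" using k by (rule le_less_trans)
      qed (rule M(1))
    qed
  qed
qed

lemma has_substE:
  assumes "has_subst y g h"
  obtains M where "finite M" "\<forall>N. finite N \<longrightarrow> M \<subseteq> N \<longrightarrow> h - sum (subst_term y g) N \<in> fil k"
proof -
  have "\<exists>M. finite M \<and> (\<forall>N. finite N \<and> M \<subseteq> N \<longrightarrow> h - sum (subst_term y g) N \<in> fil k)"
    using assms unfolding has_subst_def by (rule spec)
  then obtain M where "finite M"
      and M: "\<forall>N. finite N \<and> M \<subseteq> N \<longrightarrow> h - sum (subst_term y g) N \<in> fil k"
    by (elim exE conjE) (rule that)
  show thesis by (rule that[of M]) (use \<open>finite M\<close> M in auto)
qed

text \<open>Both error bounds hold on the union of the two finite sets, and the filtration is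
  separated. This justifies the definite description in \<open>tate_subst\<close>.\<close>

lemma has_subst_unique: assumes "has_subst y g h" "has_subst y g h'" shows "h = h'"
proof (rule fil_separated_diff)
  fix k
  obtain M where M: "finite M" "\<forall>N. finite N \<longrightarrow> M \<subseteq> N \<longrightarrow> h - sum (subst_term y g) N \<in> fil k"
    by (rule has_substE[where k = k, OF assms(1)]) (rule that)
  obtain M' where M': "finite M'" "\<forall>N. finite N \<longrightarrow> M' \<subseteq> N \<longrightarrow> h' - sum (subst_term y g) N \<in> fil k"
    by (rule has_substE[where k = k, OF assms(2)]) (rule that)
  show "h - h' \<in> fil k"
    using fil_diff[OF M(2)[rule_format, of "M \<union> M'"] M'(2)[rule_format, of "M \<union> M'"]] M(1) M'(1) by simp
qed

lemma tate_subst_eq: "h \<in> tate n v \<Longrightarrow> has_subst y g h \<Longrightarrow> tate_subst n v \<sigma> y g = h"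
  unfolding tate_subst_def has_subst_iff by (rule the_equality) (auto intro: has_subst_unique)

lemma subst_term_mem:
  assumes "g \<in> tate n v" "\<And>i. i < n \<Longrightarrow> y i \<in> tate n v" "v (mcoeff g m) \<le> v \<pi> ^ k"
  shows "subst_term y g m \<in> tate n v" "subst_term y g m \<in> fil k"
proof -
  have "subst_term y g m \<in> tate n v \<and> subst_term y g m \<in> fil k"
  \<comment> \<open>If the coefficient is 0, then m may contain variables for which \<open>y\<close>
    is unknown, but the whole term is 0.\<close>
  proof (cases "mcoeff g m = 0")
    case False
    hence m: "\<And>i. i \<in># m \<Longrightarrow> y i \<in> tate n v" using assms(2) tate_vars[OF assms(1)] by blast
    have "v (mcoeff g m) \<le> 1" using assms(3) v_pi_power_le_1[of k] by linarith
    thus ?thesis unfolding subst_term_def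
      using m assms(3) by (intro conjI tate.mult_mem tate.prod_mset_mem fil_mult' fil.prod_mset_mem
        polys_tate[OF cst_polys] cst_fil) (auto intro: tate_in_fil)
  qed (simp add: subst_term_def tate.zero_mem)
  thus "subst_term y g m \<in> tate n v" "subst_term y g m \<in> fil k" by auto
qed

text \<open>The partial sums run over the finitely many exponents with coefficient of size at least
  \<open>v \<pi> ^ k\<close>. All other terms lie in \<open>fil k\<close> because the values
  \<open>y i\<close> are integral, so these sums form a sequence to which \<open>tate_limit\<close>
  applies.\<close>

lemma has_subst_exists:
  assumes g: "g \<in> tate n v" and y: "\<And>i. i < n \<Longrightarrow> y i \<in> tate n v"
  shows "\<exists>h\<in>tate n v. has_subst y g h"
proof -
  let ?M = "\<lambda>k. {m. v (mcoeff g m) \<ge> v \<pi> ^ k}"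
  let ?T = "subst_term y g"
  have fin: "finite (?M k)" for k using g v_pi_pos by (auto simp: tate_def)
  have tail: "sum ?T N - sum ?T (?M k) \<in> fil k" if "finite N" "?M k \<subseteq> N" for N k
  proof -
    have "sum ?T N - sum ?T (?M k) = sum ?T (N - ?M k)" using that by (simp add: sum_diff)
    also have "\<dots> \<in> fil k" by (intro fil_sum subst_term_mem(2)[OF g y]) auto
    finally show ?thesis .
  qed
  have "v (mcoeff g m) \<le> v \<pi> ^ 0" for m using tate_in_fil[OF g] by (simp add: fil_def)
  hence "sum ?T (?M k) \<in> tate n v" for k
    by (intro tate.sum_mem subst_term_mem(1)[OF g y, where k = 0]) auto
  moreover have "sum ?T (?M (Suc k)) - sum ?T (?M k) \<in> fil k" for k
    using v_pi_power_mono[of k "Suc k"] by (intro tail fin) force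
  ultimately obtain h where h: "h \<in> tate n v" "\<And>k. h - sum ?T (?M k) \<in> fil k"
    using tate_limit[of "\<lambda>k. sum ?T (?M k)" n] by blast
  have "h - sum ?T N \<in> fil k" if "finite N" "?M k \<subseteq> N" for N k
    using fil_diff[OF h(2)[of k] tail[OF that]] by simp
  hence "has_subst y g h" unfolding has_subst_def using fin by blast
  thus ?thesis using h(1) by blast
qed

lemma
  assumes "g \<in> tate n v" "\<And>i. i < n \<Longrightarrow> y i \<in> tate n v"
  shows tate_subst_mem: "tate_subst n v \<sigma> y g \<in> tate n v"
    and has_subst_tate_subst: "has_subst y g (tate_subst n v \<sigma> y g)"
proof -
  obtain h where "h \<in> tate n v" "has_subst y g h"
    by (rule bexE[OF has_subst_exists[OF assms]])
  thus "tate_subst n v \<sigma> y g \<in> tate n v" "has_subst y g (tate_subst n v \<sigma> y g)"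
    using tate_subst_eq[of h n y g] by auto
qed

text \<open>For a polynomial the partial sums are constant as soon as they cover the
  support.\<close>

lemma tate_subst_polys:
  assumes g: "g \<in> polys n v" and y: "\<And>i. i < n \<Longrightarrow> y i \<in> tate n v"
  shows "tate_subst n v \<sigma> y g = mpoly_eval cst y g"
proof (rule tate_subst_eq)
  have "v (mcoeff g m) \<le> v \<pi> ^ 0" for m
    using tate_in_fil[OF polys_tate[OF g]] by (simp add: fil_def)
  thus "mpoly_eval cst y g \<in> tate n v"
    unfolding mpoly_eval_def
    using subst_term_mem(1)[where y = y, OF polys_tate[OF g] y, where k = 0]
    by (intro tate.sum_mem) (auto simp: subst_term_def)
  show "has_subst y g (mpoly_eval cst y g)" unfolding has_subst_def
  proof
    fix k
    have "finite {m. mcoeff g m \<noteq> 0}" using polys_finsupp[OF g] by (simp add: finsupp_def)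
    moreover have "mpoly_eval cst y g - sum (subst_term y g) M' \<in> fil k"
      if "finite M'" "{m. mcoeff g m \<noteq> 0} \<subseteq> M'" for M'
      using cst.mpoly_eval_superset[OF that, of y] by (simp add: subst_term_def)
    ultimately show "\<exists>M. finite M \<and> (\<forall>M'. finite M' \<and> M \<subseteq> M' \<longrightarrow>
        mpoly_eval cst y g - sum (subst_term y g) M' \<in> fil k)" by blast
  qed
qed

lemma tate_subst_add:
  assumes "f \<in> tate n v" "g \<in> tate n v" and y: "\<And>i. i < n \<Longrightarrow> y i \<in> tate n v"
  shows "tate_subst n v \<sigma> y (f + g) = tate_subst n v \<sigma> y f + tate_subst n v \<sigma> y g"
proof (rule tate_subst_eq)
  let ?f = "tate_subst n v \<sigma> y f" and ?g = "tate_subst n v \<sigma> y g"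
  show "?f + ?g \<in> tate n v" using assms by (intro tate.add_mem tate_subst_mem)
  show "has_subst y (f + g) (?f + ?g)" unfolding has_subst_def
  proof
    fix k
    obtain M where M: "finite M"
        "\<forall>N. finite N \<longrightarrow> M \<subseteq> N \<longrightarrow> ?f - sum (subst_term y f) N \<in> fil k"
      by (rule has_substE[where k = k, OF has_subst_tate_subst[where y = y, OF assms(1) y]]) (assumption, rule that)
    obtain M' where M': "finite M'"
        "\<forall>N. finite N \<longrightarrow> M' \<subseteq> N \<longrightarrow> ?g - sum (subst_term y g) N \<in> fil k"
      by (rule has_substE[where k = k, OF has_subst_tate_subst[where y = y, OF assms(2) y]]) (assumption, rule that)
    have "?f + ?g - sum (subst_term y (f + g)) N \<in> fil k" if "finite N" "M \<union> M' \<subseteq> N" for N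
    proof -
      have "sum (subst_term y (f + g)) N = sum (subst_term y f) N + sum (subst_term y g) N"
        by (simp add: subst_term_def cst.hom_add distrib_right sum.distrib)
      thus ?thesis using fil_add[OF M(2)[rule_format, of N] M'(2)[rule_format, of N]] that by (simp add: algebra_simps)
    qed
    thus "\<exists>M. finite M \<and> (\<forall>M'. finite M' \<and> M \<subseteq> M' \<longrightarrow> ?f + ?g - sum (subst_term y (f + g)) M' \<in> fil k)"
      using M(1) M'(1) by (intro exI[of _ "M \<union> M'"]) auto
  qed
qed

lemma tate_subst_fil:
  assumes g: "g \<in> tate n v" "g \<in> fil k" and y: "\<And>i. i < n \<Longrightarrow> y i \<in> tate n v"
  shows "tate_subst n v \<sigma> y g \<in> fil k"
proof -
  obtain M where M: "finite M"
      "\<forall>N. finite N \<longrightarrow> M \<subseteq> N \<longrightarrow> tate_subst n v \<sigma> y g - sum (subst_term y g) N \<in> fil k"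
    by (rule has_substE[where k = k, OF has_subst_tate_subst[where y = y, OF g(1) y]]) (assumption, rule that)
  have "tate_subst n v \<sigma> y g - sum (subst_term y g) M \<in> fil k" using M by simp
  moreover have "sum (subst_term y g) M \<in> fil k"
    using g by (intro fil_sum subst_term_mem(2)[OF g(1) y]) (auto simp: fil_def)
  ultimately show ?thesis using fil_add by fastforce
qed

lemma tate_subst_cong:
  assumes "f \<in> tate n v" "g \<in> tate n v" "f - g \<in> fil k" and y: "\<And>i. i < n \<Longrightarrow> y i \<in> tate n v"
  shows "tate_subst n v \<sigma> y f - tate_subst n v \<sigma> y g \<in> fil k"
proof -
  have "tate_subst n v \<sigma> y f = tate_subst n v \<sigma> y g + tate_subst n v \<sigma> y (f - g)"
    using tate_subst_add[OF assms(2) tate.diff_mem[OF assms(1,2)] y] by simp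
  thus ?thesis using tate_subst_fil[OF tate.diff_mem[OF assms(1,2)] assms(3) y] by simp
qed

text \<open>Multiplying two limits over finite sets is avoided: modulo \<open>fil k\<close> both
  factors may be replaced by polynomials, where evaluation is multiplicative, and k is
  arbitrary.\<close>

lemma tate_subst_mult:
  assumes "f \<in> tate n v" "g \<in> tate n v" and y: "\<And>i. i < n \<Longrightarrow> y i \<in> tate n v"
  shows "tate_subst n v \<sigma> y (f * g) = tate_subst n v \<sigma> y f * tate_subst n v \<sigma> y g"
proof (rule fil_separated_diff)
  fix k
  let ?E = "tate_subst n v \<sigma> y"
  obtain f' g' where f'g': "f' \<in> polys n v" "g' \<in> polys n v" "f - f' \<in> fil k" "g - g' \<in> fil k"
    using tate_approx assms(1,2) by meson
  note t = polys_tate[OF f'g'(1)] polys_tate[OF f'g'(2)]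
  have "f * g - f' * g' \<in> fil k" using assms f'g' t by (intro fil_cong_mult tate_in_fil)
  hence 1: "?E (f * g) - ?E (f' * g') \<in> fil k"
    using assms t by (intro tate_subst_cong tate.mult_mem)
  have 2: "?E (f' * g') = ?E f' * ?E g'"
    using f'g' y by (simp add: tate_subst_polys polys.mult_mem cst.mpoly_eval_mult polys_finsupp)
  have 3: "?E f * ?E g - ?E f' * ?E g' \<in> fil k"
    using assms f'g' t by (intro fil_cong_mult tate_subst_cong tate_in_fil[of _ n] tate_subst_mem)
  show "?E (f * g) - ?E f * ?E g \<in> fil k"
    using fil_diff[OF 1 3] by (simp add: 2)
qed

lemma tate_subst_const:
  assumes "v a \<le> 1" "\<And>i. i < n \<Longrightarrow> y i \<in> tate n v"
  shows "tate_subst n v \<sigma> y (mconst a) = mconst (\<sigma> a)"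
  using assms by (simp add: tate_subst_polys const_polys cst.mpoly_eval_const) (simp add: cst_def)

section \<open>Substitutions congruent to the p'-power map\<close>

lemma eval_mem:
  assumes "g \<in> polys n v" "\<And>i. i < n \<Longrightarrow> y i \<in> tate n v"
  shows "mpoly_eval cst y g \<in> tate n v"
  using tate_subst_polys[OF assms] tate_subst_mem[OF polys_tate[OF assms(1)] assms(2)] by simp

lemma eval_cong:
  assumes g: "g \<in> polys n v"
    and yz: "\<And>i. i < n \<Longrightarrow> y i - z i \<in> fil k" "\<And>i. i < n \<Longrightarrow> y i \<in> fil 0" "\<And>i. i < n \<Longrightarrow> z i \<in> fil 0"
  shows "mpoly_eval cst y g - mpoly_eval cst z g \<in> fil k"
  unfolding mpoly_eval_def sum_subtractf[symmetric]
proof (rule fil_sum)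
  fix m assume "m \<in> {m. mcoeff g m \<noteq> 0}"
  hence "\<And>i. i \<in># m \<Longrightarrow> i < n" using tate_vars[OF polys_tate[OF g], of m] by auto
  moreover have "cst (mcoeff g m) \<in> fil 0"
    using tate_in_fil[OF polys_tate[OF g]] by (intro cst_fil) (simp add: fil_def)
  ultimately show "cst (mcoeff g m) * (\<Prod>i\<in>#m. y i) - cst (mcoeff g m) * (\<Prod>i\<in>#m. z i) \<in> fil k"
    using yz by (auto intro!: fil_mult fil_cong_prod_mset simp flip: right_diff_distrib)
qed

lemma var_power_tate: "i < n \<Longrightarrow> mvar i ^ k \<in> tate n v"
  by (intro tate.power_mem polys_tate var_polys)

text \<open>Both sides are compared with the sum of the p'-th powers of the terms of g: the
  evaluation because \<sigma>(c) is congruent to c^p', the power because p'-th powers are additive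
  modulo \<pi>.\<close>

lemma eval_frobenius:
  assumes g: "g \<in> polys n v"
  shows "mpoly_eval cst (\<lambda>i. mvar i ^ p') g - g ^ p' \<in> fil 1"
proof -
  let ?M = "{m. mcoeff g m \<noteq> 0}"
  let ?t = "\<lambda>m. mmonom m (mcoeff g m)"
  have fin: "finite ?M" using polys_finsupp[OF g] by (simp add: finsupp_def)
  have int: "v (mcoeff g m) \<le> 1" for m
    using tate_in_fil[OF polys_tate[OF g]] by (simp add: fil_def)
  obtain d where d: "p' = p ^ d" using p'_power by blast
  have t: "?t m = mconst (mcoeff g m) * (\<Prod>i\<in>#m. mvar i)" for m
    by (simp add: prod_mset_mvar mconst_conv_monom mmonom_mult)
  have "(\<Prod>i\<in>#m. mvar i ^ p' :: 'a mps) = (\<Prod>i\<in>#m. mvar i) ^ p'" for m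
    by (induction m) (auto simp: power_mult_distrib)
  hence tp: "?t m ^ p' = mconst (mcoeff g m ^ p') * (\<Prod>i\<in>#m. mvar i ^ p')" for m
    by (simp add: t power_mult_distrib mconst.hom_power)
  have mon: "(\<Prod>i\<in>#m. mvar i ^ p' :: 'a mps) \<in> fil 0" if "m \<in> ?M" for m
    using that tate_vars[OF polys_tate[OF g], of m]
    by (intro fil.prod_mset_mem tate_in_fil[OF var_power_tate, of _ n]) auto
  have "mpoly_eval cst (\<lambda>i. mvar i ^ p') g - (\<Sum>m\<in>?M. ?t m ^ p') \<in> fil 1"
    unfolding mpoly_eval_def sum_subtractf[symmetric]
  proof (rule fil_sum)
    fix m assume m: "m \<in> ?M"
    have "mconst (\<sigma> (mcoeff g m) - mcoeff g m ^ p') \<in> fil 1"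
      using sigma_frobenius[OF int] by (intro fil_const) simp
    hence "(cst (mcoeff g m) - mconst (mcoeff g m ^ p')) * (\<Prod>i\<in>#m. mvar i ^ p') \<in> fil 1"
      by (intro fil_mult' mon[OF m]) (simp add: cst_def mconst.hom_minus)
    thus "cst (mcoeff g m) * (\<Prod>i\<in>#m. mvar i ^ p') - ?t m ^ p' \<in> fil 1"
      by (simp add: tp left_diff_distrib)
  qed
  moreover have "sum ?t ?M ^ p' - (\<Sum>m\<in>?M. ?t m ^ p') \<in> fil 1"
    unfolding d using fin int by (intro power_p_power_sum) (auto simp: fil_def mcoeff_monom)
  moreover have "sum ?t ?M = g" using fin by (intro sum_monomials) auto
  ultimately show ?thesis using fil_diff by fastforce
qed

text \<open>The power is taken of a polynomial h close to g, because \<open>tate_reduction\<close>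
  computes the class of a restricted series through such polynomials.\<close>

lemma tate_subst_frobenius:
  assumes g: "g \<in> tate n v" and h: "h \<in> polys n v" "g - h \<in> fil 1"
    and y: "\<And>i. i < n \<Longrightarrow> y i \<in> tate n v" "\<And>i. i < n \<Longrightarrow> y i - mvar i ^ p' \<in> fil 1"
  shows "tate_subst n v \<sigma> y g - h ^ p' \<in> fil 1"
proof -
  have "tate_subst n v \<sigma> y g - mpoly_eval cst y h \<in> fil 1"
    using tate_subst_cong[OF g polys_tate[OF h(1)] h(2) y(1)] h(1) y by (simp add: tate_subst_polys)
  moreover have "mpoly_eval cst y h - mpoly_eval cst (\<lambda>i. mvar i ^ p') h \<in> fil 1"
    using y by (intro eval_cong[OF h(1)]) (auto intro: tate_in_fil var_power_tate)
  ultimately show ?thesis using eval_frobenius[OF h(1)] by (blast intro: fil_trans)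
qed

lemma psi_polys: "g \<in> polys n v \<Longrightarrow> psi n v \<sigma> p' g = mpoly_eval cst (\<lambda>i. mvar i ^ p') g"
  unfolding psi_def by (rule tate_subst_polys) (auto intro: var_power_tate)

lemma psi_mem: "g \<in> polys n v \<Longrightarrow> psi n v \<sigma> p' g \<in> tate n v"
  by (simp add: psi_polys eval_mem var_power_tate)

lemma psi_var: "i < n \<Longrightarrow> psi n v \<sigma> p' (mvar i) = mvar i ^ p'"
  by (simp add: psi_polys var_polys cst.mpoly_eval_var)

end

section \<open>Taylor expansion and the lift equation\<close>

lemma mderiv_add: "mderiv i (f + g) = mderiv i f + mderiv i g"
  by (rule mps_eqI) (simp add: mcoeff_deriv distrib_left)

lemma mderiv_zero: "mderiv i 0 = 0"
  by (rule mps_eqI) (simp add: mcoeff_deriv)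

lemma mderiv_sum: "mderiv i (sum F A) = (\<Sum>x\<in>A. mderiv i (F x))"
  by (induction A rule: infinite_finite_induct) (auto simp: mderiv_zero mderiv_add)

text \<open>If i does not occur in m, then \<open>m - {#i#}\<close> is m itself, but the factor
  \<open>count m i\<close> is 0; one formula covers both cases.\<close>

lemma mderiv_monom: "mderiv i (mmonom m c) = mmonom (m - {#i#}) (of_nat (count m i) * c)"
proof (rule mps_eqI)
  fix l
  show "mcoeff (mderiv i (mmonom m c)) l = mcoeff (mmonom (m - {#i#}) (of_nat (count m i) * c)) l"
  proof (cases "i \<in># m")
    case True
    then obtain m' where "m = add_mset i m'" by (blast dest: multi_member_split)
    thus ?thesis by (simp add: mcoeff_deriv mcoeff_monom)
  next
    case False
    hence "add_mset i l \<noteq> m" "count m i = 0" by (auto simp: count_eq_zero_iff)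
    thus ?thesis by (simp add: mcoeff_deriv mcoeff_monom)
  qed
qed

text \<open>Transitivity of substitution: inserting s for the outer variables after inserting
  polynomials \<open>y i\<close> is the same as inserting the values of the \<open>y i\<close>. It
  converts the formal G(S) into an equation in R<x>.\<close>

lemma (in comm_ring_hom) mpoly_eval_comp:
  assumes f: "finsupp f" and y: "\<And>m i. mcoeff f m \<noteq> 0 \<Longrightarrow> i \<in># m \<Longrightarrow> finsupp (y i)"
  shows "mpoly_eval id s (mpoly_eval (\<lambda>a. mconst (hom a)) y f) = mpoly_eval hom (\<lambda>i. mpoly_eval id s (y i)) f"
proof -
  interpret ev: comm_ring_hom "id :: 'b \<Rightarrow> 'b" by unfold_locales auto
  have fin: "finsupp (mconst (hom (mcoeff f m)) * (\<Prod>i\<in>#m. y i))" if "mcoeff f m \<noteq> 0" for m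
    using y[OF that] by (intro finsupp_mult finsupp_const finsupp_prod_mset)
  have "mpoly_eval id s (mconst (hom (mcoeff f m)) * (\<Prod>i\<in>#m. y i))
      = hom (mcoeff f m) * (\<Prod>i\<in>#m. mpoly_eval id s (y i))" if "mcoeff f m \<noteq> 0" for m
    using y[OF that]
    by (simp add: ev.mpoly_eval_mult finsupp_prod_mset ev.mpoly_eval_const ev.mpoly_eval_prod_mset)
  thus ?thesis unfolding mpoly_eval_def[of "\<lambda>a. mconst (hom a)"] mpoly_eval_def[of hom]
    by (subst ev.mpoly_eval_sum) (auto intro!: fin sum.cong)
qed

lemma (in padic_galois_extension) deriv_polys:
  assumes g: "g \<in> polys n v" shows "mderiv i g \<in> polys n v"
proof (rule polysI)
  have "v (of_nat c) \<le> 1" for c :: nat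
    by (induction c) (auto intro: v_add_le)
  hence "v (of_nat c * x) \<le> 1" if "v x \<le> 1" for c x
    using that by (simp add: abs_mult abs_nonneg mult_le_one)
  thus "mderiv i g \<in> fil 0"
    using tate_in_fil[OF polys_tate[OF g]]
    by (auto simp: fil_def mcoeff_deriv simp del: of_nat_Suc of_nat_add)
  show "finsupp (mderiv i g)" using polys_finsupp[OF g] by simp
  fix m assume "mcoeff (mderiv i g) m \<noteq> 0"
  hence "mcoeff g (add_mset i m) \<noteq> 0" by (auto simp: mcoeff_deriv)
  thus "set_mset m \<subseteq> {..<n}" using tate_vars[OF polys_tate[OF g]] by force
qed

text \<open>The Leibniz rule for the monomial x_j x^m, differentiated by x_i and evaluated at
  y.\<close>

lemma count_prod_mset_add:
  fixes y :: "nat \<Rightarrow> 'b::comm_ring_1"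
  shows "of_nat (count (add_mset j m) i) * (\<Prod>l\<in>#add_mset j m - {#i#}. y l)
    = y j * (of_nat (count m i) * (\<Prod>l\<in>#m - {#i#}. y l)) + (if i = j then \<Prod>l\<in>#m. y l else 0)"
proof (cases "i = j")
  case True
  show ?thesis
  proof (cases "j \<in># m")
    case jm: True
    hence "(\<Prod>l\<in>#m. y l) = y j * (\<Prod>l\<in>#m - {#j#}. y l)"
      by (metis image_mset_add_mset insert_DiffM prod_mset.add_mset)
    thus ?thesis using True by (simp add: algebra_simps)
  qed (use True in \<open>simp add: count_eq_zero_iff[THEN iffD2]\<close>)
next
  case False
  show ?thesis
  proof (cases "i \<in># m")
    case True
    hence "add_mset j m - {#i#} = add_mset j (m - {#i#})" using False by (simp add: multi_self_add_other_not_self diff_add_mset_swap)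
    thus ?thesis using False by (simp add: algebra_simps)
  qed (use False in \<open>simp add: count_eq_zero_iff[THEN iffD2]\<close>)
qed

context frobenius_lift begin

text \<open>What remains after the linear part has at least two factors t. In the induction,
  multiplication by y_j + t_j turns the old remainder Q and linear part W into the remainder y_j Q +
  t_j W + t_j Q.\<close>

lemma taylor_monomial:
  fixes y t :: "nat \<Rightarrow> 'a mps"
  assumes y: "\<And>i. i < n \<Longrightarrow> y i \<in> fil 0" and t: "\<And>i. i < n \<Longrightarrow> t i \<in> fil k"
    and "set_mset m \<subseteq> {..<n}"
  shows "(\<Prod>i\<in>#m. y i + t i) - (\<Prod>i\<in>#m. y i)
    - (\<Sum>i<n. of_nat (count m i) * (\<Prod>l\<in>#m - {#i#}. y l) * t i) \<in> fil (2 * k)"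
  using assms(3)
proof (induction m)
  case (add j m)
  let ?X = "\<Prod>i\<in>#m. y i + t i" and ?Y = "\<Prod>i\<in>#m. y i"
  let ?W = "\<lambda>m. \<Sum>i<n. of_nat (count m i) * (\<Prod>l\<in>#m - {#i#}. y l) * t i"
  let ?Q = "?X - ?Y - ?W m"
  have j: "j < n" and m: "set_mset m \<subseteq> {..<n}" using add.prems by auto
  have Q: "?Q \<in> fil (2 * k)" by (rule add.IH[OF m])
  \<comment> \<open>The linear part already has level k; the additional factor \<open>t j\<close>
    brings it to 2k.\<close>
  have "?W m \<in> fil k"
  proof (intro fil_sum fil_mult fil.mult_mem fil.prod_mset_mem)
    show "of_nat c \<in> fil 0" for c by (induction c) (auto intro: fil.add_mem fil.one_mem)
    show "y l \<in> fil 0" if "l \<in># m - {#i#}" for l i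
      using in_diffD[OF that] m by (intro y) auto
  qed (auto intro: t)
  hence W: "t j * ?W m \<in> fil (2 * k)" using fil_mult_add[OF t[OF j], of "?W m" k] by (simp add: mult_2)
  have tj: "t j \<in> fil 0" using fil_mono[OF t[OF j]] by simp
  have "?W (add_mset j m) = (\<Sum>i<n. y j * (of_nat (count m i) * (\<Prod>l\<in>#m - {#i#}. y l) * t i)
      + (if i = j then ?Y * t j else 0))"
  proof (rule sum.cong)
    fix i
    show "of_nat (count (add_mset j m) i) * (\<Prod>l\<in>#add_mset j m - {#i#}. y l) * t i
        = y j * (of_nat (count m i) * (\<Prod>l\<in>#m - {#i#}. y l) * t i) + (if i = j then ?Y * t j else 0)"
      using count_prod_mset_add[of j m i y]
      by (simp only: distrib_right mult.assoc) simp
  qed simp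
  also have "\<dots> = y j * ?W m + ?Y * t j"
    using j by (simp add: sum.distrib sum_distrib_left)
  finally have "(\<Prod>i\<in>#add_mset j m. y i + t i) - (\<Prod>i\<in>#add_mset j m. y i) - ?W (add_mset j m)
      = y j * ?Q + t j * ?W m + t j * ?Q"
    by (simp add: algebra_simps)
  also have "\<dots> \<in> fil (2 * k)"
    by (intro fil_add fil_mult y j Q W tj)
  finally show ?case .
qed simp

text \<open>The monomial case is summed over the terms of g. Second derivatives never appear, so
  nothing is divided by 2, and the bound holds for every residue characteristic.\<close>

lemma taylor:
  assumes g: "g \<in> polys n v"
    and y: "\<And>i. i < n \<Longrightarrow> y i \<in> fil 0" and t: "\<And>i. i < n \<Longrightarrow> t i \<in> fil k"
  shows "mpoly_eval cst (\<lambda>i. y i + t i) g - mpoly_eval cst y g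
    - (\<Sum>i<n. mpoly_eval cst y (mderiv i g) * t i) \<in> fil (2 * k)"
proof -
  let ?M = "{m. mcoeff g m \<noteq> 0}"
  let ?t = "\<lambda>m. mmonom m (mcoeff g m)"
  have fin: "finite ?M" using polys_finsupp[OF g] by (simp add: finsupp_def)
  have "mderiv i g = (\<Sum>m\<in>?M. mderiv i (?t m))" for i
    using sum_monomials[OF fin, of g] by (simp flip: mderiv_sum)
  hence "mpoly_eval cst y (mderiv i g)
      = (\<Sum>m\<in>?M. cst (mcoeff g m) * (of_nat (count m i) * (\<Prod>l\<in>#m - {#i#}. y l)))" for i
    by (simp add: cst.mpoly_eval_sum mderiv_monom cst.mpoly_eval_monom cst.hom_mult cst.hom_of_nat mult_ac)
  hence "(\<Sum>i<n. mpoly_eval cst y (mderiv i g) * t i)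
      = (\<Sum>i<n. \<Sum>m\<in>?M. cst (mcoeff g m) * (of_nat (count m i) * (\<Prod>l\<in>#m - {#i#}. y l) * t i))"
    by (simp add: sum_distrib_right sum_distrib_left mult_ac)
  also have "\<dots> = (\<Sum>m\<in>?M. \<Sum>i<n. cst (mcoeff g m) * (of_nat (count m i) * (\<Prod>l\<in>#m - {#i#}. y l) * t i))"
    by (rule sum.swap)
  finally have "mpoly_eval cst (\<lambda>i. y i + t i) g - mpoly_eval cst y g
      - (\<Sum>i<n. mpoly_eval cst y (mderiv i g) * t i)
      = (\<Sum>m\<in>?M. cst (mcoeff g m) * ((\<Prod>i\<in>#m. y i + t i) - (\<Prod>i\<in>#m. y i)
          - (\<Sum>i<n. of_nat (count m i) * (\<Prod>l\<in>#m - {#i#}. y l) * t i)))"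
    by (simp add: mpoly_eval_def sum_subtractf right_diff_distrib sum_distrib_left)
  also have "\<dots> \<in> fil (2 * k)"
  proof (intro fil_sum fil_mult taylor_monomial y t)
    fix m assume "m \<in> ?M"
    thus "set_mset m \<subseteq> {..<n}" using tate_vars[OF polys_tate[OF g], of m] by simp
    show "cst (mcoeff g m) \<in> fil 0"
      using tate_in_fil[OF polys_tate[OF g]] by (intro cst_fil) (simp add: fil_def)
  qed
  finally show ?thesis .
qed

end

locale lift_data = frobenius_lift p Qp v \<pi> e \<sigma> p'
  for p :: nat and Qp :: "'k::field_char_0 set" and v :: "'k \<Rightarrow> real" and \<pi> :: 'k and e :: nat
    and \<sigma> :: "'k \<Rightarrow> 'k" and p' :: nat +
  fixes n d :: nat and f :: "'k mps vec" and P :: "'k mps mat" and \<Delta> :: "nat \<Rightarrow> 'k mps mat"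
  assumes f_carrier: "f \<in> carrier_vec d" and f_polys: "set\<^sub>v f \<subseteq> polys n v"
    and P_carrier: "P \<in> carrier_mat n d" and P_polys: "elements_mat P \<subseteq> polys n v"
    and \<Delta>_carrier: "\<And>j. j < d \<Longrightarrow> \<Delta> j \<in> carrier_mat d d"
    and \<Delta>_polys: "\<And>j. j < d \<Longrightarrow> elements_mat (\<Delta> j) \<subseteq> polys n v"
    and jacobian_P: "elements_mat (jacobian n f * P
          - (1\<^sub>m d + mat d d (\<lambda>ab. \<Sum>j<d. f $ j * \<Delta> j $$ ab))) \<subseteq> pi_multiples \<pi> (polys n v)"
begin

section \<open>The data and the equation in components\<close>

lemma f_mem: "a < d \<Longrightarrow> f $ a \<in> polys n v"
  using f_carrier f_polys vec_setI[of f a] by auto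

lemma P_mem: "i < n \<Longrightarrow> b < d \<Longrightarrow> P $$ (i, b) \<in> polys n v"
  using P_carrier P_polys elements_matI[of P n d i b] by auto

lemma \<Delta>_mem: "j < d \<Longrightarrow> a < d \<Longrightarrow> b < d \<Longrightarrow> \<Delta> j $$ (a, b) \<in> polys n v"
  using \<Delta>_carrier[of j] \<Delta>_polys[of j] elements_matI[of "\<Delta> j" d d a b] by auto

lemma jacobian_P_entry:
  assumes "a < d" "b < d"
  shows "(\<Sum>i<n. mderiv i (f $ a) * P $$ (i, b))
    - ((if a = b then 1 else 0) + (\<Sum>j<d. f $ j * \<Delta> j $$ (a, b))) \<in> polys n v \<inter> fil 1"
proof -
  let ?M = "jacobian n f * P - (1\<^sub>m d + mat d d (\<lambda>ab. \<Sum>j<d. f $ j * \<Delta> j $$ ab))"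
  have "?M $$ (a, b) \<in> elements_mat ?M"
    using assms P_carrier f_carrier by (intro elements_matI[of _ d d a b]) (auto simp: jacobian_def)
  hence "?M $$ (a, b) \<in> polys n v \<inter> fil 1" using jacobian_P pi_multiples_polys by blast
  also have "?M $$ (a, b) = (\<Sum>i<n. mderiv i (f $ a) * P $$ (i, b))
    - ((if a = b then 1 else 0) + (\<Sum>j<d. f $ j * \<Delta> j $$ (a, b)))"
    using assms P_carrier f_carrier
    by (simp add: jacobian_def scalar_prod_def atLeast0LessThan)
  finally show ?thesis .
qed

abbreviation \<psi> :: "'k mps \<Rightarrow> 'k mps" where "\<psi> \<equiv> psi n v \<sigma> p'"

text \<open>Functions on indices replace vectors here and in \<open>G\<close>, so that later
  computations are plain finite sums; \<open>psi_shift_index\<close> and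
  \<open>lift_equation_at_index\<close> give the translation.\<close>

definition shift :: "(nat \<Rightarrow> 'k mps) \<Rightarrow> nat \<Rightarrow> 'k mps" where
  "shift s i = mvar i ^ p' + (\<Sum>b<d. \<psi> (P $$ (i, b)) * s b)"

definition G :: "(nat \<Rightarrow> 'k mps) \<Rightarrow> nat \<Rightarrow> 'k mps" where
  "G s a = mpoly_eval cst (shift s) (f $ a) - (f $ a) ^ p'
    - (\<Sum>j<d. (f $ j) ^ p' * (\<Sum>b<d. \<psi> (\<Delta> j $$ (a, b)) * s b))"

lemma psi_shift_index:
  assumes "s \<in> carrier_vec d" "i < n"
  shows "psi_shift n v \<sigma> p' P s $ i = shift (($) s) i"
  using assms P_carrier
  by (simp add: psi_shift_def shift_def psi_var scalar_prod_def atLeast0LessThan)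

text \<open>In the lift equation the outer variables are S, and the series in x are coefficients.
  Evaluation at s commutes with the substitution into f by \<open>mpoly_eval_comp\<close>; most of
  the work is to check that all intermediate series have finite support in S.\<close>

lemma lift_equation_at_index:
  assumes s: "s \<in> carrier_vec d" and a: "a < d"
  shows "lift_equation_at (lift_equation n v \<sigma> p' f P \<Delta>) s $ a = G (($) s) a"
proof -
  interpret ev: comm_ring_hom "id :: 'k mps \<Rightarrow> 'k mps" by unfold_locales auto
  let ?Y = "map_vec mconst (map_vec \<psi> (var_vec n)) + map_mat mconst (map_mat \<psi> P) *\<^sub>v var_vec d"
  have Y: "?Y $ i = mconst (mvar i ^ p') + (\<Sum>b<d. mconst (\<psi> (P $$ (i, b))) * mvar b)" if "i < n" for i
    using that P_carrier by (simp add: psi_var scalar_prod_def atLeast0LessThan)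
  have D: "(map_mat mconst (map_mat \<psi> (\<Delta> j)) *\<^sub>v var_vec d) $ a
      = (\<Sum>b<d. mconst (\<psi> (\<Delta> j $$ (a, b))) * mvar b)" if "j < d" for j
    using that a \<Delta>_carrier[OF that] by (simp add: scalar_prod_def atLeast0LessThan)
  have eq: "lift_equation n v \<sigma> p' f P \<Delta> $ a = mpoly_eval (\<lambda>c. mconst (cst c)) (\<lambda>i. ?Y $ i) (f $ a)
      - mconst ((f $ a) ^ p')
      - (\<Sum>j<d. mconst ((f $ j) ^ p') * (\<Sum>b<d. mconst (\<psi> (\<Delta> j $$ (a, b))) * mvar b))"
    using a f_carrier D by (simp add: lift_equation_def Let_def cst_def)
  have dim: "dim_vec (lift_equation n v \<sigma> p' f P \<Delta>) = d"
    using f_carrier by (simp add: lift_equation_def Let_def)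
  have vars: "i < n" if "mcoeff (f $ a) m \<noteq> 0" "i \<in># m" for m i
    using tate_vars[OF polys_tate[OF f_mem[OF a]] that(1)] that(2) by auto
  have finY: "finsupp (?Y $ i)" if "i < n" for i
    unfolding Y[OF that] by (intro finsupp_add finsupp_sum finsupp_mult) auto
  have fin1: "finsupp (mpoly_eval (\<lambda>c. mconst (cst c)) (\<lambda>i. ?Y $ i) (f $ a))"
    unfolding mpoly_eval_def using finY vars
    by (intro finsupp_sum finsupp_mult finsupp_prod_mset) auto
  have fin2: "finsupp (\<Sum>j<d. mconst ((f $ j) ^ p') * (\<Sum>b<d. mconst (\<psi> (\<Delta> j $$ (a, b))) * mvar b))"
    by (intro finsupp_sum finsupp_mult) auto
  have evY: "mpoly_eval id (($) s) (?Y $ i) = shift (($) s) i" if "i < n" for i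
    unfolding Y[OF that] shift_def
    by (simp add: ev.mpoly_eval_add ev.mpoly_eval_sum ev.mpoly_eval_mult ev.mpoly_eval_const
      ev.mpoly_eval_var finsupp_sum)
  have "mpoly_eval id (($) s) (mpoly_eval (\<lambda>c. mconst (cst c)) (\<lambda>i. ?Y $ i) (f $ a))
      = mpoly_eval cst (\<lambda>i. mpoly_eval id (($) s) (?Y $ i)) (f $ a)"
    by (intro cst.mpoly_eval_comp polys_finsupp[OF f_mem[OF a]] finY) (rule vars)
  also have "\<dots> = mpoly_eval cst (shift (($) s)) (f $ a)"
    by (intro mpoly_eval_cong evY) (rule vars)
  finally have "mpoly_eval id (($) s) (lift_equation n v \<sigma> p' f P \<Delta> $ a) = G (($) s) a"
    unfolding eq G_def
    by (simp add: ev.mpoly_eval_diff fin1 fin2 ev.mpoly_eval_sum ev.mpoly_eval_mult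
      ev.mpoly_eval_const ev.mpoly_eval_var finsupp_sum)
  thus ?thesis using a by (simp add: lift_equation_at_def dim)
qed

lemma shift_tate: "(\<And>b. b < d \<Longrightarrow> s b \<in> tate n v) \<Longrightarrow> i < n \<Longrightarrow> shift s i \<in> tate n v"
  unfolding shift_def
  by (intro tate.add_mem tate.sum_mem tate.mult_mem var_power_tate psi_mem P_mem) auto

text \<open>The shift is affine in s, with the integral coefficients \<psi>(P).\<close>

lemma shift_cong:
  assumes "\<And>b. b < d \<Longrightarrow> s b - s' b \<in> fil k" "i < n"
  shows "shift s i - shift s' i \<in> fil k"
proof -
  have "shift s i - shift s' i = (\<Sum>b<d. \<psi> (P $$ (i, b)) * (s b - s' b))"
    by (simp add: shift_def right_diff_distrib sum_subtractf)
  also have "\<dots> \<in> fil k"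
    using assms by (intro fil_sum fil_mult tate_in_fil[OF psi_mem] P_mem) auto
  finally show ?thesis .
qed

lemma shift_frobenius:
  assumes "\<And>b. b < d \<Longrightarrow> s b \<in> fil 1" "i < n"
  shows "shift s i - mvar i ^ p' \<in> fil 1"
  using shift_cong[of s "\<lambda>_. 0" 1 i] assms by (simp add: shift_def)

lemma G_tate:
  assumes "\<And>b. b < d \<Longrightarrow> s b \<in> tate n v" "a < d"
  shows "G s a \<in> tate n v"
  unfolding G_def using assms
  by (intro tate.diff_mem tate.sum_mem tate.mult_mem tate.power_mem eval_mem shift_tate
    polys_tate[OF f_mem] f_mem psi_mem \<Delta>_mem) auto

text \<open>The terms linear in s vanish, and the rest is the Frobenius congruence for one component
  of f.\<close>

lemma G_zero: assumes "a < d" shows "G (\<lambda>_. 0) a \<in> fil 1"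
proof -
  have "shift (\<lambda>_. 0) = (\<lambda>i. mvar i ^ p')" by (simp add: shift_def fun_eq_iff)
  thus ?thesis using eval_frobenius[OF f_mem[OF assms]] by (simp add: G_def)
qed

lemma psi_frobenius: "g \<in> polys n v \<Longrightarrow> \<psi> g - g ^ p' \<in> fil 1"
  using eval_frobenius[of g n] by (simp add: psi_polys)

lemma psi_fil: "g \<in> polys n v \<Longrightarrow> g \<in> fil 1 \<Longrightarrow> \<psi> g \<in> fil 1"
  unfolding psi_def by (rule tate_subst_fil) (auto intro: polys_tate var_power_tate)

lemma psi_add: "g \<in> polys n v \<Longrightarrow> h \<in> polys n v \<Longrightarrow> \<psi> (g + h) = \<psi> g + \<psi> h"
  by (simp add: psi_polys polys.add_mem cst.mpoly_eval_add polys_finsupp)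

lemma psi_mult: "g \<in> polys n v \<Longrightarrow> h \<in> polys n v \<Longrightarrow> \<psi> (g * h) = \<psi> g * \<psi> h"
  by (simp add: psi_polys polys.mult_mem cst.mpoly_eval_mult polys_finsupp)

lemma psi_sum: "(\<And>x. x \<in> A \<Longrightarrow> F x \<in> polys n v) \<Longrightarrow> \<psi> (sum F A) = (\<Sum>x\<in>A. \<psi> (F x))"
proof -
  assume F: "\<And>x. x \<in> A \<Longrightarrow> F x \<in> polys n v"
  have "\<psi> (sum F A) = (\<Sum>x\<in>A. mpoly_eval cst (\<lambda>i. mvar i ^ p') (F x))"
    using F by (subst psi_polys) (auto intro: polys.sum_mem cst.mpoly_eval_sum polys_finsupp)
  thus ?thesis using F by (simp add: psi_polys)
qed

text \<open>This is \<psi> applied to the congruence on the Jacobian matrix, with \<psi>(f_j) then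
  replaced by f_j^p'. In this form the sum over j is exactly the linear correction in
  \<open>G\<close>.\<close>

lemma psi_jacobian_P:
  assumes "a < d" "b < d"
  shows "(\<Sum>i<n. \<psi> (mderiv i (f $ a)) * \<psi> (P $$ (i, b)))
    - ((if a = b then 1 else 0) + (\<Sum>j<d. (f $ j) ^ p' * \<psi> (\<Delta> j $$ (a, b)))) \<in> fil 1"
proof -
  let ?L = "\<Sum>i<n. mderiv i (f $ a) * P $$ (i, b)" and ?D = "\<Sum>j<d. f $ j * \<Delta> j $$ (a, b)"
  let ?\<delta> = "if a = b then 1 else 0 :: 'k mps"
  \<comment> \<open>The error of the given congruence is a polynomial in \<open>fil 1\<close>, and
    \<psi> keeps it in \<open>fil 1\<close>.\<close>
  define q where "q = ?L - (?\<delta> + ?D)"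
  have q: "q \<in> polys n v" "q \<in> fil 1" using jacobian_P_entry[OF assms] by (auto simp: q_def)
  have D: "?D \<in> polys n v" using assms by (intro polys.sum_mem polys.mult_mem f_mem \<Delta>_mem) auto
  have \<delta>: "?\<delta> \<in> polys n v" by (auto intro: polys.one_mem polys.zero_mem)
  have psi\<delta>: "\<psi> ?\<delta> = ?\<delta>"
    using psi_polys[OF \<delta>] cst.mpoly_eval_const[of _ 1] by (auto simp: cst.mpoly_eval_zero)
  have "(\<Sum>i<n. \<psi> (mderiv i (f $ a)) * \<psi> (P $$ (i, b))) = \<psi> ?L"
    using assms by (subst psi_sum) (auto intro!: sum.cong polys.mult_mem simp: psi_mult deriv_polys f_mem P_mem)
  also have "?L = ?\<delta> + ?D + q" by (simp add: q_def)
  also have "\<psi> \<dots> = ?\<delta> + \<psi> ?D + \<psi> q"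
    using \<delta> D q by (simp add: psi_add polys.add_mem psi\<delta>)
  also have "\<psi> ?D = (\<Sum>j<d. \<psi> (f $ j) * \<psi> (\<Delta> j $$ (a, b)))"
    using assms by (subst psi_sum) (auto intro!: sum.cong polys.mult_mem simp: psi_mult f_mem \<Delta>_mem)
  finally have "(\<Sum>i<n. \<psi> (mderiv i (f $ a)) * \<psi> (P $$ (i, b)))
      - (?\<delta> + (\<Sum>j<d. (f $ j) ^ p' * \<psi> (\<Delta> j $$ (a, b))))
      = (\<Sum>j<d. (\<psi> (f $ j) - (f $ j) ^ p') * \<psi> (\<Delta> j $$ (a, b))) + \<psi> q"
    by (simp add: left_diff_distrib sum_subtractf)
  also have "\<dots> \<in> fil 1"
    using assms q
    by (intro fil_add fil_sum fil_mult' psi_frobenius psi_fil tate_in_fil[OF psi_mem] f_mem \<Delta>_mem) auto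
  finally show ?thesis .
qed

text \<open>This says that \<open>s \<mapsto> s - G s\<close> contracts differences \<open>\<pi>\<close>-adically.\<close>

lemma G_diff:
  assumes k: "k \<ge> 1" and a: "a < d"
    and s: "\<And>b. b < d \<Longrightarrow> s b \<in> tate n v" "\<And>b. b < d \<Longrightarrow> s' b \<in> tate n v"
      "\<And>b. b < d \<Longrightarrow> s' b \<in> fil 1" "\<And>b. b < d \<Longrightarrow> s b - s' b \<in> fil k"
  shows "G s a - G s' a - (s a - s' a) \<in> fil (Suc k)"
proof -
  let ?E = "mpoly_eval cst"
  define \<delta> where "\<delta> = (\<lambda>b. s b - s' b)"
  define t where "t = (\<lambda>i. shift s i - shift s' i)"
  have \<delta>: "\<delta> b \<in> fil k" if "b < d" for b using s(4)[OF that] by (simp add: \<delta>_def)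
  have t: "t i \<in> fil k" if "i < n" for i
    unfolding t_def using that by (intro shift_cong s(4))
  have t_eq: "t i = (\<Sum>b<d. \<psi> (P $$ (i, b)) * \<delta> b)" for i
    by (simp add: t_def shift_def \<delta>_def right_diff_distrib sum_subtractf)
  have sh: "shift s' i \<in> fil 0" if "i < n" for i
    using tate_in_fil[OF shift_tate[of s' i]] s(2) that by blast
  have "?E (\<lambda>i. shift s' i + t i) (f $ a) - ?E (shift s') (f $ a)
      - (\<Sum>i<n. ?E (shift s') (mderiv i (f $ a)) * t i) \<in> fil (2 * k)"
    by (intro taylor[OF f_mem[OF a]] sh t)
  moreover have "(\<lambda>i. shift s' i + t i) = shift s" by (simp add: t_def)
  \<comment> \<open>The Taylor remainder has level 2k, which is at least k + 1 because k is at least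
    1.\<close>
  ultimately have 1: "?E (shift s) (f $ a) - ?E (shift s') (f $ a)
      - (\<Sum>i<n. ?E (shift s') (mderiv i (f $ a)) * t i) \<in> fil (Suc k)"
    using k by (auto elim: fil_mono)
  \<comment> \<open>Moving the base point of the derivatives from \<open>shift s'\<close> to x^p'
    changes them by \<open>fil 1\<close>, as s' is divisible by \<pi>; the factor \<open>t i\<close>
    supplies the other k levels.\<close>
  have 2: "(\<Sum>i<n. ?E (shift s') (mderiv i (f $ a)) * t i) - (\<Sum>i<n. \<psi> (mderiv i (f $ a)) * t i) \<in> fil (Suc k)"
    unfolding sum_subtractf[symmetric] left_diff_distrib[symmetric]
  proof (rule fil_sum)
    fix i assume i: "i \<in> {..<n}"
    have "?E (shift s') (mderiv i (f $ a)) - \<psi> (mderiv i (f $ a)) \<in> fil 1"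
      unfolding psi_polys[OF deriv_polys[OF f_mem[OF a]]]
      by (intro eval_cong[OF deriv_polys[OF f_mem[OF a]]] shift_frobenius s(3) sh
        tate_in_fil[OF var_power_tate])
    thus "(?E (shift s') (mderiv i (f $ a)) - \<psi> (mderiv i (f $ a))) * t i \<in> fil (Suc k)"
      using fil_mult_add[of _ 1 "t i" k] t i by simp
  qed
  let ?J = "\<lambda>b. \<Sum>i<n. \<psi> (mderiv i (f $ a)) * \<psi> (P $$ (i, b))"
  let ?I = "\<lambda>b. (if a = b then 1 else 0) + (\<Sum>j<d. (f $ j) ^ p' * \<psi> (\<Delta> j $$ (a, b)))"
  have "(\<Sum>i<n. \<psi> (mderiv i (f $ a)) * t i) = (\<Sum>i<n. \<Sum>b<d. \<psi> (mderiv i (f $ a)) * \<psi> (P $$ (i, b)) * \<delta> b)"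
    by (simp add: t_eq sum_distrib_left mult.assoc)
  also have "\<dots> = (\<Sum>b<d. ?J b * \<delta> b)"
    by (subst sum.swap) (simp add: sum_distrib_right)
  finally have J: "(\<Sum>i<n. \<psi> (mderiv i (f $ a)) * t i) = (\<Sum>b<d. ?J b * \<delta> b)" .
  \<comment> \<open>Modulo \<pi> the matrix \<psi>(Jac) \<psi>(P) is the identity plus the
    coefficients of the correction term.\<close>
  have 3: "(\<Sum>b<d. ?J b * \<delta> b) - (\<Sum>b<d. ?I b * \<delta> b) \<in> fil (Suc k)"
    unfolding sum_subtractf[symmetric] left_diff_distrib[symmetric]
  proof (rule fil_sum)
    fix b assume "b \<in> {..<d}"
    thus "(?J b - ?I b) * \<delta> b \<in> fil (Suc k)"
      using fil_mult_add[OF psi_jacobian_P[OF a, of b] \<delta>] by simp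
  qed
  \<comment> \<open>The identity contributes the difference s - s' itself, and the remaining sum
    cancels the change of the correction term in \<open>G\<close>.\<close>
  have "(\<Sum>b<d. ?I b * \<delta> b) = (\<Sum>b<d. if a = b then \<delta> b else 0)
      + (\<Sum>b<d. \<Sum>j<d. (f $ j) ^ p' * (\<psi> (\<Delta> j $$ (a, b)) * \<delta> b))"
    unfolding sum.distrib[symmetric]
    by (intro sum.cong) (auto simp: distrib_right sum_distrib_right mult.assoc)
  also have "\<dots> = \<delta> a + (\<Sum>j<d. (f $ j) ^ p' * (\<Sum>b<d. \<psi> (\<Delta> j $$ (a, b)) * \<delta> b))"
    using a by (subst sum.swap) (simp add: sum_distrib_left)
  finally have "(\<Sum>b<d. ?I b * \<delta> b) = \<delta> a + (\<Sum>j<d. (f $ j) ^ p' * (\<Sum>b<d. \<psi> (\<Delta> j $$ (a, b)) * \<delta> b))" .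
  moreover have "G s a - G s' a = ?E (shift s) (f $ a) - ?E (shift s') (f $ a)
      - (\<Sum>j<d. (f $ j) ^ p' * (\<Sum>b<d. \<psi> (\<Delta> j $$ (a, b)) * \<delta> b))"
    by (simp add: G_def \<delta>_def right_diff_distrib sum_subtractf)
  ultimately have "G s a - G s' a - (s a - s' a)
      = ?E (shift s) (f $ a) - ?E (shift s') (f $ a) - (\<Sum>b<d. ?I b * \<delta> b)"
    by (simp add: \<delta>_def)
  thus ?thesis using fil_trans[OF fil_trans[OF 1 2[unfolded J]] 3] by simp
qed

text \<open>For two roots \<open>G_diff\<close> says that a difference of level k has level k + 1.
  The induction starts at level 1, where both roots lie, and the filtration is separated.\<close>

lemma G_root_unique:
  assumes s: "\<And>b. b < d \<Longrightarrow> s b \<in> tate n v \<inter> fil 1" "\<And>b. b < d \<Longrightarrow> G s b = 0"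
    and s': "\<And>b. b < d \<Longrightarrow> s' b \<in> tate n v \<inter> fil 1" "\<And>b. b < d \<Longrightarrow> G s' b = 0"
    and "a < d"
  shows "s a = s' a"
proof -
  have *: "\<forall>b<d. s b - s' b \<in> fil (Suc k)" for k
  proof (induction k)
    case 0
    show ?case using s(1) s'(1) by (auto intro: fil_diff)
  next
    case (Suc k)
    show ?case
    proof (intro allI impI)
      fix b assume b: "b < d"
      have "G s b - G s' b - (s b - s' b) \<in> fil (Suc (Suc k))"
        using s(1) s'(1) Suc b by (intro G_diff) auto
      thus "s b - s' b \<in> fil (Suc (Suc k))"
        using fil_uminus s(2)[OF b] s'(2)[OF b] by fastforce
    qed
  qed
  show ?thesis
  proof (rule fil_separated_diff)
    show "s a - s' a \<in> fil k" for k using *[of k] \<open>a < d\<close> fil_mono[of "s a - s' a" "Suc k" k] by simp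
  qed
qed

text \<open>Newton iteration from 0 with the derivative replaced by the identity, to which it is
  congruent modulo \<pi>; each step gains one level.\<close>

lemma G_root_exists: "\<exists>s. \<forall>b<d. s b \<in> tate n v \<inter> fil 1 \<and> G s b = 0"
proof -
  define T where "T = (\<lambda>s b. s b - G s b)"
  define u where "u = (\<lambda>k. (T ^^ k) (\<lambda>_. 0))"
  have u_Suc: "u (Suc k) b = u k b - G (u k) b" for k b by (simp add: u_def T_def)
  have T_diff: "T s b - T s' b \<in> fil (Suc k)"
    if "k \<ge> 1" "\<And>b. b < d \<Longrightarrow> s b \<in> tate n v" "\<And>b. b < d \<Longrightarrow> s' b \<in> tate n v"
      "\<And>b. b < d \<Longrightarrow> s' b \<in> fil 1" "\<And>b. b < d \<Longrightarrow> s b - s' b \<in> fil k" "b < d" for s s' k b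
  proof -
    have "- (G s b - G s' b - (s b - s' b)) \<in> fil (Suc k)"
      using that by (intro fil_uminus G_diff)
    thus ?thesis by (simp add: T_def algebra_simps)
  qed
  have u: "\<forall>b<d. u k b \<in> tate n v \<and> u k b \<in> fil 1 \<and> u (Suc k) b - u k b \<in> fil (Suc k)" for k
  proof (induction k)
    case 0
    \<comment> \<open>The first step is -G(0), of level 1; hence the k-th step has level k +
      1.\<close>
    show ?case using G_zero fil_uminus by (auto simp: u_def T_def tate.zero_mem)
  next
    case (Suc k)
    have t: "u (Suc k) b \<in> tate n v" if "b < d" for b
      unfolding u_Suc using Suc that by (intro tate.diff_mem G_tate) auto
    have f1: "u (Suc k) b \<in> fil 1" if "b < d" for b
    proof -
      have "u (Suc k) b - u k b \<in> fil 1" "u k b \<in> fil 1" using Suc that by (auto elim: fil_mono)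
      from fil_add[OF this] show ?thesis by simp
    qed
    have "T (u (Suc k)) b - T (u k) b \<in> fil (Suc (Suc k))" if "b < d" for b
      using Suc that t by (intro T_diff) auto
    thus ?case using t f1 by (simp add: u_def)
  qed
  have "\<forall>b. \<exists>h. b < d \<longrightarrow> h \<in> tate n v \<and> (\<forall>k. h - u k b \<in> fil k)"
  proof
    fix b
    have "\<exists>h\<in>tate n v. \<forall>k. h - u k b \<in> fil k" if "b < d"
    proof (rule tate_limit)
      show "u k b \<in> tate n v" "u (Suc k) b - u k b \<in> fil k" for k
        using u[of k] that fil_mono[of "u (Suc k) b - u k b" "Suc k" k] by auto
    qed
    thus "\<exists>h. b < d \<longrightarrow> h \<in> tate n v \<and> (\<forall>k. h - u k b \<in> fil k)" by blast
  qed
  then obtain s where s: "\<And>b. b < d \<Longrightarrow> s b \<in> tate n v" "\<And>b k. b < d \<Longrightarrow> s b - u k b \<in> fil k"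
    by metis
  have s1: "s b \<in> fil 1" if "b < d" for b
    using fil_add[OF s(2)[OF that, of 1], of "u 1 b"] u that by auto
  have "G s b = 0" if b: "b < d" for b
  proof (rule fil_separated)
    fix k
    \<comment> \<open>The limit is compared with the iterate of index k + 1 rather than k, so that
      the level of their difference is at least 1, as \<open>T_diff\<close> demands. Applying
      \<open>T\<close> to that iterate yields the next one, which is again close to s.\<close>
    have "T s b - T (u (Suc k)) b \<in> fil (Suc (Suc k))"
      using u s b by (intro T_diff) auto
    moreover have "s b - T (u (Suc k)) b \<in> fil (Suc (Suc k))"
      using s(2)[OF b, of "Suc (Suc k)"] by (simp add: u_def)
    ultimately have "s b - T s b \<in> fil (Suc (Suc k))" using fil_diff by fastforce
    thus "G s b \<in> fil k" by (auto simp: T_def elim: fil_mono)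
  qed
  thus ?thesis using s(1) s1 by blast
qed

end

section \<open>Reductions and the lift of Frobenius\<close>

context lift_data begin

section \<open>Ideals generated by f and classes in R<x>/(f)\<close>

lemma f_set: "set\<^sub>v f \<subseteq> tate n v"
  using f_polys polys_tate by blast

lemma f_in_set: "a < d \<Longrightarrow> f $ a \<in> set\<^sub>v f"
  using f_carrier by (auto intro: vec_setI)

lemma in_f_set: "g \<in> set\<^sub>v f \<Longrightarrow> \<exists>a<d. g = f $ a"
  using f_carrier by (auto simp: vec_set_def)

lemma ideal_tate_ideal: "ideal (tate_ideal n v f) (ring_on (tate n v))"
  unfolding tate_ideal_def using f_set by (intro tate.on.genideal_ideal) simp

lemma ideal_poly_ideal: "ideal (poly_ideal n v f) (ring_on (polys n v))"
  unfolding poly_ideal_def using f_polys by (intro polys.on.genideal_ideal) simp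

lemmas tate_ideal_memD = tate.ideal_memD[OF ideal_tate_ideal]
lemmas poly_ideal_memD = polys.ideal_memD[OF ideal_poly_ideal]

lemma f_tate_ideal: "a < d \<Longrightarrow> f $ a \<in> tate_ideal n v f"
  unfolding tate_ideal_def using tate.on.genideal_self[of "set\<^sub>v f"] f_set f_in_set by auto

lemma f_poly_ideal: "a < d \<Longrightarrow> f $ a \<in> poly_ideal n v f"
  unfolding poly_ideal_def using polys.on.genideal_self[of "set\<^sub>v f"] f_polys f_in_set by auto

lemma tate_ideal_minimal:
  assumes "ideal I (ring_on (tate n v))" "\<And>a. a < d \<Longrightarrow> f $ a \<in> I"
  shows "tate_ideal n v f \<subseteq> I"
  unfolding tate_ideal_def
  using assms(2) in_f_set by (intro tate.genideal_ring_on_minimal[OF assms(1)]) blast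

lemma tate_class_eq_iff:
  "g \<in> tate n v \<Longrightarrow> h \<in> tate n v \<Longrightarrow>
    tate_class n v f g = tate_class n v f h \<longleftrightarrow> g - h \<in> tate_ideal n v f"
  unfolding tate_class_def by (rule tate.rcos_eq_iff[OF ideal_tate_ideal])

lemma carrier_tate_quot: "carrier (tate_quot n v f) = tate_class n v f ` tate n v"
  unfolding tate_quot_def tate_class_def by (rule tate.carrier_Quot_ring_on)

lemma tate_class_hom: "tate_class n v f \<in> Ring.ring_hom (ring_on (tate n v)) (tate_quot n v f)"
  unfolding tate_quot_def tate_class_def[abs_def] by (rule tate.rcos_hom[OF ideal_tate_ideal])

lemma tate_class_mult:
  "g \<in> tate n v \<Longrightarrow> h \<in> tate n v \<Longrightarrow>
    tate_class n v f g \<otimes>\<^bsub>tate_quot n v f\<^esub> tate_class n v f h = tate_class n v f (g * h)"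
  using ring_hom_mult[OF tate_class_hom, of g h] by simp

lemma tate_class_add:
  "g \<in> tate n v \<Longrightarrow> h \<in> tate n v \<Longrightarrow>
    tate_class n v f g \<oplus>\<^bsub>tate_quot n v f\<^esub> tate_class n v f h = tate_class n v f (g + h)"
  using ring_hom_add[OF tate_class_hom, of g h] by simp

lemma tate_class_one: "\<one>\<^bsub>tate_quot n v f\<^esub> = tate_class n v f 1"
  using ring_hom_one[OF tate_class_hom] by simp

text \<open>The series with such an approximation form an ideal of R<x> that contains f: a
  multiplier from R<x> may itself be replaced by a polynomial modulo \<pi>. This makes the reduction
  of a class independent of its representative.\<close>

lemma tate_ideal_mod_pi:
  assumes "i \<in> tate_ideal n v f"
  shows "\<exists>q\<in>poly_ideal n v f. i - q \<in> fil 1"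
proof -
  define J where "J = {g \<in> tate n v. \<exists>q\<in>poly_ideal n v f. g - q \<in> fil 1}"
  have "ideal J (ring_on (tate n v))"
  proof (rule tate.ideal_ring_onI)
    show "0 \<in> J" unfolding J_def using poly_ideal_memD(2) tate.zero_mem
      by (auto intro!: bexI[of _ 0])
    fix a assume a: "a \<in> J"
    then obtain q where q: "q \<in> poly_ideal n v f" "a - q \<in> fil 1" by (auto simp: J_def)
    {
      fix b assume b: "b \<in> J"
      then obtain q' where q': "q' \<in> poly_ideal n v f" "b - q' \<in> fil 1" by (auto simp: J_def)
      have "(a + b) - (q + q') \<in> fil 1" using fil_add[OF q(2) q'(2)] by (simp add: algebra_simps)
      thus "a + b \<in> J" unfolding J_def
        using a b poly_ideal_memD(3)[OF q(1) q'(1)] by (auto simp: J_def intro: tate.add_mem)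
    next
      fix x assume x: "x \<in> tate n v"
      then obtain x' where x': "x' \<in> polys n v" "x - x' \<in> fil 1" using tate_approx by blast
      have "q \<in> fil 0" using q poly_ideal_memD(1) by (blast intro: tate_in_fil polys_tate)
      hence "x * a - x' * q \<in> fil 1"
        using x x' q by (intro fil_cong_mult) (auto intro: tate_in_fil)
      thus "x * a \<in> J" unfolding J_def
        using a x poly_ideal_memD(5)[OF q(1) x'(1)] by (auto simp: J_def intro: tate.mult_mem)
    }
  qed (auto simp: J_def)
  moreover have "f $ a \<in> J" if "a < d" for a
    using that f_poly_ideal polys_tate[OF f_mem] by (auto simp: J_def intro!: bexI[of _ "f $ a"])
  ultimately show ?thesis using tate_ideal_minimal assms unfolding J_def by blast
qed

section \<open>The special fibre and the reduction map\<close>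

lemma cring_poly_quot: "cring (poly_quot n v f)"
  unfolding poly_quot_def by (rule ideal.quotient_is_cring[OF ideal_poly_ideal polys.cring_ring_on])

lemma poly_class_hom: "poly_class n v f \<in> Ring.ring_hom (ring_on (polys n v)) (poly_quot n v f)"
  unfolding poly_quot_def poly_class_def[abs_def] by (rule polys.rcos_hom[OF ideal_poly_ideal])

lemma poly_class_carrier: "g \<in> polys n v \<Longrightarrow> poly_class n v f g \<in> carrier (poly_quot n v f)"
  using ring_hom_closed[OF poly_class_hom, of g] by simp

lemma pi_polys: "mconst \<pi> \<in> polys n v"
  using v_pi_less_1 by (simp add: const_polys)

lemma ideal_special_ideal: "ideal (special_ideal n v \<pi> f) (poly_quot n v f)"
  unfolding special_ideal_def
  by (rule cring.cgenideal_ideal[OF cring_poly_quot poly_class_carrier[OF pi_polys]])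

lemma ring_special_fibre: "Ring.ring (special_fibre n v \<pi> f)"
  unfolding special_fibre_def by (rule ideal.quotient_is_ring[OF ideal_special_ideal])

lemma special_class_hom:
  "special_class n v \<pi> f \<in> Ring.ring_hom (ring_on (polys n v)) (special_fibre n v \<pi> f)"
proof -
  have "(+>\<^bsub>poly_quot n v f\<^esub>) (special_ideal n v \<pi> f) \<circ> poly_class n v f
      \<in> Ring.ring_hom (ring_on (polys n v)) (special_fibre n v \<pi> f)"
    unfolding special_fibre_def
    by (rule ring_hom_trans[OF poly_class_hom ideal.rcos_ring_hom[OF ideal_special_ideal]])
  thus ?thesis by (simp add: special_class_def[abs_def] comp_def)
qed

lemma special_class_poly_ideal:
  assumes "q \<in> poly_ideal n v f"
  shows "special_class n v \<pi> f q = \<zero>\<^bsub>special_fibre n v \<pi> f\<^esub>"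
proof -
  have "q \<in> polys n v" using assms poly_ideal_memD(1) by blast
  hence "poly_class n v f q = poly_class n v f 0"
    unfolding poly_class_def polys.rcos_eq_iff[OF ideal_poly_ideal \<open>q \<in> polys n v\<close> polys.zero_mem]
    using assms by simp
  hence "special_class n v \<pi> f q = special_class n v \<pi> f 0" by (simp add: special_class_def)
  also have "\<dots> = \<zero>\<^bsub>special_fibre n v \<pi> f\<^esub>"
    using ring_hom_zero[OF special_class_hom polys.on.ring_axioms ring_special_fibre] by simp
  finally show ?thesis .
qed

lemma special_class_pi: "special_class n v \<pi> f (mconst \<pi>) = \<zero>\<^bsub>special_fibre n v \<pi> f\<^esub>"
proof -
  interpret Q: cring "poly_quot n v f" by (rule cring_poly_quot)
  have "poly_class n v f (mconst \<pi>) \<in> special_ideal n v \<pi> f"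
    unfolding special_ideal_def by (rule Q.cgenideal_self[OF poly_class_carrier[OF pi_polys]])
  hence "special_class n v \<pi> f (mconst \<pi>) = special_ideal n v \<pi> f"
    unfolding special_class_def by (rule Q.a_rcos_zero[OF ideal_special_ideal])
  thus ?thesis by (simp add: special_fibre_def FactRing_def)
qed

text \<open>The reduction map kills the ideal (f) of R[x] and all multiples of \<pi>; h' differs
  from h by one element of each kind.\<close>

lemma special_class_cong:
  assumes "h \<in> polys n v" "h' \<in> polys n v" "q \<in> poly_ideal n v f" "h' - h - q \<in> fil 1"
  shows "special_class n v \<pi> f h' = special_class n v \<pi> f h"
proof -
  interpret S: Ring.ring "special_fibre n v \<pi> f" by (rule ring_special_fibre)
  note hom = special_class_hom
  have q: "q \<in> polys n v" using assms(3) poly_ideal_memD(1) by blast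
  hence "h' - h - q \<in> pi_multiples \<pi> (polys n v)"
    using assms by (simp add: pi_multiples_polys polys.diff_mem)
  then obtain g where g: "g \<in> polys n v" "h' - h - q = mconst \<pi> * g"
    by (auto simp: pi_multiples_def)
  hence h': "h' = h + (q + mconst \<pi> * g)" by (simp add: algebra_simps)
  have "special_class n v \<pi> f (mconst \<pi> * g) = \<zero>\<^bsub>special_fibre n v \<pi> f\<^esub>"
    using ring_hom_mult[OF hom, of "mconst \<pi>" g] ring_hom_closed[OF hom, of g] g(1) pi_polys
    by (simp add: special_class_pi)
  hence "special_class n v \<pi> f (q + mconst \<pi> * g) = \<zero>\<^bsub>special_fibre n v \<pi> f\<^esub>"
    using ring_hom_add[OF hom, of q "mconst \<pi> * g"] q g(1) pi_polys special_class_poly_ideal[OF assms(3)]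
    by (simp add: polys.mult_mem)
  thus ?thesis unfolding h'
    using ring_hom_add[OF hom, of h "q + mconst \<pi> * g"] ring_hom_closed[OF hom, of h] q g(1) pi_polys assms(1)
    by (simp add: polys.add_mem polys.mult_mem)
qed

text \<open>The set under \<open>the_elem\<close> is a singleton: changing the representative adds
  an element of (f), which modulo \<pi> comes from (f) in R[x], and changing the polynomial adds a
  multiple of \<pi>.\<close>

lemma tate_reduction_class:
  assumes g: "g \<in> tate n v" and h: "h \<in> polys n v" "g - h \<in> fil 1"
  shows "tate_reduction n v \<pi> f (tate_class n v f g) = special_class n v \<pi> f h"
proof -
  have "{special_class n v \<pi> f h' | g' h'. g' \<in> tate_class n v f g \<and> h' \<in> polys n v
      \<and> g' - h' \<in> pi_multiples \<pi> (tate n v)} = {special_class n v \<pi> f h}" (is "?S = _")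
  proof (rule equalityI; rule subsetI)
    fix x assume "x \<in> {special_class n v \<pi> f h}"
    moreover have "g \<in> tate_class n v f g"
      unfolding tate_class_def tate.rcos_ring_on using tate_ideal_memD(2) by force
    moreover have "g - h \<in> pi_multiples \<pi> (tate n v)"
      using assms by (simp add: pi_multiples_tate tate.diff_mem polys_tate)
    ultimately show "x \<in> ?S" using h(1) by blast
  next
    fix x assume "x \<in> ?S"
    then obtain g' h' where x: "x = special_class n v \<pi> f h'" "g' \<in> tate_class n v f g"
      "h' \<in> polys n v" "g' - h' \<in> pi_multiples \<pi> (tate n v)" by blast
    then obtain i where i: "i \<in> tate_ideal n v f" "g' = i + g"
      unfolding tate_class_def tate.rcos_ring_on by blast
    obtain q where q: "q \<in> poly_ideal n v f" "i - q \<in> fil 1" using tate_ideal_mod_pi[OF i(1)] by blast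
    have "g' - h' \<in> fil 1" using x(4) by (simp add: pi_multiples_tate)
    hence "(i - q) + (g - h) - (g' - h') \<in> fil 1" using fil_diff[OF fil_add[OF q(2) h(2)]] by blast
    also have "(i - q) + (g - h) - (g' - h') = h' - h - q" by (simp add: i(2))
    finally show "x \<in> {special_class n v \<pi> f h}"
      using special_class_cong[OF h(1) x(3) q(1)] x(1) by simp
  qed
  thus ?thesis by (simp add: tate_reduction_def)
qed

text \<open>Since \<open>G s = 0\<close>, substituting \<open>shift s\<close> maps each \<open>f $ a\<close> into the ideal generated by \<open>f\<close>.\<close>

lemma tate_subst_ideal:
  assumes s: "\<And>b. b < d \<Longrightarrow> s b \<in> tate n v" "\<And>b. b < d \<Longrightarrow> G s b = 0"
    and g: "g \<in> tate_ideal n v f"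
  shows "tate_subst n v \<sigma> (shift s) g \<in> tate_ideal n v f"
proof -
  let ?E = "tate_subst n v \<sigma> (shift s)"
  note y = shift_tate[of s, OF s(1)]
  \<comment> \<open>The preimage of the ideal under the substitution is an ideal, since the
    substitution is additive and multiplicative; so only the generators remain to be
    checked.\<close>
  define J where "J = {g \<in> tate n v. ?E g \<in> tate_ideal n v f}"
  have pow: "f $ a ^ p' * h \<in> tate_ideal n v f" if "a < d" "h \<in> tate n v" for a h
  proof -
    \<comment> \<open>One factor f_a can be split off because p' is positive.\<close>
    have "f $ a ^ p' * h = (h * f $ a ^ (p' - 1)) * f $ a"
      using p'_pos by (cases p') (auto simp: mult_ac)
    thus ?thesis using that
      by (auto intro!: tate_ideal_memD(5) f_tate_ideal tate.mult_mem tate.power_mem polys_tate[OF f_mem])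
  qed
  have sum: "(\<Sum>j\<in>A. F j) \<in> tate_ideal n v f" if "\<And>j. j \<in> A \<Longrightarrow> F j \<in> tate_ideal n v f"
    for A and F :: "nat \<Rightarrow> 'k mps"
    using that by (induction A rule: infinite_finite_induct) (auto intro: tate_ideal_memD)
  have "ideal J (ring_on (tate n v))"
  proof (rule tate.ideal_ring_onI)
    have "?E 0 = 0" using tate_subst_const[of 0 n "shift s"] y by simp
    thus "0 \<in> J" by (simp add: J_def tate.zero_mem tate_ideal_memD(2))
    fix a assume a: "a \<in> J"
    show "a + b \<in> J" if "b \<in> J" for b
      using a that y by (auto simp: J_def tate_subst_add intro: tate.add_mem tate_ideal_memD(3))
    show "x * a \<in> J" if "x \<in> tate n v" for x
      using a that y
      by (auto simp: J_def tate_subst_mult intro: tate.mult_mem tate_ideal_memD(5) tate_subst_mem)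
  qed (auto simp: J_def)
  moreover have "f $ a \<in> J" if a: "a < d" for a
  proof -
    have "?E (f $ a) = mpoly_eval cst (shift s) (f $ a)"
      using y by (intro tate_subst_polys f_mem a)
    \<comment> \<open>This is G(s) = 0 solved for the value of f; the factor 1 brings the first
      summand into the form of \<open>pow\<close>.\<close>
    also have "\<dots> = f $ a ^ p' * 1 + (\<Sum>j<d. f $ j ^ p' * (\<Sum>b<d. \<psi> (\<Delta> j $$ (a, b)) * s b))"
      using s(2)[OF a] by (simp add: G_def algebra_simps)
    also have "\<dots> \<in> tate_ideal n v f"
      using a s(1) by (intro tate_ideal_memD(3) sum pow tate.one_mem tate.sum_mem tate.mult_mem psi_mem \<Delta>_mem) auto
    finally show ?thesis using a by (simp add: J_def polys_tate f_mem)
  qed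
  ultimately have "tate_ideal n v f \<subseteq> J" by (rule tate_ideal_minimal)
  thus ?thesis using g by (auto simp: J_def)
qed

text \<open>The substitution descends to the quotient because it preserves (f). It is semi-linear
  since constants go to their images under \<sigma>, and it lifts the p'-power map since the shift
  is congruent to x^p' modulo \<pi>.\<close>

lemma lift_exists:
  assumes s: "\<And>b. b < d \<Longrightarrow> s b \<in> tate n v" "\<And>b. b < d \<Longrightarrow> s b \<in> fil 1" "\<And>b. b < d \<Longrightarrow> G s b = 0"
  shows "\<exists>\<phi>. semilinear_endo n v \<sigma> f \<phi> \<and> lifts_power_map n v \<pi> p' f \<phi> \<and>
    (\<forall>g\<in>tate n v. \<phi> (tate_class n v f g) = tate_class n v f (tate_subst n v \<sigma> (shift s) g))"
proof -
  let ?E = "tate_subst n v \<sigma> (shift s)" and ?c = "tate_class n v f"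
  let ?C = "carrier (tate_quot n v f)"
  note y = shift_tate[of s, OF s(1)]
  have E: "?E g \<in> tate n v" if "g \<in> tate n v" for g using that y by (rule tate_subst_mem)
  \<comment> \<open>A representative is chosen for each class; the restriction to the carrier
    provides the extensionality demanded of \<phi>.\<close>
  define \<phi> where "\<phi> = restrict (\<lambda>b. ?c (?E (SOME g. g \<in> tate n v \<and> ?c g = b))) ?C"
  have \<phi>: "\<phi> (?c g) = ?c (?E g)" if g: "g \<in> tate n v" for g
  proof -
    let ?g = "SOME g'. g' \<in> tate n v \<and> ?c g' = ?c g"
    have g': "?g \<in> tate n v \<and> ?c ?g = ?c g" by (rule someI[of _ g]) (simp add: g)
    \<comment> \<open>Independence of the choice: two representatives differ by an element of (f),
      whose image again lies in (f).\<close>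
    hence "?g - g \<in> tate_ideal n v f" using tate_class_eq_iff[of ?g g] g by simp
    hence "?E (?g - g) \<in> tate_ideal n v f" using s by (intro tate_subst_ideal)
    moreover have "?E ?g = ?E g + ?E (?g - g)"
      using tate_subst_add[of g n "?g - g" "shift s"] g g' y by (simp add: tate.diff_mem)
    ultimately have "?c (?E ?g) = ?c (?E g)"
      using tate_class_eq_iff[OF E E, of ?g g] g g' by simp
    thus ?thesis using g by (simp add: \<phi>_def carrier_tate_quot)
  qed
  have "\<phi> \<in> Ring.ring_hom (tate_quot n v f) (tate_quot n v f)"
  proof (rule ring_hom_memI)
    fix a b assume "a \<in> ?C" "b \<in> ?C"
    then obtain g h where gh: "a = ?c g" "b = ?c h" "g \<in> tate n v" "h \<in> tate n v"
      by (auto simp: carrier_tate_quot)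
    show "\<phi> a \<in> ?C" using gh E by (simp add: \<phi> carrier_tate_quot)
    show "\<phi> (a \<otimes>\<^bsub>tate_quot n v f\<^esub> b) = \<phi> a \<otimes>\<^bsub>tate_quot n v f\<^esub> \<phi> b"
      using gh E y by (simp add: \<phi> tate_class_mult tate.mult_mem tate_subst_mult)
    show "\<phi> (a \<oplus>\<^bsub>tate_quot n v f\<^esub> b) = \<phi> a \<oplus>\<^bsub>tate_quot n v f\<^esub> \<phi> b"
      using gh E y by (simp add: \<phi> tate_class_add tate.add_mem tate_subst_add)
  next
    have "?E 1 = 1" using tate_subst_const[of 1 n "shift s"] y by simp
    thus "\<phi> \<one>\<^bsub>tate_quot n v f\<^esub> = \<one>\<^bsub>tate_quot n v f\<^esub>"
      by (simp add: tate_class_one \<phi> tate.one_mem)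
  qed
  moreover have "\<phi> (?c (mconst a) \<otimes>\<^bsub>tate_quot n v f\<^esub> b) = ?c (mconst (\<sigma> a)) \<otimes>\<^bsub>tate_quot n v f\<^esub> \<phi> b"
    if ab: "a \<in> valuation_ring v" "b \<in> ?C" for a b
  proof -
    obtain g where g: "b = ?c g" "g \<in> tate n v" using ab(2) by (auto simp: carrier_tate_quot)
    have a: "v a \<le> 1" "mconst a \<in> tate n v" "mconst (\<sigma> a) \<in> tate n v"
      using ab(1) by (auto simp: valuation_ring_def intro!: polys_tate const_polys sigma_integral)
    thus ?thesis using g E y
      by (simp add: \<phi> tate_class_mult tate.mult_mem tate_subst_mult tate_subst_const)
  qed
  ultimately have "semilinear_endo n v \<sigma> f \<phi>"
    by (simp add: semilinear_endo_def \<phi>_def)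
  moreover have "lifts_power_map n v \<pi> p' f \<phi>" unfolding lifts_power_map_def
  proof
    fix b assume "b \<in> ?C"
    then obtain g where g: "b = ?c g" "g \<in> tate n v" by (auto simp: carrier_tate_quot)
    obtain h where h: "h \<in> polys n v" "g - h \<in> fil 1" using tate_approx[OF g(2)] by blast
    \<comment> \<open>Thus h^p' is a polynomial representing the reduction of the image, while h
      represents that of the argument.\<close>
    have "?E g - h ^ p' \<in> fil 1"
      using g h y s(2) by (intro tate_subst_frobenius shift_frobenius)
    hence "tate_reduction n v \<pi> f (\<phi> b) = special_class n v \<pi> f (h ^ p')"
      using g h E by (simp add: \<phi> tate_reduction_class polys.power_mem)
    also have "\<dots> = special_class n v \<pi> f h [^]\<^bsub>special_fibre n v \<pi> f\<^esub> p'"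
      using ring_hom_nat_pow[OF special_class_hom polys.on.ring_axioms ring_special_fibre, of h p'] h(1)
      unfolding polys.nat_pow_ring_on by simp
    also have "special_class n v \<pi> f h = tate_reduction n v \<pi> f b"
      using g h by (simp add: tate_reduction_class)
    finally show "tate_reduction n v \<pi> f (\<phi> b) = tate_reduction n v \<pi> f b [^]\<^bsub>special_fibre n v \<pi> f\<^esub> p'" .
  qed
  ultimately show ?thesis using \<phi> by blast
qed

text \<open>The two points agree on indices below n only; exponents containing other variables have
  coefficient 0 in g, so all terms agree.\<close>

lemma tate_subst_psi_shift:
  assumes "s \<in> carrier_vec d" "\<And>b. b < d \<Longrightarrow> s $ b \<in> tate n v" "g \<in> tate n v"
  shows "tate_subst n v \<sigma> (\<lambda>i. psi_shift n v \<sigma> p' P s $ i) g = tate_subst n v \<sigma> (shift (($) s)) g"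
proof (rule tate_subst_eq)
  show "tate_subst n v \<sigma> (shift (($) s)) g \<in> tate n v"
    using assms shift_tate by (intro tate_subst_mem) auto
  have "has_subst (shift (($) s)) g (tate_subst n v \<sigma> (shift (($) s)) g)"
    using assms shift_tate by (intro has_subst_tate_subst) auto
  moreover have "subst_term (\<lambda>i. psi_shift n v \<sigma> p' P s $ i) g m = subst_term (shift (($) s)) g m" for m
  proof (cases "mcoeff g m = 0")
    case False
    hence "image_mset (\<lambda>i. psi_shift n v \<sigma> p' P s $ i) m = image_mset (shift (($) s)) m"
      using tate_vars[OF assms(3)] psi_shift_index[OF assms(1)] by (intro image_mset_cong) auto
    thus ?thesis by (simp add: subst_term_def)
  qed (simp add: subst_term_def)
  ultimately show "has_subst (\<lambda>i. psi_shift n v \<sigma> p' P s $ i) g (tate_subst n v \<sigma> (shift (($) s)) g)"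
    by (simp add: has_subst_def)
qed

text \<open>A map of the required form is determined on every class by its s, and s has to be the
  unique root of G. Off the carrier two such maps agree by extensionality.\<close>

lemma unique_lift:
  "\<exists>!\<phi>. semilinear_endo n v \<sigma> f \<phi> \<and> lifts_power_map n v \<pi> p' f \<phi> \<and>
    (\<exists>s\<in>carrier_vec d. set\<^sub>v s \<subseteq> pi_multiples \<pi> (tate n v) \<and>
       lift_equation_at (lift_equation n v \<sigma> p' f P \<Delta>) s = 0\<^sub>v d \<and>
       (\<forall>g\<in>tate n v. \<phi> (tate_class n v f g)
          = tate_class n v f (tate_subst n v \<sigma> (\<lambda>i. psi_shift n v \<sigma> p' P s $ i) g)))"
  (is "\<exists>!\<phi>. _ \<and> _ \<and> ?sol \<phi>")
proof -
  let ?c = "tate_class n v f"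
  obtain s where s: "\<And>b. b < d \<Longrightarrow> s b \<in> tate n v" "\<And>b. b < d \<Longrightarrow> s b \<in> fil 1" "\<And>b. b < d \<Longrightarrow> G s b = 0"
    using G_root_exists by auto
  obtain \<phi> where \<phi>: "semilinear_endo n v \<sigma> f \<phi>" "lifts_power_map n v \<pi> p' f \<phi>"
      "\<And>g. g \<in> tate n v \<Longrightarrow> \<phi> (?c g) = ?c (tate_subst n v \<sigma> (shift s) g)"
    using lift_exists[OF s] by auto
  have shift_eq: "shift s' = shift s" if "\<And>b. b < d \<Longrightarrow> s' b = s b" for s'
    using that by (simp add: shift_def fun_eq_iff)
  have dim: "dim_vec (lift_equation_at (lift_equation n v \<sigma> p' f P \<Delta>) s') = d" for s'
    using f_carrier by (simp add: lift_equation_at_def lift_equation_def Let_def)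
  show ?thesis
  proof (rule ex1I[of _ \<phi>])
    \<comment> \<open>The root was found as a function; the vector with its entries below d gives
      the same shift, because only those entries are read.\<close>
    define s' where "s' = Matrix.vec d s"
    have s': "s' \<in> carrier_vec d" "\<And>b. b < d \<Longrightarrow> s' $ b = s b" by (auto simp: s'_def)
    have shift: "shift (($) s') = shift s" using s'(2) by (rule shift_eq)
    hence "G (($) s') a = G s a" for a using s'(2) by (simp add: G_def)
    hence "lift_equation_at (lift_equation n v \<sigma> p' f P \<Delta>) s' = 0\<^sub>v d"
      using s(3) by (intro eq_vecI) (auto simp: dim lift_equation_at_index[OF s'(1)])
    moreover have "set\<^sub>v s' \<subseteq> pi_multiples \<pi> (tate n v)"
      using s s' by (auto simp: vec_set_def pi_multiples_tate)
    ultimately have "?sol \<phi>"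
      using s s' \<phi>(3) by (intro bexI[of _ s']) (auto simp: tate_subst_psi_shift shift)
    thus "semilinear_endo n v \<sigma> f \<phi> \<and> lifts_power_map n v \<pi> p' f \<phi> \<and> ?sol \<phi>" using \<phi> by blast
  next
    fix \<phi>' assume \<phi>': "semilinear_endo n v \<sigma> f \<phi>' \<and> lifts_power_map n v \<pi> p' f \<phi>' \<and> ?sol \<phi>'"
    then obtain t where t: "t \<in> carrier_vec d" "set\<^sub>v t \<subseteq> pi_multiples \<pi> (tate n v)"
        "lift_equation_at (lift_equation n v \<sigma> p' f P \<Delta>) t = 0\<^sub>v d"
        "\<And>g. g \<in> tate n v \<Longrightarrow> \<phi>' (?c g) = ?c (tate_subst n v \<sigma> (\<lambda>i. psi_shift n v \<sigma> p' P t $ i) g)"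
      by blast
    have t_mem: "t $ b \<in> tate n v \<inter> fil 1" if "b < d" for b
      using t(1,2) vec_setI[of t b] that by (auto simp: pi_multiples_tate)
    \<comment> \<open>The vector of any competing map is a root divisible by \<pi>, hence equals the
      root found above.\<close>
    have "G (($) t) b = 0" if "b < d" for b
      using lift_equation_at_index[OF t(1) that] t(3) that by simp
    hence "t $ b = s b" if "b < d" for b
      using G_root_unique[of "($) t" s b] t_mem s that by blast
    hence "shift (($) t) = shift s" by (rule shift_eq)
    hence "\<phi>' (?c g) = \<phi> (?c g)" if "g \<in> tate n v" for g
      using t(4)[OF that] \<phi>(3)[OF that] tate_subst_psi_shift[OF t(1) _ that] t_mem by simp
    moreover have "\<phi> \<in> extensional (carrier (tate_quot n v f))" "\<phi>' \<in> extensional (carrier (tate_quot n v f))"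
      using \<phi>(1) \<phi>' by (auto simp: semilinear_endo_def)
    ultimately show "\<phi>' = \<phi>"
      by (intro extensionalityI[of _ "carrier (tate_quot n v f)"]) (auto simp: carrier_tate_quot)
  qed
qed

end

theorem theorem3p11:
  fixes p e n r p' :: nat
    and Qp :: "'k::field_char_0 set" and v :: "'k \<Rightarrow> real" and \<pi> :: 'k and \<sigma> :: "'k \<Rightarrow> 'k"
    and f :: "'k mps vec" and P :: "'k mps mat" and \<Delta> :: "nat \<Rightarrow> 'k mps mat"
  assumes K: "padic_galois_extension p Qp v \<pi> e"
    and p': "\<exists>d>0. p' = p ^ d"
    and \<sigma>: "automorphism_inducing_power v \<pi> p' \<sigma>"
    and r: "r < n"
    and f: "f \<in> carrier_vec (n - r)" "set\<^sub>v f \<subseteq> polys n v"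
    and minors: "Idl\<^bsub>special_fibre n v \<pi> f\<^esub>
        (special_class n v \<pi> f ` maximal_minors (jacobian n f))
          = carrier (special_fibre n v \<pi> f)"
    and P: "P \<in> carrier_mat n (n - r)" "elements_mat P \<subseteq> polys n v"
    and \<Delta>: "\<And>j. j < n - r \<Longrightarrow> \<Delta> j \<in> carrier_mat (n - r) (n - r)"
        "\<And>j. j < n - r \<Longrightarrow> elements_mat (\<Delta> j) \<subseteq> polys n v"
    and congruence: "elements_mat (jacobian n f * P
          - (1\<^sub>m (n - r) + mat (n - r) (n - r) (\<lambda>ab. \<Sum>j<n - r. f $ j * \<Delta> j $$ ab)))
        \<subseteq> pi_multiples \<pi> (polys n v)"
  shows "\<exists>!\<phi>. semilinear_endo n v \<sigma> f \<phi> \<and> lifts_power_map n v \<pi> p' f \<phi> \<and>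
    (\<exists>s\<in>carrier_vec (n - r). set\<^sub>v s \<subseteq> pi_multiples \<pi> (tate n v) \<and>
       lift_equation_at (lift_equation n v \<sigma> p' f P \<Delta>) s = 0\<^sub>v (n - r) \<and>
       (\<forall>g\<in>tate n v. \<phi> (tate_class n v f g)
          = tate_class n v f (tate_subst n v \<sigma> (\<lambda>i. psi_shift n v \<sigma> p' P s $ i) g)))"
proof -
  interpret padic_galois_extension p Qp v \<pi> e by (rule K)
  interpret lift_data p Qp v \<pi> e \<sigma> p' n "n - r" f P \<Delta>
    by unfold_locales (fact \<sigma> p' f P \<Delta> congruence)+
  show ?thesis by (rule unique_lift)
qed

end
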